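(* Let $M=p_i^2p_j^2p_k^2$ with $p_i,p_j,p_k\ge3$ distinct primes, let $A,B\subset\mathbb{Z}_M$ with $A\oplus B=\mathbb{Z}_M$, $|A|=|B|=p_ip_jp_k$, and $\Phi_M\mid A$. Let $\Lambda$ be a $D(M)$-grid with $A\cap\Lambda\ne\emptyset$ such that $A\cap\Lambda$ is not $M$-fibered in any direction, and assume that one of the following holds: (a) $\{m:D(M)\mid m\mid M\}\subset\operatorname{Div}(A\cap\Lambda)$ and $A\cap\Lambda$ contains diagonal boxes; (b) $A\cap\Lambda$ has a full plane structure; (c) $A\cap\Lambda$ has an almost corner structure. Then at least one of the following is true: • the tiling $A\oplus B=\mathbb{Z}_M$ is T2-equivalent to $\Lambda\oplus B=\mathbb{Z}_M$ via fiber shifts; in this case $\Lambda$ is a translate of $A^\flat$ and both $A$ and $B$ satisfy (T2); • the tiling $A\oplus B=\mathbb{Z}_M$ is T2-equivalent to a tiling $A'\oplus B=\mathbb{Z}_M$ such that $A'\cap\Lambda$ contains a $p_\nu$ corner for some $\nu\in\{i,j,k\}$.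
   Context: $A\oplus B=\mathbb{Z}_M$: unique representation $a+b$. Masks $A(X)=\sum_{a\in A}X^a$ mod $X^M-1$; $\Phi_s$ cyclotomic. (T2): with $S_A$ the prime powers $s\mid M$, $\Phi_s\mid A$, any product of elements of $S_A$ that are powers of distinct primes gives a cyclotomic divisor of $A$. $(x,M)$ is the gcd; $\operatorname{Div}(S)=\{(s-s',M):s,s'\in S\}$. $D(M)=p_ip_jp_k$; a $D(M)$-grid is $\Lambda=x_0+D(M)\mathbb{Z}_M$, identified with $\mathbb{Z}_{p_i}\times\mathbb{Z}_{p_j}\times\mathbb{Z}_{p_k}$ via $x_0+l_iM/p_i+l_jM/p_j+l_kM/p_k\leftrightarrow(l_i,l_j,l_k)$. $F_\nu=\{0,M/p_\nu,\dots,(p_\nu-1)M/p_\nu\}$, $x*F_\nu=x+F_\nu$ ($M$-fiber in the $p_\nu$ direction); $x*F_j*F_k=x+F_j+F_k$; $S$ is $M$-fibered in the $p_\nu$ direction if $S=S'+F_\nu$, $S'\subset S$. Diagonal boxes: $A\cap\Lambda\supset(I\times J\times K)\cup(I^c\times J^c\times K^c)$ with $I,J,K$ nonempty proper subsets of $\mathbb{Z}_{p_i},\mathbb{Z}_{p_j},\mathbb{Z}_{p_k}$ and complements $I^c$ etc. Full plane structure: for some labeling $(\alpha,\beta,\gamma)$ of $(i,j,k)$ there is $x\in\Lambda\setminus A$ with $A\cap\Lambda=\{y\in\Lambda:(y-x,M)\in\{M/p_\alpha,M/p_\beta p_\gamma\}\}$. Almost corner structure: for some labeling $(\alpha,\beta,\gamma)$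 of $(i,j,k)$ there are $x_0,\dots,x_{p_\gamma-1}\in\Lambda$ with $(x_l-x_{l'},M)=M/p_\gamma$ for $l\ne l'$ and disjoint sets $\mathcal L_\alpha,\mathcal L_\beta$ with $|\mathcal L_\alpha|,|\mathcal L_\beta|>1$ and $\mathcal L_\alpha\cup\mathcal L_\beta=\{0,\dots,p_\gamma-1\}$, such that $A\cap\Lambda=\{z\in\Lambda:(z-x_l,M)=M/p_\alpha\text{ for some }l\in\mathcal L_\alpha,\text{ or }(z-x_l,M)=M/p_\beta\text{ for some }l\in\mathcal L_\beta\}$. $p_\nu$ corner in $A'\cap\Lambda$: writing $\{\nu,\beta,\gamma\}=\{i,j,k\}$, there exist $a,a_\nu\in A'\cap\Lambda$ with $(a-a_\nu,M)=M/p_\nu$, $A'\cap(a*F_\beta*F_\gamma)=a*F_\beta$ and $A'\cap(a_\nu*F_\beta*F_\gamma)=a_\nu*F_\gamma$. $A^\flat$: with $M_\nu=M/p_\nu^2$ and $\mathfrak A_\nu=\{\alpha\in\{1,2\}:\Phi_{p_\nu^\alpha}\mid A\}$, $A^\flat$ has mask $\prod_\nu\prod_{\alpha\in\mathfrak A_\nu}\sum_{t=0}^{p_\nu-1}X^{tM_\nu p_\nu^{\alpha-1}}$. T2-equivalent: $A$ satisfies (T2) iff $A'$ does (both tiling with $B$). "Via fiber shifts": obtained by finitely many steps each replacing an $M$-fiber $x*F_\nu$ of the current set by $x'*F_\nu$ with $(x-x',M)=M/p_\nu^2$, each intermediate set tiling with $B$. *)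

theory Defs
  imports Complex_Main "HOL-Computational_Algebra.Computational_Algebra"
    "HOL-Number_Theory.Prime_Powers"
begin

definition primitive_roots_unity :: "nat \<Rightarrow> complex set" where
  "primitive_roots_unity n = {z. z ^ n = 1 \<and> (\<forall>m. 0 < m \<and> m < n \<longrightarrow> z ^ m \<noteq> 1)}"

text \<open>
  The polynomial is taken over the integers, so that divisibility of masks below is divisibility
  in \<open>\<int>[X]\<close>. Lemma \<open>of_int_cyclotomic\<close> shows that the description is well defined for \<open>n > 0\<close>.
\<close>
definition cyclotomic :: "nat \<Rightarrow> int poly" where
  "cyclotomic n = (THE f. map_poly of_int f = (\<Prod>z\<in>primitive_roots_unity n. [:- z, 1:]))"

lemma map_poly_of_int_mult:
  "map_poly of_int (f * g) = (map_poly of_int f * map_poly of_int g :: complex poly)"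
  by (rule poly_eqI) (simp add: coeff_map_poly coeff_mult)

lemma map_poly_of_int_add:
  "map_poly of_int (f + g) = (map_poly of_int f + map_poly of_int g :: complex poly)"
  by (rule poly_eqI) (simp add: coeff_map_poly)

lemma map_poly_of_int_prod:
  "map_poly of_int (prod f S) = (\<Prod>x\<in>S. map_poly of_int (f x) :: complex poly)"
  by (induction S rule: infinite_finite_induct) (simp_all add: map_poly_of_int_mult)

lemma inj_map_poly_of_int: "inj (map_poly of_int :: int poly \<Rightarrow> complex poly)"
proof (rule injI)
  fix f g :: "int poly"
  assume eq: "map_poly of_int f = (map_poly of_int g :: complex poly)"
  show "f = g"
  proof (rule poly_eqI)
    fix n
    have "coeff (map_poly of_int f :: complex poly) n = coeff (map_poly of_int g) n"
      using eq by simp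
    then show "coeff f n = coeff g n"
      by (simp add: coeff_map_poly)
  qed
qed

lemma roots_unity_eq_Union:
  assumes "n > 0"
  shows "{z::complex. z ^ n = 1} = (\<Union>d\<in>{d. d dvd n}. primitive_roots_unity d)"
proof (intro equalityI subsetI)
  fix z :: complex
  assume "z \<in> {z. z ^ n = 1}"
  then have zn: "z ^ n = 1" by simp
  define d where "d = (LEAST m. 0 < m \<and> z ^ m = 1)"
  have d: "0 < d \<and> z ^ d = 1"
    unfolding d_def by (rule LeastI[of _ n]) (use zn assms in simp)
  have d_le: "d \<le> m" if "0 < m" "z ^ m = 1" for m
    unfolding d_def by (rule Least_le) (use that in simp)
  have "z ^ n = (z ^ d) ^ (n div d) * z ^ (n mod d)"
    by (simp flip: power_mult power_add)
  also have "\<dots> = z ^ (n mod d)"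
    using d by simp
  finally have "z ^ (n mod d) = 1"
    using zn by simp
  moreover have "n mod d < d"
    using d by simp
  ultimately have "n mod d = 0"
    using d_le[of "n mod d"] by linarith
  then have "d dvd n" by (simp add: dvd_eq_mod_eq_0)
  moreover have "z \<in> primitive_roots_unity d"
    unfolding primitive_roots_unity_def using d d_le leD by blast
  ultimately show "z \<in> (\<Union>d\<in>{d. d dvd n}. primitive_roots_unity d)" by blast
next
  fix z :: complex
  assume "z \<in> (\<Union>d\<in>{d. d dvd n}. primitive_roots_unity d)"
  then obtain d where "d dvd n" "z ^ d = 1"
    unfolding primitive_roots_unity_def by blast
  moreover from this obtain k where "n = d * k" by blast
  ultimately show "z \<in> {z. z ^ n = 1}"
    by (simp add: power_mult)
qed

lemma prod_primitive_roots_unity: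
  assumes "n > 0"
  shows "(\<Prod>d | d dvd n. \<Prod>z\<in>primitive_roots_unity d. [:- z, 1:]) = monom 1 n - 1"
proof -
  let ?R = "{z::complex. z ^ n = 1}"
  have finR: "finite ?R" and cardR: "card ?R = n"
    using assms card_roots_unity_eq[of n] card_ge_0_finite[of ?R] by simp_all
  have fin: "finite {d. d dvd n}" using assms by simp
  have finP: "finite (primitive_roots_unity d)" if "d dvd n" for d
    using that roots_unity_eq_Union[OF assms] finR by (auto intro: finite_subset)
  have disj: "primitive_roots_unity d \<inter> primitive_roots_unity e = {}"
    if "d dvd n" "e dvd n" "d \<noteq> e" for d e
  proof -
    have "0 < d" "0 < e" using that assms by (auto intro: dvd_pos_nat)
    then show ?thesis
      using \<open>d \<noteq> e\<close> unfolding primitive_roots_unity_def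
      by (cases d e rule: linorder_cases) auto
  qed
  have "(\<Prod>d | d dvd n. \<Prod>z\<in>primitive_roots_unity d. [:- z, 1:]) = (\<Prod>z\<in>?R. [:- z, 1:])"
    unfolding roots_unity_eq_Union[OF assms]
    by (rule prod.UNION_disjoint[symmetric]) (use fin finP disj in auto)
  also have "\<dots> = monom 1 n - 1"
  proof -
    let ?f = "\<Prod>z\<in>?R. [:- z, 1:]" and ?g = "monom 1 n - 1 :: complex poly"
    have degf: "degree ?f = n"
      by (subst degree_prod_eq_sum_degree) (use cardR in auto)
    have lcf: "lead_coeff ?f = 1"
      by (simp add: lead_coeff_prod)
    have "degree (?f - ?g) < n" if "?f \<noteq> ?g"
    proof -
      have "degree (?f - ?g) \<le> n"
        using degf assms by (intro degree_diff_le) (auto simp: degree_monom_eq)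
      moreover have "coeff (?f - ?g) n = 0"
        using lcf degf assms by simp
      ultimately show ?thesis
        using that by (metis le_neq_implies_less leading_coeff_0_iff right_minus_eq)
    qed
    moreover have "poly (?f - ?g) z = 0" if "z \<in> ?R" for z
      using that finR by (auto simp: poly_prod poly_monom)
    then have "n \<le> degree (?f - ?g)" if "?f \<noteq> ?g"
    proof -
      have "card ?R \<le> card {z. poly (?f - ?g) z = 0}"
        using that \<open>\<And>z. z \<in> ?R \<Longrightarrow> poly (?f - ?g) z = 0\<close>
        by (intro card_mono poly_roots_finite) auto
      also have "\<dots> \<le> degree (?f - ?g)"
        using that by (intro card_poly_roots_bound) auto
      finally show ?thesis using cardR by simp
    qed
    ultimately show ?thesis by force
  qed
  finally show ?thesis .
qed

lemma ex_cyclotomic: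
  assumes "n > 0"
  shows "\<exists>f::int poly. lead_coeff f = 1 \<and>
           map_poly of_int f = (\<Prod>z\<in>primitive_roots_unity n. [:- z, 1:])"
  using assms
proof (induction n rule: less_induct)
  case (less n)
  let ?C = "\<lambda>d. \<Prod>z\<in>primitive_roots_unity d. [:- z, 1:]"
  let ?h = "map_poly of_int :: int poly \<Rightarrow> complex poly"
  let ?S = "{d. d dvd n \<and> d \<noteq> n}"
  have S: "d < n \<and> 0 < d" if "d \<in> ?S" for d
  proof -
    have "d dvd n" "d \<noteq> n" using that by auto
    with dvd_imp_le[of d n] dvd_pos_nat[of n d] less.prems show ?thesis by linarith
  qed
  have "\<forall>d\<in>?S. \<exists>f. lead_coeff f = 1 \<and> ?h f = ?C d"
    using less.IH S by blast
  from bchoice[OF this] obtain F where F: "lead_coeff (F d) = 1 \<and> ?h (F d) = ?C d"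
    if "d \<in> ?S" for d
    by blast
  define g where "g = prod F ?S"
  have lcg: "lead_coeff g = 1"
    unfolding g_def lead_coeff_prod using F by (intro prod.neutral) blast
  then have g0: "g \<noteq> 0" by auto
  have hg: "?h g = (\<Prod>d\<in>?S. ?C d)"
    unfolding g_def map_poly_of_int_prod by (rule prod.cong) (use F in auto)
  have hg0: "?h g \<noteq> 0"
    using g0 by (subst map_poly_eq_0_iff) auto
  have fin: "finite {d. d dvd n}" using less.prems by simp
  have split: "{d. d dvd n} = insert n ?S" by auto
  have "(monom 1 n - 1 :: complex poly) = (\<Prod>d | d dvd n. ?C d)"
    using prod_primitive_roots_unity[OF less.prems] by simp
  also have "\<dots> = ?C n * ?h g"
  proof -
    have "finite ?S" using fin by (rule rev_finite_subset) auto
    then have "(\<Prod>d\<in>insert n ?S. ?C d) = ?C n * (\<Prod>d\<in>?S. ?C d)"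
      by (rule prod.insert) simp
    then show ?thesis by (simp only: split hg)
  qed
  finally have fact: "monom 1 n - 1 = ?C n * ?h g" .
  obtain q r where qr: "pseudo_divmod (monom 1 n - 1) g = (q, r)"
    by (metis surj_pair)
  have eq: "monom 1 n - 1 = g * q + r"
    using pseudo_divmod(1)[OF g0 qr] lcg by simp
  have deg: "r = 0 \<or> degree r < degree g"
    by (rule pseudo_divmod(2)[OF g0 qr])
  have hM: "?h (monom 1 n - 1) = monom 1 n - 1"
    by (rule poly_eqI) (simp add: coeff_map_poly)
  have degh: "degree (?h f) = degree f" for f
    by (rule degree_map_poly) simp
  have "?h g * ?h q + ?h r = ?C n * ?h g"
    by (simp only: fact[symmetric] hM[symmetric] eq map_poly_of_int_add map_poly_of_int_mult)
  then have hr: "?h r = ?h g * (?C n - ?h q)"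
    by (simp add: algebra_simps)
  have "?C n - ?h q = 0"
  proof (rule ccontr)
    assume nz: "?C n - ?h q \<noteq> 0"
    then have "degree (?h r) = degree (?h g) + degree (?C n - ?h q)"
      unfolding hr using hg0 by (rule degree_mult_eq[rotated])
    then have "degree g \<le> degree r" using degh by simp
    moreover have "?h r \<noteq> 0" unfolding hr using nz hg0 by simp
    then have "r \<noteq> 0" by auto
    ultimately show False using deg by simp
  qed
  then have hq: "?h q = ?C n" by simp
  have "of_int (lead_coeff q) = lead_coeff (?h q)"
    using degh by (simp add: coeff_map_poly)
  also have "\<dots> = 1" unfolding hq by (simp add: lead_coeff_prod)
  finally have "lead_coeff q = 1" by simp
  with hq show ?case by (intro exI[of _ q] conjI)
qed

lemma of_int_cyclotomic:
  assumes "n > 0"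
  shows "map_poly of_int (cyclotomic n) = (\<Prod>z\<in>primitive_roots_unity n. [:- z, 1:])"
proof -
  from ex_cyclotomic[OF assms] obtain f :: "int poly"
    where f: "map_poly of_int f = (\<Prod>z\<in>primitive_roots_unity n. [:- z, 1:])" by blast
  show ?thesis
    unfolding cyclotomic_def
  proof (rule theI)
    show "map_poly of_int f = (\<Prod>z\<in>primitive_roots_unity n. [:- z, 1:])" by (fact f)
    show "g = f" if "map_poly of_int g = (\<Prod>z\<in>primitive_roots_unity n. [:- z, 1:])" for g
      by (rule injD[OF inj_map_poly_of_int]) (rule trans[OF that f[symmetric]])
  qed
qed

text \<open>Elements of \<open>\<int>\<^sub>M\<close> are represented by their residues in \<open>{0..<M}\<close>.\<close>

definition Zmod :: "nat \<Rightarrow> int set" where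
  "Zmod M = {0..<int M}"

definition sumset :: "nat \<Rightarrow> int set \<Rightarrow> int set \<Rightarrow> int set" where
  "sumset M S T = (\<lambda>(s, t). (s + t) mod int M) ` (S \<times> T)"

definition tiling :: "nat \<Rightarrow> int set \<Rightarrow> int set \<Rightarrow> bool" where
  "tiling M A B \<longleftrightarrow> A \<subseteq> Zmod M \<and> B \<subseteq> Zmod M \<and>
     bij_betw (\<lambda>(a, b). (a + b) mod int M) (A \<times> B) (Zmod M)"

definition gcdM :: "nat \<Rightarrow> int \<Rightarrow> nat" where
  "gcdM M x = nat (gcd x (int M))"

definition Div :: "nat \<Rightarrow> int set \<Rightarrow> nat set" where
  "Div M S = {gcdM M (s - s') | s s'. s \<in> S \<and> s' \<in> S}"

text \<open>
  The representative of degree less than \<open>M\<close> of the mask modulo \<open>X\<^sup>M - 1\<close>. Since \<open>cyclotomic s\<close>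
  divides \<open>X\<^sup>M - 1\<close> for \<open>s dvd M\<close>, divisibility by it does not depend on the representative.
\<close>
definition mask_poly :: "int set \<Rightarrow> int poly" where
  "mask_poly A = (\<Sum>a\<in>A. monom 1 (nat a))"

definition SA :: "nat \<Rightarrow> int set \<Rightarrow> nat set" where
  "SA M A = {s. primepow s \<and> s dvd M \<and> cyclotomic s dvd mask_poly A}"

text \<open>
  The products are over nonempty families: the empty one would demand that \<open>X - 1\<close> divides the
  mask, which never holds for nonempty \<open>A\<close>.
\<close>
definition T2 :: "nat \<Rightarrow> int set \<Rightarrow> bool" where
  "T2 M A \<longleftrightarrow>
     (\<forall>Q e. finite Q \<and> Q \<noteq> {} \<and> (\<forall>q\<in>Q. prime q \<and> q ^ e q \<in> SA M A) \<longrightarrow>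
        cyclotomic (\<Prod>q\<in>Q. q ^ e q) dvd mask_poly A)"

text \<open>
  The three directions \<open>i, j, k\<close> are named by the corresponding primes. As these are distinct, a
  labeling of the directions is a triple \<open>(\<alpha>, \<beta>, \<gamma>)\<close> with \<open>{\<alpha>, \<beta>, \<gamma>} = P\<close>, where
  \<open>P = {p\<^sub>i, p\<^sub>j, p\<^sub>k}\<close>.
\<close>

definition grid :: "nat \<Rightarrow> nat \<Rightarrow> int \<Rightarrow> int set" where
  "grid M D x = (\<lambda>t. (x + int D * t) mod int M) ` Zmod M"

definition fiber :: "nat \<Rightarrow> nat \<Rightarrow> int set" where
  "fiber M p = (\<lambda>t. int (t * (M div p))) ` {..<p}"

definition fibered :: "nat \<Rightarrow> nat \<Rightarrow> int set \<Rightarrow> bool" where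
  "fibered M p S \<longleftrightarrow> (\<exists>S'\<subseteq>S. S = sumset M S' (fiber M p))"

definition box ::
  "nat \<Rightarrow> nat \<Rightarrow> nat \<Rightarrow> nat \<Rightarrow> int \<Rightarrow> nat set \<Rightarrow> nat set \<Rightarrow> nat set \<Rightarrow> int set" where
  "box M p\<^sub>i p\<^sub>j p\<^sub>k x I J K =
     {(x + int (l\<^sub>i * (M div p\<^sub>i) + l\<^sub>j * (M div p\<^sub>j) + l\<^sub>k * (M div p\<^sub>k))) mod int M
        | l\<^sub>i l\<^sub>j l\<^sub>k. l\<^sub>i \<in> I \<and> l\<^sub>j \<in> J \<and> l\<^sub>k \<in> K}"

text \<open>
  Changing the base point \<open>x\<close> of the coordinates on \<open>\<Lambda>\<close> only translates \<open>I, J, K\<close>.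
\<close>
definition diagonal_boxes ::
  "nat \<Rightarrow> nat \<Rightarrow> nat \<Rightarrow> nat \<Rightarrow> int set \<Rightarrow> int set \<Rightarrow> bool" where
  "diagonal_boxes M p\<^sub>i p\<^sub>j p\<^sub>k \<Lambda> A \<longleftrightarrow>
     (\<exists>x\<in>\<Lambda>. \<exists>I J K. I \<noteq> {} \<and> I \<subset> {..<p\<^sub>i} \<and> J \<noteq> {} \<and> J \<subset> {..<p\<^sub>j} \<and> K \<noteq> {} \<and> K \<subset> {..<p\<^sub>k} \<and>
        box M p\<^sub>i p\<^sub>j p\<^sub>k x I J K \<union> box M p\<^sub>i p\<^sub>j p\<^sub>k x ({..<p\<^sub>i} - I) ({..<p\<^sub>j} - J) ({..<p\<^sub>k} - K)
          \<subseteq> A \<inter> \<Lambda>)"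

definition full_plane_structure :: "nat \<Rightarrow> nat set \<Rightarrow> int set \<Rightarrow> int set \<Rightarrow> bool" where
  "full_plane_structure M P \<Lambda> A \<longleftrightarrow>
     (\<exists>\<alpha> \<beta> \<gamma>. {\<alpha>, \<beta>, \<gamma>} = P \<and>
        (\<exists>x\<in>\<Lambda> - A. A \<inter> \<Lambda> = {y\<in>\<Lambda>. gcdM M (y - x) \<in> {M div \<alpha>, M div (\<beta> * \<gamma>)}}))"

definition almost_corner_structure :: "nat \<Rightarrow> nat set \<Rightarrow> int set \<Rightarrow> int set \<Rightarrow> bool" where
  "almost_corner_structure M P \<Lambda> A \<longleftrightarrow>
     (\<exists>\<alpha> \<beta> \<gamma>. {\<alpha>, \<beta>, \<gamma>} = P \<and>
        (\<exists>(x :: nat \<Rightarrow> int) L\<^sub>\<alpha> L\<^sub>\<beta>.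
           (\<forall>l<\<gamma>. x l \<in> \<Lambda>) \<and>
           (\<forall>l<\<gamma>. \<forall>l'<\<gamma>. l \<noteq> l' \<longrightarrow> gcdM M (x l - x l') = M div \<gamma>) \<and>
           L\<^sub>\<alpha> \<inter> L\<^sub>\<beta> = {} \<and> card L\<^sub>\<alpha> > 1 \<and> card L\<^sub>\<beta> > 1 \<and> L\<^sub>\<alpha> \<union> L\<^sub>\<beta> = {..<\<gamma>} \<and>
           A \<inter> \<Lambda> = {z\<in>\<Lambda>. (\<exists>l\<in>L\<^sub>\<alpha>. gcdM M (z - x l) = M div \<alpha>) \<or>
                           (\<exists>l\<in>L\<^sub>\<beta>. gcdM M (z - x l) = M div \<beta>)}))"

definition corner :: "nat \<Rightarrow> nat set \<Rightarrow> nat \<Rightarrow> int set \<Rightarrow> int set \<Rightarrow> bool" where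
  "corner M P \<nu> \<Lambda> A \<longleftrightarrow>
     (\<exists>\<beta> \<gamma>. {\<nu>, \<beta>, \<gamma>} = P \<and>
        (\<exists>a\<in>A \<inter> \<Lambda>. \<exists>a\<^sub>\<nu>\<in>A \<inter> \<Lambda>. gcdM M (a - a\<^sub>\<nu>) = M div \<nu> \<and>
           A \<inter> sumset M (sumset M {a} (fiber M \<beta>)) (fiber M \<gamma>) = sumset M {a} (fiber M \<beta>) \<and>
           A \<inter> sumset M (sumset M {a\<^sub>\<nu>} (fiber M \<beta>)) (fiber M \<gamma>) = sumset M {a\<^sub>\<nu>} (fiber M \<gamma>)))"

definition flat_mask :: "nat \<Rightarrow> nat set \<Rightarrow> int set \<Rightarrow> int poly" where
  "flat_mask M P A =
     (\<Prod>\<nu>\<in>P. \<Prod>\<alpha> | \<alpha> \<in> {1, 2} \<and> cyclotomic (\<nu> ^ \<alpha>) dvd mask_poly A.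
        \<Sum>t<\<nu>. monom 1 (t * (M div \<nu>\<^sup>2) * \<nu> ^ (\<alpha> - 1)))"

text \<open>
  \<open>F\<close> is the set \<open>A\<^sup>\<flat>\<close>. Masks are compared modulo \<open>X\<^sup>M - 1\<close>, which determines \<open>F\<close> because masks
  of subsets of \<open>{0..<M}\<close> have degree less than \<open>M\<close>.
\<close>
definition is_flat :: "nat \<Rightarrow> nat set \<Rightarrow> int set \<Rightarrow> int set \<Rightarrow> bool" where
  "is_flat M P A F \<longleftrightarrow> F \<subseteq> Zmod M \<and> (monom 1 M - 1) dvd (mask_poly F - flat_mask M P A)"

definition T2_equivalent :: "nat \<Rightarrow> int set \<Rightarrow> int set \<Rightarrow> int set \<Rightarrow> bool" where
  "T2_equivalent M B A A' \<longleftrightarrow> tiling M A B \<and> tiling M A' B \<and> (T2 M A \<longleftrightarrow> T2 M A')"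

definition fiber_shift :: "nat \<Rightarrow> nat set \<Rightarrow> int set \<Rightarrow> int set \<Rightarrow> int set \<Rightarrow> bool" where
  "fiber_shift M P B S S' \<longleftrightarrow>
     (\<exists>\<nu>\<in>P. \<exists>x\<in>Zmod M. \<exists>x'\<in>Zmod M.
        gcdM M (x - x') = M div \<nu>\<^sup>2 \<and>
        sumset M {x} (fiber M \<nu>) \<subseteq> S \<and>
        S' = (S - sumset M {x} (fiber M \<nu>)) \<union> sumset M {x'} (fiber M \<nu>) \<and>
        tiling M S' B)"

definition T2_equivalent_via_fiber_shifts ::
  "nat \<Rightarrow> nat set \<Rightarrow> int set \<Rightarrow> int set \<Rightarrow> int set \<Rightarrow> bool" where
  "T2_equivalent_via_fiber_shifts M P B A A' \<longleftrightarrow>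
     T2_equivalent M B A A' \<and> (fiber_shift M P B)\<^sup>*\<^sup>* A A'"

end

theory Submission
  imports Defs "HOL-Number_Theory.Cong"
begin

text \<open>
  Classify a difference \<open>d\<close> modulo \<open>M\<close> by its type: for each of the three primes \<open>p\<close>, whether \<open>p\<close>
  and \<open>p\<^sup>2\<close> divide \<open>d\<close>. By Tijdeman's theorem no type other than that of \<open>0\<close> occurs both in
  \<open>A - A\<close> and in \<open>B - B\<close>. For a base point \<open>b0\<close> in \<open>B\<close> and \<open>x\<close> in \<open>\<Lambda>\<close> write \<open>x + b0 = a + b\<close>;
  the types of \<open>b - b0\<close> are severely restricted by the elements of \<open>A \<inter> \<Lambda>\<close> near \<open>x\<close>, and a line of
  \<open>\<Lambda>\<close> that lands, for every \<open>b0\<close>, on a translate by a multiple of \<open>M / p\<^sup>2\<close> can be shifted back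
  without destroying the tiling.

  If \<open>B\<close> meets every \<open>D(M)\<close>-grid once and \<open>A \<inter> \<Lambda>\<close> contains diagonal boxes, every point of
  \<open>\<Lambda> - A\<close> lies on such a line, so \<open>A\<close> is moved to \<open>\<Lambda>\<close> line by line. A full plane or an almost
  corner offers, for each base point, only two kinds of lines through its center. Lines of both kinds
  cannot coexist, because \<open>A\<close> has at most \<open>|A| / p\<close> elements in a residue class modulo \<open>p\<^sup>2\<close>; and
  shifting one line through the center produces a corner, except in one case where again \<open>B\<close> meets
  every grid once and the almost corner is a pair of diagonal boxes.
\<close>

section \<open>Points of a grid and their landing fibers\<close>

text \<open>Shifting is delicate because the displacement of a line depends on the base point in
  \<open>B\<close>. A line may be moved only when every base point displaces it in the same
  direction. The displacements then agree modulo \<open>p\<close>, the elements of \<open>B\<close>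
  used for the various base points form a permutation of \<open>B\<close>, and the mask of
  \<open>B\<close> vanishes at the primitive \<open>p\<close>-th roots of unity. The last fact also
  protects (T2): a shift changes the mask of \<open>A\<close> only at roots whose order is divisible
  by \<open>p\<close> but not by \<open>p\<^sup>2\<close>, and such orders do not arise among the
  products in (T2).

  The divisor condition in (a) says that all types vanishing modulo the three primes already occur
  in \<open>A \<inter> \<Lambda>\<close>. Hence \<open>B\<close> is injective modulo
  \<open>D(M)\<close>, and \<open>|B| = D(M)\<close> puts one element in each class.

  The plane bound rests on \<open>|A|\<close> containing each prime once: exactly one of the
  cyclotomic polynomials of order \<open>p\<close> and \<open>p\<^sup>2\<close> divides the mask of
  \<open>A\<close>, and either of them limits a class modulo \<open>p\<^sup>2\<close>.\<close>

definition eq1 :: "nat \<Rightarrow> int \<Rightarrow> int \<Rightarrow> bool" where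
  "eq1 p x y \<longleftrightarrow> int p dvd x - y"

definition eq2 :: "nat \<Rightarrow> int \<Rightarrow> int \<Rightarrow> bool" where
  "eq2 p x y \<longleftrightarrow> (int p)\<^sup>2 dvd x - y"

lemma eq1_refl [simp]: "eq1 p x x" by (simp add: eq1_def)
lemma eq2_refl [simp]: "eq2 p x x" by (simp add: eq2_def)
lemma eq1_sym: "eq1 p x y \<Longrightarrow> eq1 p y x" by (simp add: eq1_def dvd_diff_commute)
lemma eq2_sym: "eq2 p x y \<Longrightarrow> eq2 p y x" by (simp add: eq2_def dvd_diff_commute)
lemma eq1_trans: "eq1 p x y \<Longrightarrow> eq1 p y z \<Longrightarrow> eq1 p x z"
  unfolding eq1_def using dvd_add[of "int p" "x - y" "y - z"] by simp
lemma eq2_trans: "eq2 p x y \<Longrightarrow> eq2 p y z \<Longrightarrow> eq2 p x z"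
  unfolding eq2_def using dvd_add[of "(int p)\<^sup>2" "x - y" "y - z"] by simp
lemma eq2_imp_eq1: "eq2 p x y \<Longrightarrow> eq1 p x y"
  unfolding eq1_def eq2_def by (metis dvd_mult_left power2_eq_square)
lemma eq1_left: "eq1 p y v \<Longrightarrow> eq1 p y w \<longleftrightarrow> eq1 p v w"
  by (blast intro: eq1_trans dest: eq1_sym)
lemma eq1_right: "eq1 p y v \<Longrightarrow> eq1 p w y \<longleftrightarrow> eq1 p w v"
  by (blast intro: eq1_trans dest: eq1_sym)
lemma eq2_left: "eq2 p y v \<Longrightarrow> eq2 p y w \<longleftrightarrow> eq2 p v w"
  by (blast intro: eq2_trans dest: eq2_sym)
lemma eq2_right: "eq2 p y v \<Longrightarrow> eq2 p w y \<longleftrightarrow> eq2 p w v"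
  by (blast intro: eq2_trans dest: eq2_sym)
lemma eq1_diff: "eq1 p x y \<Longrightarrow> eq1 p u v \<Longrightarrow> eq1 p (x - u) (y - v)"
  unfolding eq1_def using dvd_diff[of "int p" "x - y" "u - v"] by (simp add: algebra_simps)
lemma eq2_diff: "eq2 p x y \<Longrightarrow> eq2 p u v \<Longrightarrow> eq2 p (x - u) (y - v)"
  unfolding eq2_def using dvd_diff[of "(int p)\<^sup>2" "x - y" "u - v"] by (simp add: algebra_simps)

section \<open>Three odd primes and simultaneous congruences modulo their squares\<close>

locale prime_triple =
  fixes P :: "nat set"
  assumes card_P: "card P = 3"
    and prime_P: "p \<in> P \<Longrightarrow> prime p"
    and ge_3: "p \<in> P \<Longrightarrow> p \<ge> 3"
begin

definition labels :: "nat \<Rightarrow> nat \<Rightarrow> nat \<Rightarrow> bool" where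
  "labels i j k \<longleftrightarrow> P = {i, j, k} \<and> i \<noteq> j \<and> i \<noteq> k \<and> j \<noteq> k"

lemma labels_perm:
  assumes "labels i j k"
  shows "labels j i k" "labels i k j" "labels k j i" "labels j k i" "labels k i j"
  using assms unfolding labels_def by auto

lemma labels_obtain:
  assumes "i \<in> P"
  obtains j k where "labels i j k"
proof -
  have "card (P - {i}) = 2" using assms card_P by simp
  then obtain j k where "P - {i} = {j, k}" "j \<noteq> k" by (auto simp: card_2_iff)
  then have "labels i j k" using assms unfolding labels_def by auto
  then show ?thesis by (rule that)
qed

lemma labels_coprime:
  assumes "labels i j k"
  shows "coprime ((int i)\<^sup>2) ((int j)\<^sup>2)" "coprime ((int i)\<^sup>2) ((int k)\<^sup>2)" "coprime ((int j)\<^sup>2) ((int k)\<^sup>2)"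
  using assms prime_P unfolding labels_def by (auto simp: primes_coprime)

lemma labels_ball: "labels i j k \<Longrightarrow> (\<forall>p\<in>P. Q p) \<longleftrightarrow> Q i \<and> Q j \<and> Q k"
  unfolding labels_def by auto

lemma labels_mem: "labels i j k \<Longrightarrow> i \<in> P \<and> j \<in> P \<and> k \<in> P"
  unfolding labels_def by auto

lemma crt:
  assumes "labels i j k"
  obtains w where "eq2 i w x" "eq2 j w y" "eq2 k w z"
proof -
  note c = labels_coprime[OF assms]
  obtain u where u: "[u = x] (mod (int i)\<^sup>2)" "[u = y] (mod (int j)\<^sup>2)"
    using binary_chinese_remainder_int[OF c(1)] by blast
  have "coprime ((int i)\<^sup>2 * (int j)\<^sup>2) ((int k)\<^sup>2)"
    using c by simp
  then obtain w where w: "[w = u] (mod (int i)\<^sup>2 * (int j)\<^sup>2)" "[w = z] (mod (int k)\<^sup>2)"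
    using binary_chinese_remainder_int by blast
  have "[w = x] (mod (int i)\<^sup>2)"
    using cong_modulus_mult[OF w(1)] u cong_trans by blast
  moreover have "[w = y] (mod (int j)\<^sup>2)"
    using w(1) u by (metis cong_modulus_mult cong_trans mult.commute)
  ultimately have "[w = x] (mod (int i)\<^sup>2)" "[w = y] (mod (int j)\<^sup>2)" by auto
  with w show ?thesis
    by (intro that) (auto simp: eq2_def cong_iff_dvd_diff)
qed

end

text \<open>\<open>A\<close> is the periodic extension of a tile to all integers, whereas
  \<open>B\<close> stays a set of representatives, so that equality in \<open>B\<close> is plain
  equality. The two families of equivalences in \<open>sands\<close> say that \<open>m - n\<close>
  and \<open>b - b'\<close> have the same type, which amounts to the same gcd with the
  modulus.\<close>

locale tiling_core = prime_triple +
  fixes A :: "int \<Rightarrow> bool" and B :: "int set"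
  assumes cover: "\<exists>b\<in>B. A (n - b)"
    and periodic: "A m \<Longrightarrow> (\<And>p. p \<in> P \<Longrightarrow> eq2 p n m) \<Longrightarrow> A n"
    and sands: "A m \<Longrightarrow> A n \<Longrightarrow> b \<in> B \<Longrightarrow> b' \<in> B \<Longrightarrow>
        (\<And>p. p \<in> P \<Longrightarrow> eq1 p m n \<longleftrightarrow> eq1 p b b') \<Longrightarrow>
        (\<And>p. p \<in> P \<Longrightarrow> eq2 p m n \<longleftrightarrow> eq2 p b b') \<Longrightarrow> b = b'"

locale grid_core = tiling_core +
  fixes x0 :: int
begin

text \<open>The full preimage in the integers of the \<open>D(M)\<close>-grid through
  \<open>x0\<close>, as \<open>D(M)\<close> is the product of the primes in
  \<open>P\<close>.\<close>

definition Lam :: "int \<Rightarrow> bool" where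
  "Lam x \<longleftrightarrow> (\<forall>p\<in>P. eq1 p x x0)"

lemma Lam_eq1: "Lam x \<Longrightarrow> Lam y \<Longrightarrow> p \<in> P \<Longrightarrow> eq1 p x y"
  unfolding Lam_def by (meson eq1_sym eq1_trans)

lemma LamI:
  assumes "labels i j k" "eq1 i w x" "eq1 j w y" "eq1 k w z" "Lam x" "Lam y" "Lam z"
  shows "Lam w"
proof -
  have "eq1 p w x0" if p: "p \<in> P" for p
  proof -
    consider "p = i" | "p = j" | "p = k" using p assms(1) unfolding labels_def by blast
    then show ?thesis
      using assms(2-) p by cases (metis Lam_def eq1_trans)+
  qed
  then show ?thesis unfolding Lam_def by blast
qed

lemma crt_Lam:
  assumes "labels i j k" "Lam x" "Lam y" "Lam z"
  obtains w where "Lam w" "eq2 i w x" "eq2 j w y" "eq2 k w z"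
proof -
  obtain w where w: "eq2 i w x" "eq2 j w y" "eq2 k w z" using crt[OF assms(1)] by blast
  have "Lam w"
    using LamI[OF assms(1) w[THEN eq2_imp_eq1] assms(2-4)] .
  with w show ?thesis using that by blast
qed

text \<open>This is where \<open>p \<ge> 3\<close> enters.\<close>

lemma third_point:
  assumes "p \<in> P" "Lam x"
  obtains w where "Lam w" "\<not> eq2 p w y" "\<not> eq2 p w z" "\<And>q. q \<in> P \<Longrightarrow> q \<noteq> p \<Longrightarrow> eq2 q w x"
proof -
  obtain j k where l: "labels p j k" using labels_obtain[OF assms(1)] by blast
  have p: "prime p" "p \<ge> 3" using assms prime_P ge_3 by auto
  have n: "\<not> (int p)\<^sup>2 dvd int p" "\<not> (int p)\<^sup>2 dvd 2 * int p"
  proof -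
    have "int p < (int p)\<^sup>2" "2 * int p < (int p)\<^sup>2" using p by (auto simp: power2_eq_square)
    then show "\<not> (int p)\<^sup>2 dvd int p" "\<not> (int p)\<^sup>2 dvd 2 * int p"
      using p zdvd_not_zless by (auto simp del: of_nat_less_iff)
  qed
  \<comment> \<open>Three pairwise distinct points of one line cannot all be excluded by two
    residues.\<close>
  have d: "\<not> eq2 p x (x + int p)" "\<not> eq2 p x (x + 2 * int p)" "\<not> eq2 p (x + int p) (x + 2 * int p)"
    using n by (auto simp: eq2_def)
  have "\<exists>v\<in>{x, x + int p, x + 2 * int p}. \<not> eq2 p v y \<and> \<not> eq2 p v z"
  proof (rule ccontr)
    assume "\<not> ?thesis"
    then have "eq2 p x y \<or> eq2 p x z" "eq2 p (x + int p) y \<or> eq2 p (x + int p) z"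
      "eq2 p (x + 2 * int p) y \<or> eq2 p (x + 2 * int p) z" by auto
    then show False using d by (elim disjE) (blast dest: eq2_sym intro: eq2_trans)+
  qed
  then obtain v where v: "v \<in> {x, x + int p, x + 2 * int p}" "\<not> eq2 p v y" "\<not> eq2 p v z" by blast
  obtain w where w: "eq2 p w v" "eq2 j w x" "eq2 k w x" using crt[OF l] by blast
  have "eq1 p v x" using v(1) by (auto simp: eq1_def)
  then have "Lam w"
    using LamI[OF l eq1_trans[OF eq2_imp_eq1[OF w(1)]] w(2,3)[THEN eq2_imp_eq1] assms(2,2,2)] by blast
  moreover have "\<not> eq2 p w y" "\<not> eq2 p w z" using w v by (meson eq2_sym eq2_trans)+
  moreover have "eq2 q w x" if "q \<in> P" "q \<noteq> p" for q
    using that w l unfolding labels_def by auto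
  ultimately show ?thesis using that by blast
qed

text \<open>Seen from the base point \<open>b0\<close>, the point \<open>x\<close> lands at
  \<open>a\<close>. Since \<open>x - a = b - b0\<close>, the displacement of \<open>x\<close> is a
  difference in \<open>B\<close>, and its type is restricted by the differences in
  \<open>A\<close>.\<close>

definition land :: "int \<Rightarrow> int \<Rightarrow> int \<Rightarrow> int \<Rightarrow> bool" where
  "land b0 x a b \<longleftrightarrow> b0 \<in> B \<and> b \<in> B \<and> A a \<and> a + b = x + b0"

lemma land_ex: assumes "b0 \<in> B" obtains a b where "land b0 x a b"
proof -
  obtain b where "b \<in> B" "A (x + b0 - b)" using cover by blast
  then have "land b0 x (x + b0 - b) b" using assms unfolding land_def by simp
  then show ?thesis by (rule that)
qed

lemma land_self: "b0 \<in> B \<Longrightarrow> A x \<Longrightarrow> land b0 x x b0"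
  unfolding land_def by simp

lemma land_diff: "land b0 x a b \<Longrightarrow> b - b0 = x - a"
  unfolding land_def by linarith

lemma land_eq1: "land b0 x a b \<Longrightarrow> eq1 p b b0 \<longleftrightarrow> eq1 p a x"
  unfolding eq1_def by (simp add: land_diff dvd_diff_commute)

lemma land_eq2: "land b0 x a b \<Longrightarrow> eq2 p b b0 \<longleftrightarrow> eq2 p a x"
  unfolding eq2_def by (simp add: land_diff dvd_diff_commute)

text \<open>Two landings give \<open>a - a' = b' - b\<close>, a difference common to both
  factors.\<close>

lemma land_unique:
  assumes "land b0 x a b" "land b0 x a' b'"
  shows "a = a'" "b = b'"
proof -
  have "a - a' = b' - b" using assms unfolding land_def by simp
  then have "b = b'"
    using assms sands[of a a' b' b] unfolding land_def eq1_def eq2_def by metis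
  then show "a = a'" "b = b'" using assms unfolding land_def by auto
qed

text \<open>All points of the grid agree modulo the primes, so \<open>a - y\<close> and
  \<open>a - x\<close> can differ in type only modulo the squares. If they do not, the difference
  \<open>a - y\<close> in \<open>A\<close> has the type of \<open>b - b0\<close>.\<close>

lemma land_sands:
  assumes "land b0 x a b" "Lam x" "Lam y" "A y"
    "\<And>p. p \<in> P \<Longrightarrow> eq2 p a y \<longleftrightarrow> eq2 p a x"
  shows "a = x"
proof -
  have "eq1 p a y \<longleftrightarrow> eq1 p a x" if "p \<in> P" for p
    using Lam_eq1[OF assms(2,3) that] by (meson eq1_sym eq1_trans)
  then have "b = b0"
    using assms land_eq1[OF assms(1)] land_eq2[OF assms(1)] unfolding land_def
    by (intro sands[of a y]) auto
  then show ?thesis using assms(1) unfolding land_def by simp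
qed

text \<open>In \<open>a - a' = (x - y) - (b - b')\<close> the first bracket is divisible by every
  prime. At a prime \<open>q\<close> with \<open>q\<^sup>2\<close> dividing \<open>x - y\<close>, or
  with \<open>b\<close> and \<open>b'\<close> distinct modulo \<open>q\<close>, the differences
  \<open>a - a'\<close> and \<open>b - b'\<close> behave alike. If this held at all primes, the
  types would coincide.\<close>

lemma pair:
  assumes "land b0 x a b" "land b0 y a' b'" "Lam x" "Lam y" "p \<in> P" "\<not> eq2 p x y"
  obtains q where "q \<in> P" "\<not> eq2 q x y" "eq1 q b b'" 
proof (rule ccontr)
  assume "\<not> thesis"
  then have n: "\<And>q. q \<in> P \<Longrightarrow> eq2 q x y \<or> \<not> eq1 q b b'" using that by blast
  have e: "a - a' = (x - y) - (b - b')" using assms unfolding land_def by simp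
  have 1: "eq1 q a a' \<longleftrightarrow> eq1 q b b'" if "q \<in> P" for q
    using Lam_eq1[OF assms(3,4) that] unfolding eq1_def e 
    by (metis dvd_diff_right_iff dvd_diff_commute)
  have 2: "eq2 q a a' \<longleftrightarrow> eq2 q b b'" if "q \<in> P" for q
  proof (cases "eq2 q x y")
    case True
    then show ?thesis unfolding eq2_def e by (metis dvd_diff_right_iff dvd_diff_commute)
  next
    case False
    then show ?thesis using n[OF that] 1[OF that] eq2_imp_eq1 by blast
  qed
  have "b = b'" using assms 1 2 unfolding land_def by (intro sands[of a a']) auto
  then show False using n[OF assms(5)] assms(6) by simp
qed

text \<open>The case in which the second point lands on itself, so that
  \<open>b' = b0\<close>.\<close>

lemma pair_A:
  assumes "land b0 x a b" "A y" "Lam x" "Lam y" "p \<in> P" "\<not> eq2 p x y"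
  obtains q where "q \<in> P" "\<not> eq2 q x y" "eq1 q a x" 
proof -
  have "land b0 y y b0" using land_self assms unfolding land_def by blast
  from pair[OF assms(1) this assms(3-6)] show ?thesis using that land_eq1[OF assms(1)] by blast
qed

text \<open>If \<open>a\<close> left the position of \<open>x\<close> in direction \<open>p\<close>,
  then by \<open>land_sands\<close> each point of \<open>A\<close> on this line would have to share
  the \<open>p\<close>-coordinate of \<open>a\<close>, which two distinct points cannot do.\<close>

lemma two_points:
  assumes l: "land b0 x a b" and L: "Lam x" "Lam y" "Lam z" and A: "A y" "A z" and p: "p \<in> P"
    and ne: "\<not> eq2 p y z" and line: "\<And>q. q \<in> P \<Longrightarrow> q \<noteq> p \<Longrightarrow> eq2 q x y \<and> eq2 q x z"
  shows "eq2 p a x"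
proof (rule ccontr)
  assume n: "\<not> eq2 p a x"
  then have ax: "a \<noteq> x" by auto
  have *: "eq2 p a u" if u: "Lam u" "A u" "\<And>q. q \<in> P \<Longrightarrow> q \<noteq> p \<Longrightarrow> eq2 q x u" for u
  proof (rule ccontr)
    assume "\<not> eq2 p a u"
    then have "eq2 q a u \<longleftrightarrow> eq2 q a x" if "q \<in> P" for q
      using n u(3)[of q] \<open>q \<in> P\<close> by (cases "q = p") (auto intro: eq2_trans eq2_sym)
    then show False using land_sands[OF l L(1) u(1,2)] ax by blast
  qed
  have "eq2 p a y" "eq2 p a z" using *[of y] *[of z] L A line by blast+
  then show False using ne eq2_sym eq2_trans by blast
qed

lemma sands3:
  assumes "labels i j k" "land b0 x a b" "A m" "A n"
    "eq1 i m n \<longleftrightarrow> eq1 i a x" "eq1 j m n \<longleftrightarrow> eq1 j a x" "eq1 k m n \<longleftrightarrow> eq1 k a x"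
    "eq2 i m n \<longleftrightarrow> eq2 i a x" "eq2 j m n \<longleftrightarrow> eq2 j a x" "eq2 k m n \<longleftrightarrow> eq2 k a x"
  shows "a = x"
proof -
  have P: "P = {i, j, k}" using assms(1) unfolding labels_def by blast
  have "b = b0"
    using assms(2-) land_eq1[OF assms(2)] land_eq2[OF assms(2)] unfolding land_def
    by (intro sands[of m n]) (auto simp: P)
  then show ?thesis using land_diff[OF assms(2)] by simp
qed

text \<open>Only the primes modulo which \<open>a\<close> and \<open>x\<close> agree need attention:
  at the others \<open>a\<close> differs from \<open>y\<close> already modulo the prime, so neither
  square divides.\<close>

lemma land_sands_labels:
  assumes "labels i j k" "land b0 x a b" "Lam x" "Lam y" "A y"
    "eq1 i a x \<Longrightarrow> eq2 i a y \<longleftrightarrow> eq2 i a x" "eq1 j a x \<Longrightarrow> eq2 j a y \<longleftrightarrow> eq2 j a x"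
    "eq1 k a x \<Longrightarrow> eq2 k a y \<longleftrightarrow> eq2 k a x"
  shows "a = x"
proof (rule land_sands[OF assms(2-5)])
  fix p assume p: "p \<in> P"
  have "eq1 p a y \<longleftrightarrow> eq1 p a x" using eq1_right[OF Lam_eq1[OF assms(3,4) p]] by simp
  then show "eq2 p a y \<longleftrightarrow> eq2 p a x"
    using p assms(1,6-) eq2_imp_eq1[of p a x] eq2_imp_eq1[of p a y] unfolding labels_def by blast
qed

lemma land_sands0:
  assumes "labels i j k" "land b0 x a b" "Lam x" "Lam y" "A y" "\<not> eq1 i a x"
    "eq2 j a y \<longleftrightarrow> eq2 j a x" "eq2 k a y \<longleftrightarrow> eq2 k a x"
  shows False
  using land_sands_labels[OF assms(1-5)] assms(6-) eq1_refl by blast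

lemma sands0:
  assumes "labels i j k" "land b0 x a b" "A m" "A n" "\<not> eq1 i a x" "\<not> eq1 i m n"
    "eq1 j a x" "eq1 k a x" "eq1 j m n" "eq1 k m n"
    "eq2 j m n \<longleftrightarrow> eq2 j a x" "eq2 k m n \<longleftrightarrow> eq2 k a x"
  shows False
  using sands3[OF assms(1-4)] assms eq2_imp_eq1 eq1_refl by blast

text \<open>The whole line of \<open>x\<close> in direction \<open>\<nu>\<close> is obtained from a fiber in \<open>A\<close> by one step of
  length \<open>M / \<nu>\<^sup>2\<close>, seen from the base point \<open>b0\<close> of \<open>B\<close>.\<close>

definition shifts :: "int \<Rightarrow> nat \<Rightarrow> int \<Rightarrow> bool" where
  "shifts b0 \<nu> x \<longleftrightarrow> (\<exists>b\<in>B. \<not> eq1 \<nu> b b0 \<and> (\<forall>q\<in>P - {\<nu>}. eq2 q b b0) \<and>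
      (\<forall>y. eq1 \<nu> y x \<and> (\<forall>q\<in>P - {\<nu>}. eq2 q y x) \<longrightarrow> A (y - (b - b0))))"

end

section \<open>Grids containing diagonal boxes\<close>

text \<open>\<open>U p x\<close> says that the \<open>p\<close>-coordinate of \<open>x\<close>
  belongs to the chosen side \<open>I\<close>, \<open>J\<close> or \<open>K\<close>. The last two
  assumptions together give one element of \<open>B\<close> in each class modulo
  \<open>D(M)\<close>.\<close>

locale box_core = grid_core +
  fixes U :: "nat \<Rightarrow> int \<Rightarrow> bool"
  assumes U_cong: "p \<in> P \<Longrightarrow> eq2 p x y \<Longrightarrow> U p x \<longleftrightarrow> U p y"
    and U_ex: "p \<in> P \<Longrightarrow> \<exists>x. Lam x \<and> U p x"
    and U_ex': "p \<in> P \<Longrightarrow> \<exists>x. Lam x \<and> \<not> U p x"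
    and boxes: "Lam x \<Longrightarrow> (\<forall>p\<in>P. U p x) \<or> (\<forall>p\<in>P. \<not> U p x) \<Longrightarrow> A x"
    and B_inj: "b \<in> B \<Longrightarrow> b' \<in> B \<Longrightarrow> (\<And>p. p \<in> P \<Longrightarrow> eq1 p b b') \<Longrightarrow> b = b'"
    and B_surj: "\<exists>b\<in>B. \<forall>p\<in>P. eq1 p b n"
begin

text \<open>Complementing all three sides only exchanges the two boxes. This halves later case
  distinctions about the side on which a coordinate lies.\<close>

lemma complement: "box_core P A B x0 (\<lambda>p x. \<not> U p x)"
proof unfold_locales
  show "(\<not> U p x) = (\<not> U p y)" if "p \<in> P" "eq2 p x y" for p x y using U_cong[OF that] by simp
  show "\<exists>x. Lam x \<and> \<not> U p x" if "p \<in> P" for p using U_ex' that .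
  show "\<exists>x. Lam x \<and> \<not> \<not> U p x" if "p \<in> P" for p using U_ex that by simp
  show "A x" if "Lam x" "(\<forall>p\<in>P. \<not> U p x) \<or> (\<forall>p\<in>P. \<not> \<not> U p x)" for x
    using boxes that by blast
  show "b = b'" if "b \<in> B" "b' \<in> B" "\<And>p. p \<in> P \<Longrightarrow> eq1 p b b'" for b b'
    using B_inj that .
  show "\<exists>b\<in>B. \<forall>p\<in>P. eq1 p b n" for n by (rule B_surj)
qed

lemma point:
  assumes "labels i j k" "Lam x" "Lam y" "Lam z"
  obtains w where "Lam w" "eq2 i w x" "eq2 j w y" "eq2 k w z"
    "U i w \<longleftrightarrow> U i x" "U j w \<longleftrightarrow> U j y" "U k w \<longleftrightarrow> U k z"
    "U i x = U j y \<Longrightarrow> U j y = U k z \<Longrightarrow> A w"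
proof -
  obtain w where w: "Lam w" "eq2 i w x" "eq2 j w y" "eq2 k w z" by (rule crt_Lam[OF assms])
  moreover have U: "U i w \<longleftrightarrow> U i x" "U j w \<longleftrightarrow> U j y" "U k w \<longleftrightarrow> U k z"
    using w U_cong labels_mem[OF assms(1)] by blast+
  moreover have "A w" if "U i x = U j y" "U j y = U k z"
    using boxes[OF w(1)] U that by (auto simp: labels_ball[OF assms(1)])
  ultimately show ?thesis by (rule that)
qed

lemma eq1_none:
  assumes "land b0 x a b" "\<And>p. p \<in> P \<Longrightarrow> eq1 p a x"
  shows "a = x"
proof -
  have "b = b0"
    using assms(1) assms(2)[folded land_eq1[OF assms(1)]] unfolding land_def by (intro B_inj) auto
  then show ?thesis using land_diff[OF assms(1)] by simp
qed

text \<open>A direction in which the landing leaves even the residue modulo the prime. A missing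
  point turns out to have exactly one, and it does not depend on \<open>b0\<close>.\<close>

definition dir :: "int \<Rightarrow> nat \<Rightarrow> int \<Rightarrow> bool" where
  "dir b0 i x \<longleftrightarrow> i \<in> P \<and> Lam x \<and> (\<exists>a b. land b0 x a b \<and> \<not> eq1 i a x)"

lemma dir_land: "dir b0 i x \<Longrightarrow> land b0 x a b \<Longrightarrow> \<not> eq1 i a x"
  unfolding dir_def using land_unique by blast

lemma dir_not_A: "dir b0 i x \<Longrightarrow> \<not> A x"
  unfolding dir_def using land_self land_unique(1) eq1_refl unfolding land_def by blast

text \<open>Moving the odd coordinate \<open>k\<close> alone to the other side leads to a point of
  \<open>A\<close>, and so does moving \<open>i\<close> and \<open>j\<close>. In each case
  \<open>pair_A\<close> yields a preserved residue among the coordinates that were moved.\<close>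

lemma dir_ex1_aux:
  assumes l: "labels i j k" and a: "land b0 x a b" and x: "Lam x"
    and U: "U i x = U j x" "U k x \<noteq> U j x"
  shows "eq1 k a x" "eq1 i a x \<or> eq1 j a x"
proof -
  note P = labels_mem[OF l]
  obtain u where u: "Lam u" "U k u = U i x" using U_ex U_ex' P by metis
  obtain v where v: "Lam v" "U i v = U k x" using U_ex U_ex' P by metis
  obtain v' where v': "Lam v'" "U j v' = U k x" using U_ex U_ex' P by metis
  obtain y where y: "Lam y" "eq2 i y x" "eq2 j y x" "U k y = U k u" "A y"
    using point[OF l x x u(1)] u U by metis
  obtain z where z: "Lam z" "eq2 k z x" "A z" "U i z = U i v"
    using point[OF l v(1) v'(1) x] v v' by metis
  have "\<not> eq2 k x y" using U_cong[of k x y] P y u U by auto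
  from pair_A[OF a y(5) x y(1) _ this] obtain q where "q \<in> P" "\<not> eq2 q x y" "eq1 q a x"
    using P by blast
  then show "eq1 k a x" using y eq2_sym l unfolding labels_def by blast
  have "\<not> eq2 i x z" using U_cong[of i x z] P z v U by auto
  from pair_A[OF a z(3) x z(1) _ this] obtain q where "q \<in> P" "\<not> eq2 q x z" "eq1 q a x"
    using P by blast
  then show "eq1 i a x \<or> eq1 j a x" using z eq2_sym l unfolding labels_def by blast
qed

text \<open>A missing point lies in neither box, so two of its coordinates are on one side and the
  third on the other. At most one residue changes by \<open>dir_ex1_aux\<close>, and at least one by
  injectivity of \<open>B\<close> modulo \<open>D(M)\<close>.\<close>

lemma dir_ex1:
  assumes "land b0 x a b" "Lam x" "\<not> A x"
  obtains i where "i \<in> P" "\<not> eq1 i a x" "\<And>q. q \<in> P \<Longrightarrow> q \<noteq> i \<Longrightarrow> eq1 q a x"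
proof -
  obtain p where "p \<in> P" using card_P by fastforce
  then obtain i j k where l: "labels i j k" using labels_obtain by metis
  have n: "\<not> (U i x = U j x \<and> U j x = U k x)"
    using boxes[OF assms(2)] assms(3) by (auto simp: labels_ball[OF l])
  have "\<exists>i j k. labels i j k \<and> U i x = U j x \<and> U k x \<noteq> U j x"
    using n l labels_perm[OF l] by (cases "U i x"; cases "U j x"; cases "U k x") blast+
  then obtain i j k where l: "labels i j k" and U: "U i x = U j x" "U k x \<noteq> U j x" by blast
  note 1 = dir_ex1_aux[OF l assms(1,2) U]
  have "\<not> (\<forall>p\<in>P. eq1 p a x)" using eq1_none[OF assms(1)] assms unfolding land_def by blast
  then show ?thesis using 1 l that[of i] that[of j] unfolding labels_def by blast
qed

lemma dir_ex:
  assumes "b0 \<in> B" "Lam x" "\<not> A x"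
  obtains i where "dir b0 i x"
  using land_ex[OF assms(1)] dir_ex1[OF _ assms(2,3)] assms(2) unfolding dir_def by metis

lemma dir_others:
  assumes "dir b0 i x" "land b0 x a b" "q \<in> P" "q \<noteq> i"
  shows "eq1 q a x"
  using dir_ex1[OF assms(2)] assms dir_land[OF assms(1,2)] dir_not_A[OF assms(1)] unfolding dir_def by metis

lemma dir_unique: "dir b0 i x \<Longrightarrow> dir b0 j x \<Longrightarrow> i = j"
  using dir_others[of b0 i x _ _ j] unfolding dir_def[of b0 j] by blast

text \<open>Comparison with \<open>x\<close> gives \<open>b\<close> and \<open>b'\<close> congruent
  modulo \<open>i\<close>, so \<open>y\<close> is displaced in direction \<open>i\<close> too, and
  only there. Then \<open>b\<close> and \<open>b'\<close> agree modulo all three primes: a single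
  element of \<open>B\<close> serves the whole line.\<close>

lemma dir_line:
  assumes d: "dir b0 i x" and a: "land b0 x a b" and y: "Lam y" "\<And>q. q \<in> P \<Longrightarrow> q \<noteq> i \<Longrightarrow> eq2 q y x"
  shows "dir b0 i y" "land b0 y (y - (b - b0)) b"
proof -
  have x: "Lam x" "i \<in> P" using d unfolding dir_def by auto
  obtain a' b' where a': "land b0 y a' b'" using land_ex a unfolding land_def by blast
  have "b = b' \<and> dir b0 i y"
  proof (cases "eq2 i x y")
    case True
    then have "\<forall>p\<in>P. eq2 p x y" using y eq2_sym by blast
    have "eq2 p a (a + (y - x))" if "p \<in> P" for p
      using \<open>\<forall>p\<in>P. eq2 p x y\<close> that unfolding eq2_def by auto
    then have "A (a + (y - x))" using a periodic[of a] eq2_sym unfolding land_def by blast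
    then have l: "land b0 y (a + (y - x)) b" using a unfolding land_def by auto
    then have "b = b'" using land_unique a' by blast
    moreover have "\<not> eq1 i (a + (y - x)) y" using dir_land[OF d a] unfolding eq1_def by simp
    ultimately show ?thesis using l y x unfolding dir_def by blast
  next
    case False
    obtain q where "q \<in> P" "\<not> eq2 q x y" "eq1 q b b'"
      using pair[OF a a' x(1) y(1) x(2) False] by blast
    then have bi: "eq1 i b b'" using y eq2_sym by blast
    have "\<not> eq1 i a' y"
      using land_eq1[OF a] land_eq1[OF a'] dir_land[OF d a] eq1_left[OF bi] by blast
    then have dy: "dir b0 i y" using x y a' unfolding dir_def by blast
    have "eq1 p b b'" if "p \<in> P" for p
      using bi dir_others[OF d a that] dir_others[OF dy a' that] land_eq1[OF a] land_eq1[OF a']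
        eq1_sym eq1_trans by metis
    then show ?thesis using B_inj a a' dy unfolding land_def by blast
  qed
  moreover from this have "a' = y - (b - b0)" using land_diff[OF a'] by simp
  ultimately show "dir b0 i y" "land b0 y (y - (b - b0)) b"
    using a' by auto
qed

lemma dir_line':
  assumes d: "dir b0 i x" and y: "Lam y" "\<And>q. q \<in> P \<Longrightarrow> q \<noteq> i \<Longrightarrow> eq2 q y x"
  shows "dir b0 i y"
  using dir_line(1)[OF d _ y] d unfolding dir_def by blast

text \<open>The missing point \<open>z\<close> lies on the \<open>i\<close>-line of
  \<open>x2\<close>. Its direction is not \<open>k\<close>, as its \<open>k\<close>-line contains
  the point \<open>t\<close> of \<open>A\<close>. It is not \<open>j\<close> either: the
  \<open>j\<close>-line of \<open>z\<close> meets the \<open>i\<close>-line of \<open>x\<close>, and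
  the intersection would have two directions.\<close>

lemma dir_spread:
  assumes l: "labels i j k" and d: "dir b0 i x" and x2: "Lam x2" "eq2 k x2 x"
    and z: "Lam z" "eq2 j z x2" "eq2 k z x2" "\<not> A z"
    and t: "Lam t" "eq2 i t z" "eq2 j t z" "A t"
  shows "dir b0 i x2"
proof -
  note ne = l[unfolded labels_def]
  have x: "Lam x" using d unfolding dir_def by simp
  have b0: "b0 \<in> B" using d unfolding dir_def land_def by blast
  obtain q where q: "dir b0 q z" using dir_ex[OF b0 z(1,4)] .
  have "q \<noteq> k"
  proof
    assume [simp]: "q = k"
    have "eq2 p t z" if "p \<in> P" "p \<noteq> k" for p using that ne t by auto
    then show False using dir_line'[OF q t(1)] t(4) dir_not_A by simp
  qed
  moreover have "q \<noteq> j"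
  proof
    assume [simp]: "q = j"
    obtain s where s: "Lam s" "eq2 i s z" "eq2 j s x" "eq2 k s x" by (rule crt_Lam[OF l z(1) x x])
    have "eq2 p s z" if "p \<in> P" "p \<noteq> j" for p
      using that ne s eq2_right[OF eq2_trans[OF z(3) x2(2)]] by auto
    then have "dir b0 j s" using dir_line'[OF q s(1)] by simp
    moreover have "eq2 p s x" if "p \<in> P" "p \<noteq> i" for p using that ne s by auto
    then have "dir b0 i s" using dir_line'[OF d s(1)] by blast
    ultimately show False using dir_unique ne by blast
  qed
  ultimately have [simp]: "q = i" using q ne unfolding dir_def by auto
  have "eq2 p x2 z" if "p \<in> P" "p \<noteq> i" for p
    using that ne z(2,3)[THEN eq2_sym] by auto
  then show ?thesis using dir_line'[OF q x2(1)] by simp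
qed

text \<open>If the landing fiber of a missing line were displaced in both directions \<open>j\<close> and \<open>k\<close>, then
  \<open>A \<inter> \<Lambda>\<close> would lie in a cross through the landing position \<open>w\<close>. A parallel missing line through
  \<open>x2\<close> would land there as well, and the difference of the two shifts would have a type that already
  occurs in \<open>A - A\<close>.\<close>

lemma not_both_aux:
  assumes l: "labels i j k" and d: "dir b0 i x" and a: "land b0 x a b"
    and nj: "\<not> eq2 j a x" and nk: "\<not> eq2 k a x"
    and w: "Lam w" "eq2 j w a" "eq2 k w a" and Uj: "U j w"
  shows False
proof -
  note P = labels_mem[OF l] and ne = l[unfolded labels_def]
  have x: "Lam x" using d unfolding dir_def by simp
  have ai: "\<not> eq1 i a x" by (rule dir_land[OF d a])
  \<comment> \<open>A point of \<open>A\<close> outside the two planes through the landing position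
    would realize the type of the displacement. The claim is kept general because it is applied to a
    second landing below.\<close>
  have cross: "eq2 j y w' \<or> eq2 k y w'"
    if "Lam y" "A y" and a': "land b0 x' a' b'" "dir b0 i x'" "\<not> eq2 j a' x'" "\<not> eq2 k a' x'"
      "eq2 j w' a'" "eq2 k w' a'" for y w' x' a' b'
    using land_sands0[OF l a'(1) _ that(1,2) dir_land[OF a'(2,1)]] a' eq2_left[OF a'(5)] eq2_left[OF a'(6)]
      eq2_sym dir_def by metis
  note cr = cross[OF _ _ a d nj nk w(2,3)]
  have xw: "\<not> eq2 j x w" "\<not> eq2 k x w"
    using nj nk w eq2_right eq2_sym by blast+
  obtain ui where ui: "Lam ui" "U i ui" using U_ex P by blast
  obtain vi where vi: "Lam vi" "\<not> U i vi" using U_ex' P by blast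
  obtain uk where uk: "Lam uk" "U k uk" using U_ex P by blast
  obtain vj where vj: "Lam vj" "\<not> U j vj" using U_ex' P by blast
  \<comment> \<open>Otherwise the complementary box would avoid both planes of the cross.\<close>
  have Uk: "\<not> U k w"
  proof
    assume Uk: "U k w"
    obtain vk where vk: "Lam vk" "\<not> U k vk" using U_ex' P by blast
    obtain y where y: "Lam y" "A y" "\<not> U j y" "\<not> U k y"
      using point[OF l vi(1) vj(1) vk(1)] vi vj vk by metis
    then show False using cr[OF y(1,2)] Uj Uk U_cong P by metis
  qed
  \<comment> \<open>The cross is so thin that one side of the partition in direction
    \<open>j\<close> is the single coordinate of \<open>w\<close>; in direction \<open>k\<close> the
    same happens to the opposite side.\<close>
  have Uj_eq: "eq2 j y w" if y: "Lam y" "U j y" for y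
  proof -
    obtain z where z: "Lam z" "A z" "eq2 j z y" "U k z" using point[OF l ui(1) y(1) uk(1)] ui uk y by metis
    then show ?thesis using cr[OF z(1,2)] Uk U_cong P eq2_left[OF z(3)] by metis
  qed
  have Uk_eq: "eq2 k y w" if y: "Lam y" "\<not> U k y" for y
  proof -
    obtain z where z: "Lam z" "A z" "eq2 k z y" "\<not> U j z" using point[OF l vi(1) vj(1) y(1)] vi vj y by metis
    then show ?thesis using cr[OF z(1,2)] Uj U_cong P eq2_left[OF z(3)] by metis
  qed
  have Ux: "\<not> U j x" "U k x" using Uj_eq Uk_eq x xw by blast+
  obtain x2 where x2: "Lam x2" "\<not> eq2 j x2 x" "\<not> eq2 j x2 w" "\<And>q. q \<in> P \<Longrightarrow> q \<noteq> j \<Longrightarrow> eq2 q x2 x"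
    using third_point[of j x x w] P x by blast
  then have x2k: "eq2 k x2 x" "eq2 i x2 x" using P ne by auto
  have Ux2: "\<not> U j x2" "U k x2" using Uj_eq x2 Ux U_cong[of k x2 x] x2k P by auto
  have d2: "dir b0 i x2"
  proof -
    obtain z where z: "Lam z" "eq2 i z vi" "eq2 j z x2" "eq2 k z x" "\<not> U i z" "\<not> U j z" "U k z"
      using point[OF l vi(1) x2(1) x] vi Ux2 Ux by metis
    have "\<not> A z" using cr[OF z(1)] xw x2 eq2_left[OF z(3)] eq2_left[OF z(4)] by blast
    moreover obtain t where "Lam t" "eq2 i t z" "eq2 j t z" "A t"
      using point[OF l z(1) z(1) w(1)] z Uk by metis
    ultimately show ?thesis
      using dir_spread[OF l d x2(1) x2k(1) z(1,3) eq2_trans[OF z(4) eq2_sym[OF x2k(1)]]] by blast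
  qed
  obtain a2 b2 where a2: "land b0 x2 a2 b2" using land_ex a unfolding land_def by blast
  have a2t: "\<not> eq1 i a2 x2" "eq1 j a2 x2" "eq1 k a2 x2"
    using dir_land[OF d2 a2] dir_others[OF d2 a2] P ne by auto
  have at: "eq1 j a x" "eq1 k a x" using dir_others[OF d a] P ne by auto
  have aL: "\<not> eq1 i a y" "eq1 j a y" "eq1 k a y" if "Lam y" for y
    using ai at that x Lam_eq1[of x y] P eq1_right by blast+
  have a2L: "\<not> eq1 i a2 y" "eq1 j a2 y" "eq1 k a2 y" if "Lam y" for y
    using a2t that x2(1) Lam_eq1[of x2 y] P eq1_right by blast+
  have Aa: "A a" "A a2" using a a2 unfolding land_def by auto
  note s = sands0[OF l]
  \<comment> \<open>The differences \<open>a - y1\<close> and \<open>a - y2\<close> occupy the types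
    displaced in exactly one of \<open>j\<close> and \<open>k\<close>, so the landing of
    \<open>x2\<close> is displaced in both of them or in neither.\<close>
  obtain y1 where y1: "Lam y1" "A y1" "eq2 j y1 x" "eq2 k y1 w"
    using point[OF l vi(1) x w(1)] vi Ux Uk by metis
  obtain y2 where y2: "Lam y2" "A y2" "eq2 j y2 w" "eq2 k y2 x"
    using point[OF l ui(1) w(1) x] ui Ux Uj by metis
  have t1: "\<not> eq2 j a y1" "eq2 k a y1" using y1 nj w eq2_sym eq2_trans by blast+
  have t2: "eq2 j a y2" "\<not> eq2 k a y2" using y2 nk w eq2_sym eq2_trans by blast+
  have "eq2 j a2 x2 \<longleftrightarrow> eq2 k a2 x2"
    using s[OF a2 Aa(1) y1(2) a2t(1) aL(1)[OF y1(1)] a2t(2,3) aL(2,3)[OF y1(1)]] t1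
      s[OF a2 Aa(1) y2(2) a2t(1) aL(1)[OF y2(1)] a2t(2,3) aL(2,3)[OF y2(1)]] t2 by blast
  then consider "eq2 j a2 x2" "eq2 k a2 x2" | "\<not> eq2 j a2 x2" "\<not> eq2 k a2 x2" by blast
  then show False
  proof cases
    case 1
    \<comment> \<open>A point of the cross in the column of \<open>w\<close>, away from the height
      of \<open>x\<close>, makes \<open>a2 - y\<close> displaced in both directions, like
      \<open>a - x\<close>.\<close>
    obtain k3 where k3: "Lam k3" "\<not> eq2 k k3 x" "\<not> eq2 k k3 w" using third_point[of k x] P x by metis
    then have "U k k3" using Uk_eq by blast
    then obtain y where y: "Lam y" "A y" "eq2 j y w" "eq2 k y k3" using point[OF l ui(1) w(1) k3(1)] ui Uj by metis
    have "\<not> eq2 j a2 y" using 1(1) y(3) x2(3) eq2_sym eq2_trans by blast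
    moreover have "\<not> eq2 k a2 y"
      using k3(2) eq2_sym by (simp add: eq2_left[OF 1(2)] eq2_left[OF x2k(1)] eq2_right[OF y(4)]) blast
    ultimately show False
      using s[OF a Aa(2) y(2) ai a2L(1)[OF y(1)] at a2L(2,3)[OF y(1)]] nj nk by blast
  next
    case 2
    obtain w2 where w2: "eq2 j w2 a2" "eq2 k w2 a2" using crt[OF l, of 0 a2 a2] by blast
    note cr2 = cross[OF _ _ a2 d2 2 w2]
    \<comment> \<open>Two crosses containing the same points of \<open>A\<close> have the same
      center, because each arm carries two distinct points.\<close>
    have "eq2 k w w2"
    proof (rule ccontr)
      assume n: "\<not> eq2 k w w2"
      obtain z where z: "Lam z" "A z" "eq2 j z x2" "eq2 k z w"
        using point[OF l vi(1) x2(1) w(1)] vi Ux2 Uk by metis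
      have "eq2 j z w2" using cr2[OF z(1,2)] n eq2_left[OF z(4)] by blast
      moreover have "eq2 j y1 w2" using cr2[OF y1(1,2)] n eq2_left[OF y1(4)] by blast
      ultimately have "eq2 j x2 x"
        using z(3) y1(3) by (simp add: eq2_left[OF z(3)] eq2_left[OF y1(3)] eq2_right[of j x w2])
      then show False using x2 by blast
    qed
    moreover have "eq2 j w w2"
    proof (rule ccontr)
      assume n: "\<not> eq2 j w w2"
      obtain k3 where k3: "Lam k3" "\<not> eq2 k k3 x" "\<not> eq2 k k3 w" using third_point[of k x] P x by metis
      then have "U k k3" using Uk_eq by blast
      then obtain z where z: "Lam z" "A z" "eq2 j z w" "eq2 k z k3" using point[OF l ui(1) w(1) k3(1)] ui Uj by metis
      have "eq2 k z w2" using cr2[OF z(1,2)] n eq2_left[OF z(3)] by blast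
      moreover have "eq2 k y2 w2" using cr2[OF y2(1,2)] n eq2_left[OF y2(3)] by blast
      ultimately have "eq2 k k3 x"
        using z(4) y2(4) by (simp add: eq2_left[OF z(4)] eq2_left[OF y2(4)] eq2_right[of k x w2])
      then show False using k3 by blast
    qed
    ultimately have aa: "eq2 j a a2" "eq2 k a a2" using w w2 eq2_sym eq2_trans by blast+
    \<comment> \<open>As \<open>a\<close> and \<open>a2\<close> agree in \<open>j\<close> and
      \<open>k\<close>, the difference \<open>b - b2\<close> inherits from \<open>x - x2\<close> a
      displacement in \<open>j\<close> only, which is the type of \<open>a - y1\<close>.\<close>
    have b: "b - b2 = (x - x2) - (a - a2)" using a a2 unfolding land_def by linarith
    have bb: "b \<in> B" "b2 \<in> B" "b \<noteq> b2"
    proof -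
      show "b \<in> B" "b2 \<in> B" using a a2 unfolding land_def by auto
      show "b \<noteq> b2"
      proof
        assume "b = b2"
        then have "x2 - x = a2 - a" using b by simp
        then show False using aa x2(2) eq2_sym[OF aa(1)] unfolding eq2_def by simp
      qed
    qed
    have b2j: "\<not> eq2 j b b2" using aa(1) x2(2) unfolding eq2_def b
      by (metis dvd_diff_commute dvd_diff_left_iff)
    have b2k: "eq2 k b b2" using aa(2) eq2_sym[OF x2k(1)] unfolding eq2_def b by (metis dvd_diff)
    have b1j: "eq1 j b b2" "eq1 k b b2"
      using at a2t land_eq1[OF a] land_eq1[OF a2] eq1_sym eq1_trans by metis+
    have b1i: "\<not> eq1 i b b2"
    proof
      assume "eq1 i b b2"
      then have "\<forall>p\<in>P. eq1 p b b2" using b1j by (simp add: labels_ball[OF l])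
      then show False using B_inj bb by blast
    qed
    have "b = b2"
    proof (rule sands[OF Aa(1) y1(2) bb(1,2)])
      have "\<forall>p\<in>P. (eq1 p a y1 \<longleftrightarrow> eq1 p b b2) \<and> (eq2 p a y1 \<longleftrightarrow> eq2 p b b2)"
        using aL[OF y1(1)] t1 b1j b1i b2j b2k eq2_imp_eq1 by (auto simp: labels_ball[OF l])
      then show "eq1 p a y1 \<longleftrightarrow> eq1 p b b2" "eq2 p a y1 \<longleftrightarrow> eq2 p b b2" if "p \<in> P" for p
        using that by blast+
    qed
    then show False using bb by blast
  qed
qed

text \<open>The auxiliary lemma assumes that \<open>w\<close> is on the chosen side in direction
  \<open>j\<close>; complementing the boxes treats the other side.\<close>

lemma not_both:
  assumes l: "labels i j k" and d: "dir b0 i x" and a: "land b0 x a b"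
  shows "eq2 j a x \<or> eq2 k a x"
proof (rule ccontr)
  assume n: "\<not> (eq2 j a x \<or> eq2 k a x)"
  interpret c: box_core P A B x0 "\<lambda>p x. \<not> U p x" by (rule complement)
  have x: "Lam x" using d unfolding dir_def by simp
  obtain w where w: "eq2 i w x" "eq2 j w a" "eq2 k w a" using crt[OF l] by blast
  have e: "eq1 j a x" "eq1 k a x" using dir_others[OF d a] l unfolding labels_def by auto
  have "Lam w"
    using LamI[OF l eq2_imp_eq1[OF w(1)] _ _ x x x] e w eq2_imp_eq1 eq1_trans by blast
  then show False
    using not_both_aux[OF l d a _ _ _ w(2,3)] c.not_both_aux[OF l _ a _ _ _ w(2,3)] d n
    unfolding dir_def c.dir_def by blast
qed

text \<open>Displacement in direction \<open>j\<close> alone: then the elements of \<open>B\<close> congruent to \<open>b0\<close> modulo \<open>j\<close> and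
  \<open>k\<close> would be in bijection both with the residues modulo \<open>i\<close> and with those modulo \<open>j\<close>.\<close>

lemma not_single_aux:
  assumes l: "labels i j k" and d: "dir b0 i x" and a: "land b0 x a b"
    and nj: "\<not> eq2 j a x" and k: "eq2 k a x" and Uk: "\<not> U k x"
  shows False
proof -
  note P = labels_mem[OF l] and ne = l[unfolded labels_def]
  have x: "Lam x" using d unfolding dir_def by simp
  have b0: "b0 \<in> B" using a unfolding land_def by simp
  have ai: "\<not> eq1 i a x" by (rule dir_land[OF d a])
  have at: "eq1 j a x" "eq1 k a x" using dir_others[OF d a] P ne by auto
  obtain w where w: "eq2 i w x" "eq2 j w a" "eq2 k w x" using crt[OF l] by blast
  have wL: "Lam w"
    using LamI[OF l _ _ _ x x x] w at eq2_imp_eq1 eq1_trans by blast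
  \<comment> \<open>At the height of \<open>x\<close>, a point of \<open>A\<close> outside the
    column of \<open>w\<close> would realize the type of the displacement.\<close>
  have land_j: "eq2 j y w" if "Lam y" "A y" "eq2 k y x" for y
  proof -
    have "eq2 k a y" using that(3) k eq2_sym eq2_trans by blast
    then have "eq2 j a y" using land_sands0[OF l a x that(1,2) ai] nj k by blast
    then show ?thesis using w(2) eq2_sym eq2_trans by blast
  qed
  obtain ui where ui: "Lam ui" "U i ui" using U_ex P by blast
  obtain vi where vi: "Lam vi" "\<not> U i vi" using U_ex' P by blast
  obtain uk where uk: "Lam uk" "U k uk" using U_ex P by blast
  have Uj_eq: "eq2 j y w" if y: "Lam y" "\<not> U j y" for y
  proof -
    obtain z where z: "Lam z" "A z" "eq2 j z y" "eq2 k z x"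
      using point[OF l vi(1) y(1) x] vi y Uk by metis
    then show ?thesis using land_j[OF z(1,2,4)] eq2_left[OF z(3)] by blast
  qed
  have Uw: "\<not> U j w" using U_ex' Uj_eq U_cong P by metis
  have Uj: "U j y \<longleftrightarrow> \<not> eq2 j y w" if "Lam y" for y using Uj_eq[OF that] Uw U_cong[of j y w] P by blast
  have xw: "\<not> eq2 j x w" using nj w eq2_sym eq2_trans by blast
  obtain y1 where y1: "Lam y1" "A y1" "eq2 j y1 w" "eq2 k y1 x"
    using point[OF l vi(1) wL x] vi Uw Uk by metis
  obtain y2 where y2: "Lam y2" "A y2" "eq2 j y2 x" "U k y2"
    using point[OF l ui(1) x uk(1)] ui uk Uj[OF x] xw by metis
  have y2x: "\<not> eq2 k y2 x" using y2(4) Uk U_cong P by blast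
  have aL: "\<not> eq1 i a y" "eq1 j a y" "eq1 k a y" if "Lam y" for y
    using ai at that x Lam_eq1[of x y] P eq1_right by blast+
  have t1: "eq2 j a y1" "eq2 k a y1" using y1 w k eq2_sym eq2_trans by blast+
  have t2: "\<not> eq2 j a y2" "\<not> eq2 k a y2"
    using y2(3) nj eq2_trans apply blast
    using y2x k eq2_sym eq2_trans by blast
  have Aa: "A a" using a unfolding land_def by auto
  \<comment> \<open>Every further missing line at this height lands in the same column
    \<open>w\<close>: each other pattern of displacement would repeat a type that is already
    taken.\<close>
  have other: "dir b0 i x2 \<and> eq2 k a2 x2 \<and> eq2 j a2 w"
    if x2: "Lam x2" "eq2 k x2 x" "\<not> eq2 j x2 w" and a2: "land b0 x2 a2 b2" for x2 a2 b2
  proof -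
    have Ux2: "U j x2" "\<not> U k x2" using Uj x2 U_cong[of k x2 x] P Uk by blast+
    have d2: "dir b0 i x2"
    proof -
      obtain z where z: "Lam z" "eq2 i z ui" "eq2 j z x2" "eq2 k z x2" "U i z" "U j z" "\<not> U k z"
        using point[OF l ui(1) x2(1) x2(1)] ui Ux2 by metis
      have zx: "eq2 k z x" using z(4) x2(2) eq2_trans by blast
      have "\<not> A z" using land_j[OF z(1) _ zx] x2 eq2_left[OF z(3)] by blast
      moreover obtain t where "Lam t" "eq2 i t z" "eq2 j t z" "A t"
        using point[OF l z(1) z(1) uk(1)] z uk by metis
      ultimately show ?thesis using dir_spread[OF l d x2(1,2) z(1,3,4)] by blast
    qed
    have a2t: "\<not> eq1 i a2 x2" "eq1 j a2 x2" "eq1 k a2 x2"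
      using dir_land[OF d2 a2] dir_others[OF d2 a2] P ne by auto
    have a2L: "\<not> eq1 i a2 y" "eq1 j a2 y" "eq1 k a2 y" if "Lam y" for y
      using a2t that x2(1) Lam_eq1[of x2 y] P eq1_right by blast+
    have Aa2: "A a2" using a2 unfolding land_def by auto
    note s = sands0[OF l]
    have "eq2 j a2 x2 \<longleftrightarrow> \<not> eq2 k a2 x2"
      using s[OF a2 Aa y1(2) a2t(1) aL(1)[OF y1(1)] a2t(2,3) aL(2,3)[OF y1(1)]] t1
        s[OF a2 Aa y2(2) a2t(1) aL(1)[OF y2(1)] a2t(2,3) aL(2,3)[OF y2(1)]] t2 by blast
    moreover have "\<not> (eq2 j a2 x2 \<and> \<not> eq2 k a2 x2)"
    proof
      assume n: "eq2 j a2 x2 \<and> \<not> eq2 k a2 x2"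
      \<comment> \<open>This point determines the height of \<open>a2\<close> as that of
        \<open>uk\<close>. A second point of \<open>A\<close> at this height, in the column
        \<open>j3\<close>, then differs from \<open>a2\<close> by the type of
        \<open>a - x\<close>.\<close>
      obtain y where y: "Lam y" "A y" "eq2 j y x2" "eq2 k y uk"
        using point[OF l ui(1) x2(1) uk(1)] ui uk Ux2 by metis
      have "eq2 j a2 y" using n y(3) eq2_sym eq2_trans by blast
      then have "eq2 k a2 y" using land_sands0[OF l a2 x2(1) y(1,2) a2t(1)] n by blast
      then have a2k: "eq2 k a2 uk" using y(4) eq2_trans by blast
      obtain j3 where j3: "Lam j3" "\<not> eq2 j j3 x2" "\<not> eq2 j j3 w" using third_point[of j x2] P x2(1) by metis
      obtain y' where y': "Lam y'" "A y'" "eq2 j y' j3" "eq2 k y' uk"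
        using point[OF l ui(1) j3(1) uk(1)] ui uk Uj[OF j3(1)] j3 by metis
      have "\<not> eq2 j a2 y'" "eq2 k a2 y'" using n a2k y' j3 eq2_sym eq2_trans by blast+
      then show False
        using s[OF a Aa2 y'(2) ai a2L(1)[OF y'(1)] at a2L(2,3)[OF y'(1)]] nj k by blast
    qed
    ultimately have jk: "eq2 k a2 x2" "\<not> eq2 j a2 x2" by blast+
    have "eq2 k a2 y1" using jk(1) x2(2) y1(4) eq2_sym eq2_trans by blast
    then have "eq2 j a2 y1" using land_sands0[OF l a2 x2(1) y1(1,2) a2t(1)] jk by blast
    then show ?thesis using d2 jk y1(3) eq2_trans by blast
  qed
  define T where "T = {b \<in> B. eq1 j b b0 \<and> eq1 k b b0}"
  \<comment> \<open>The patterns "displaced in neither of \<open>j\<close>, \<open>k\<close>" and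
    "displaced in both" are excluded by \<open>a - y1\<close> and \<open>a - y2\<close>.\<close>
  have Tdiff: "\<not> eq1 i c c' \<and> (eq2 j c c' \<longleftrightarrow> \<not> eq2 k c c')" if "c \<in> T" "c' \<in> T" "c \<noteq> c'" for c c'
  proof -
    have B: "c \<in> B" "c' \<in> B" "eq1 j c c'" "eq1 k c c'"
      using that unfolding T_def by (auto intro: eq1_trans dest: eq1_sym)
    have i: "\<not> eq1 i c c'"
    proof
      assume "eq1 i c c'"
      then have "\<forall>p\<in>P. eq1 p c c'" using B by (simp add: labels_ball[OF l])
      then show False using B_inj B that by blast
    qed
    have "\<not> (eq2 j c c' \<and> eq2 k c c')"
    proof
      assume *: "eq2 j c c' \<and> eq2 k c c'"
      have "\<forall>p\<in>P. (eq1 p a y1 \<longleftrightarrow> eq1 p c c') \<and> (eq2 p a y1 \<longleftrightarrow> eq2 p c c')"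
        using aL[OF y1(1)] t1 * i B eq2_imp_eq1 by (auto simp: labels_ball[OF l])
      then show False using sands[OF Aa y1(2) B(1,2)] that by blast
    qed
    moreover have "eq2 j c c' \<or> eq2 k c c'"
    proof (rule ccontr)
      assume *: "\<not> (eq2 j c c' \<or> eq2 k c c')"
      have "\<forall>p\<in>P. (eq1 p a y2 \<longleftrightarrow> eq1 p c c') \<and> (eq2 p a y2 \<longleftrightarrow> eq2 p c c')"
        using aL[OF y2(1)] t2 * i B eq2_imp_eq1 by (auto simp: labels_ball[OF l])
      then show False using sands[OF Aa y2(2) B(1,2)] that by blast
    qed
    ultimately show ?thesis using i by blast
  qed
  have bT: "b0 \<in> T" "b \<in> T" "b \<noteq> b0" "\<not> eq2 j b b0" "eq2 k b b0"
    using a at nj k land_eq1[OF a] land_eq2[OF a] unfolding T_def land_def by auto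
  \<comment> \<open>Relative to \<open>b0\<close> the element \<open>b\<close> is displaced in
    \<open>j\<close> alone. An element displaced from \<open>b0\<close> in \<open>k\<close> alone
    would differ from \<open>b\<close> in both directions.\<close>
  have Tk: "eq2 k c b0" if "c \<in> T" for c
  proof (rule ccontr)
    assume n: "\<not> eq2 k c b0"
    then have j: "eq2 j c b0" using Tdiff[OF that bT(1)] by (cases "c = b0") auto
    have "\<not> eq2 k c b" "\<not> eq2 j c b" using n j bT(4,5) eq2_sym eq2_trans by blast+
    then show False using Tdiff[OF that bT(2)] by (cases "c = b") auto
  qed
  have pos: "prime i" "prime j" "int i > 0" "int j > 0"
    using prime_P P prime_gt_0_nat by auto
  \<comment> \<open>With the residues modulo \<open>j\<close> and \<open>k\<close> fixed, the
    residue modulo \<open>i\<close> can be prescribed freely and determines the element.\<close>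
  have "bij_betw (\<lambda>c. c mod int i) T {0..<int i}"
    unfolding bij_betw_def
  proof
    show "inj_on (\<lambda>c. c mod int i) T"
    proof (rule inj_onI)
      fix c c' assume "c \<in> T" "c' \<in> T" "c mod int i = c' mod int i"
      moreover from this have "eq1 i c c'" by (simp add: eq1_def mod_eq_dvd_iff)
      ultimately show "c = c'" using Tdiff by blast
    qed
    show "(\<lambda>c. c mod int i) ` T = {0..<int i}"
    proof (intro equalityI subsetI)
      fix r assume r: "r \<in> {0..<int i}"
      obtain n where n: "eq2 i n r" "eq2 j n b0" "eq2 k n b0" using crt[OF l] by blast
      obtain c where c: "c \<in> B" "\<forall>p\<in>P. eq1 p c n" using B_surj by blast
      then have "c \<in> T" using n P eq2_imp_eq1 eq1_trans unfolding T_def by blast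
      moreover have "eq1 i c r" using n c P eq2_imp_eq1 eq1_trans by blast
      then have "c mod int i = r" using r by (simp add: eq1_def mod_eq_dvd_iff[symmetric])
      ultimately show "r \<in> (\<lambda>c. c mod int i) ` T" by blast
    qed (use pos in auto)
  qed
  then have 1: "card T = i" by (auto dest: bij_betw_same_card)
  have "bij_betw (\<lambda>c. (c - b0) mod (int j)\<^sup>2) T ((\<lambda>t. int j * t) ` {0..<int j})"
    unfolding bij_betw_def
  proof
    show "inj_on (\<lambda>c. (c - b0) mod (int j)\<^sup>2) T"
    proof (rule inj_onI)
      fix c c' assume c: "c \<in> T" "c' \<in> T" and "(c - b0) mod (int j)\<^sup>2 = (c' - b0) mod (int j)\<^sup>2"
      then have "eq2 j c c'" by (simp add: eq2_def mod_eq_dvd_iff)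
      moreover have "eq2 k c c'" using Tk c eq2_sym eq2_trans by blast
      ultimately show "c = c'" using Tdiff c by blast
    qed
    show "(\<lambda>c. (c - b0) mod (int j)\<^sup>2) ` T = (\<lambda>t. int j * t) ` {0..<int j}"
    proof (intro equalityI subsetI)
      fix r assume "r \<in> (\<lambda>c. (c - b0) mod (int j)\<^sup>2) ` T"
      then obtain c where c: "c \<in> T" "r = (c - b0) mod (int j)\<^sup>2" by blast
      then obtain s where "c - b0 = int j * s" unfolding T_def eq1_def by blast
      then have "r = int j * (s mod int j)" using c by (simp add: power2_eq_square)
      then show "r \<in> (\<lambda>t. int j * t) ` {0..<int j}" using pos by auto
    next
      fix r assume "r \<in> (\<lambda>t. int j * t) ` {0..<int j}"
      then obtain t where t: "r = int j * t" "0 \<le> t" "t < int j" by auto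
      have rr: "0 \<le> r" "r < (int j)\<^sup>2" using t pos by (auto simp: power2_eq_square)
      show "r \<in> (\<lambda>c. (c - b0) mod (int j)\<^sup>2) ` T"
      proof (cases "t = 0")
        case True
        then show ?thesis using bT t by (intro image_eqI[of _ _ b0]) auto
      next
        case False
        \<comment> \<open>The line in column \<open>w + r\<close> lands in column \<open>w\<close>,
          so the element of \<open>B\<close> used there is displaced from \<open>b0\<close> by
          exactly \<open>r\<close> modulo \<open>j\<^sup>2\<close>. The remaining value
          \<open>r = 0\<close> belongs to \<open>b0\<close> itself.\<close>
        obtain x2 where x2: "eq2 i x2 x" "eq2 j x2 (w + r)" "eq2 k x2 x" using crt[OF l] by blast
        have r1: "eq1 j (w + r) w" unfolding eq1_def using t by simp
        have "\<not> (int j)\<^sup>2 dvd r" using False t rr pos zdvd_not_zless[of r] by simp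
        then have "\<not> eq2 j (w + r) w" unfolding eq2_def by simp
        then have x2w: "\<not> eq2 j x2 w" using eq2_left[OF x2(2)] by simp
        have x2L: "Lam x2"
          using LamI[OF l _ _ _ x wL x] x2 r1 eq2_imp_eq1 eq1_trans by blast
        obtain a2 b2 where a2: "land b0 x2 a2 b2" using land_ex[OF b0] by blast
        have o: "dir b0 i x2" "eq2 k a2 x2" "eq2 j a2 w" using other[OF x2L x2(3) x2w a2] by auto
        have "eq1 j a2 x2" "eq1 k a2 x2" using dir_others[OF o(1) a2] P ne by auto
        then have "b2 \<in> T" using a2 land_eq1[OF a2] unfolding T_def land_def by blast
        moreover have "eq2 j (x2 - a2) (w + r - w)" by (rule eq2_diff[OF x2(2) o(3)])
        then have "eq2 j (b2 - b0) r" using land_diff[OF a2] by simp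
        then have "(b2 - b0) mod (int j)\<^sup>2 = r" using rr by (simp add: eq2_def mod_eq_dvd_iff[symmetric])
        ultimately show ?thesis by blast
      qed
    qed
  qed
  then have "card T = card ((\<lambda>t. int j * t) ` {0..<int j})" by (rule bij_betw_same_card)
  also have "\<dots> = j" using pos by (subst card_image) (auto simp: inj_on_def)
  finally show False using 1 ne by simp
qed

lemma dir_eq2:
  assumes d: "dir b0 i x" and a: "land b0 x a b" and q: "q \<in> P" "q \<noteq> i"
  shows "eq2 q a x"
proof (rule ccontr)
  assume n: "\<not> eq2 q a x"
  interpret c: box_core P A B x0 "\<lambda>p x. \<not> U p x" by (rule complement)
  have "i \<in> P" using d unfolding dir_def by simp
  then obtain k where l: "labels i q k"
    using labels_obtain[OF \<open>i \<in> P\<close>] labels_perm q unfolding labels_def by (metis insertE singletonD)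
  have "eq2 k a x" using not_both[OF l d a] n by blast
  then show False
    using not_single_aux[OF l d a n] c.not_single_aux[OF l _ a n] d
    unfolding dir_def c.dir_def by blast
qed

text \<open>Some \<open>c\<close> in \<open>B\<close> is placed relative to \<open>b0'\<close> as
  \<open>b\<close> is relative to \<open>b0\<close>, modulo all primes. From \<open>b0'\<close> the
  point \<open>x' = a + c - b0'\<close> of the grid also lands at \<open>a\<close>, displaced in
  direction \<open>i\<close>. By \<open>dir_eq2\<close> both \<open>x\<close> and \<open>x'\<close>
  agree with \<open>a\<close> in the other coordinates, so they share an
  \<open>i\<close>-line.\<close>

lemma dir_base:
  assumes d: "dir b0 i x" and b0': "b0' \<in> B"
  shows "dir b0' i x"
proof -
  have x: "Lam x" "i \<in> P" using d unfolding dir_def by auto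
  obtain a b where a: "land b0 x a b" using d unfolding dir_def by blast
  obtain c where c: "c \<in> B" "\<forall>p\<in>P. eq1 p c (b0' + (b - b0))" using B_surj by blast
  define x' where "x' = a + c - b0'"
  have l: "land b0' x' a c" using a b0' c unfolding land_def x'_def by auto
  have e: "eq1 p x' x" if "p \<in> P" for p
    using c(2) that land_diff[OF a] unfolding eq1_def x'_def by (simp add: algebra_simps)
  have "Lam x'" using e x eq1_trans unfolding Lam_def by blast
  moreover have "\<not> eq1 i a x'" using dir_land[OF d a] e[OF x(2)] eq1_trans by blast
  ultimately have d': "dir b0' i x'" using l x unfolding dir_def by blast
  have "eq2 q x x'" if "q \<in> P" "q \<noteq> i" for q
    using dir_eq2[OF d a that] dir_eq2[OF d' l that] eq2_sym eq2_trans by blast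
  then show ?thesis using dir_line'[OF d' x(1)] by blast
qed

lemma dir_shifts:
  assumes d: "dir b0 i x"
  shows "shifts b0 i x"
proof -
  obtain a b where a: "land b0 x a b" and x: "Lam x" "i \<in> P" using d unfolding dir_def by blast
  have "A (y - (b - b0))" if y: "eq1 i y x" "\<forall>q\<in>P - {i}. eq2 q y x" for y
  proof -
    have "eq1 p y x" if "p \<in> P" for p using y that eq2_imp_eq1 by blast
    then have "Lam y" using x eq1_trans unfolding Lam_def by blast
    then show ?thesis using dir_line(2)[OF d a, of y] y unfolding land_def by blast
  qed
  then show ?thesis
    using dir_land[OF d a] dir_eq2[OF d a] land_eq1[OF a] land_eq2[OF a] a
    unfolding shifts_def land_def by blast
qed

theorem missing_point_shifts:
  assumes "Lam x" "\<not> A x"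
  obtains i where "i \<in> P" "\<And>b0. b0 \<in> B \<Longrightarrow> shifts b0 i x"
proof -
  obtain b0 where "b0 \<in> B" using B_surj by blast
  then obtain i where i: "dir b0 i x" using dir_ex assms by blast
  then have "shifts b i x" if "b \<in> B" for b using dir_shifts dir_base that by blast
  moreover have "i \<in> P" using i unfolding dir_def by simp
  ultimately show ?thesis using that by blast
qed

end

section \<open>Full planes and almost corners\<close>

text \<open>The assumption is a counting bound in disguise. A plane of the grid has
  \<open>|A| / i\<close> points, and \<open>A\<close> has no more in a class modulo
  \<open>i\<^sup>2\<close>; hence an injection of the plane into that part of \<open>A\<close> is
  onto.\<close>

locale plane_core = grid_core +
  assumes plane_bound: "i \<in> P \<Longrightarrow> Lam c \<Longrightarrow>
      (\<And>y. Lam y \<Longrightarrow> eq2 i y c \<Longrightarrow> A (f y) \<and> eq2 i (f y) c) \<Longrightarrow>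
      (\<And>y y'. Lam y \<Longrightarrow> eq2 i y c \<Longrightarrow> Lam y' \<Longrightarrow> eq2 i y' c \<Longrightarrow>
         (\<And>p. p \<in> P \<Longrightarrow> eq2 p (f y) (f y')) \<Longrightarrow> (\<forall>p\<in>P. eq2 p y y')) \<Longrightarrow>
      A e \<Longrightarrow> eq2 i e c \<Longrightarrow> \<exists>y. Lam y \<and> eq2 i y c \<and> (\<forall>p\<in>P. eq2 p (f y) e)"
begin

text \<open>The type of a difference divisible by all primes is the set of primes whose squares
  divide it. To separate elements of \<open>B\<close> modulo \<open>D(M)\<close> it therefore
  suffices to find the corresponding pattern of equal coordinates inside \<open>A\<close> and the
  grid.\<close>

lemma near_inj:
  assumes "labels i j k" "b \<in> B" "b' \<in> B" "\<And>p. p \<in> P \<Longrightarrow> eq1 p b b'" "Lam m" "Lam n" "A m" "A n"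
    "eq2 i m n \<longleftrightarrow> eq2 i b b'" "eq2 j m n \<longleftrightarrow> eq2 j b b'" "eq2 k m n \<longleftrightarrow> eq2 k b b'"
  shows "b = b'"
proof (rule sands[OF assms(7,8,2,3)])
  show "eq1 p m n \<longleftrightarrow> eq1 p b b'" if "p \<in> P" for p
    using Lam_eq1[OF assms(5,6) that] assms(4)[OF that] by simp
  show "eq2 p m n \<longleftrightarrow> eq2 p b b'" if "p \<in> P" for p
    using that assms(9-) assms(1) unfolding labels_def by auto
qed

text \<open>Two families of lines in one plane, shifted out in the directions \<open>j\<close> and \<open>k\<close>, together with
  the points of \<open>A\<close> in the plane and one more point, are too many for the plane bound.\<close>

lemma plane_contradiction:
  assumes l: "labels i j k" and c: "Lam c"
    and f: "\<And>y. Lam y \<Longrightarrow> eq2 i y c \<Longrightarrow> J y \<or> K y \<or> A y"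
    and J: "\<And>y. Lam y \<Longrightarrow> eq2 i y c \<Longrightarrow> J y \<Longrightarrow>
        \<exists>b\<in>B. eq2 i b b1 \<and> \<not> eq1 j b b1 \<and> eq2 k b b1 \<and>
          (\<forall>y'. eq2 i y' c \<and> eq1 j y' c \<and> eq2 k y' y \<longrightarrow> A (y' - (b - b1)))"
    and b1: "b1 \<in> B"
    and K: "\<And>y. Lam y \<Longrightarrow> eq2 i y c \<Longrightarrow> K y \<Longrightarrow> A (y - d)"
    and d: "eq2 i d 0" "eq2 j d 0" "\<not> eq1 k d 0"
    and e: "Lam e" "eq2 i e c" "A (e - d)" and Je: "\<And>y. (\<And>p. p \<in> P \<Longrightarrow> eq2 p y e) \<Longrightarrow> J y"
  shows False
proof -
  note P = labels_mem[OF l] and ne = l[unfolded labels_def]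
  \<comment> \<open>For each line in \<open>J\<close> some element of \<open>B\<close> is chosen
    that lands the entire line. It may vary with the \<open>k\<close>-coordinate of
    \<open>y\<close>.\<close>
  define jb where "jb y = (SOME b. b \<in> B \<and> eq2 i b b1 \<and> \<not> eq1 j b b1 \<and> eq2 k b b1 \<and>
          (\<forall>y'. eq2 i y' c \<and> eq1 j y' c \<and> eq2 k y' y \<longrightarrow> A (y' - (b - b1))))" for y
  have jb: "jb y \<in> B" "eq2 i (jb y) b1" "\<not> eq1 j (jb y) b1" "eq2 k (jb y) b1"
      "\<And>y'. Lam y' \<Longrightarrow> eq2 i y' c \<Longrightarrow> eq2 k y' y \<Longrightarrow> A (y' - (jb y - b1))"
    if y: "Lam y" "eq2 i y c" "J y" for y
  proof -
    have "jb y \<in> B \<and> eq2 i (jb y) b1 \<and> \<not> eq1 j (jb y) b1 \<and> eq2 k (jb y) b1 \<and>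
          (\<forall>y'. eq2 i y' c \<and> eq1 j y' c \<and> eq2 k y' y \<longrightarrow> A (y' - (jb y - b1)))"
      unfolding jb_def by (rule someI_ex) (use J[OF y] in blast)
    moreover have "eq1 j y' c" if "Lam y'" for y' using Lam_eq1[OF that c] P by blast
    ultimately show "jb y \<in> B" "eq2 i (jb y) b1" "\<not> eq1 j (jb y) b1" "eq2 k (jb y) b1"
      "\<And>y'. Lam y' \<Longrightarrow> eq2 i y' c \<Longrightarrow> eq2 k y' y \<Longrightarrow> A (y' - (jb y - b1))" by blast+
  qed
  \<comment> \<open>The displacement to be subtracted: points of \<open>J\<close> move in direction
    \<open>j\<close>, the others in \<open>K\<close> move in direction \<open>k\<close>, and the
    rest already belong to \<open>A\<close>.\<close>
  define g where "g y = (if J y then jb y - b1 else if K y then d else 0)" for y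
  have g_i: "eq2 i (g y) 0" if "Lam y" "eq2 i y c" for y
    using jb(2)[OF that] d unfolding g_def eq2_def by auto
  have g_j: "eq1 j (g y) 0 \<longleftrightarrow> \<not> J y" if "Lam y" "eq2 i y c" for y
    using jb(3)[OF that] eq2_imp_eq1[OF d(2)] unfolding g_def eq1_def by auto
  have g_k: "eq1 k (g y) 0 \<longleftrightarrow> J y \<or> \<not> K y" if "Lam y" "eq2 i y c" for y
    using eq2_imp_eq1[OF jb(4)[OF that]] d unfolding g_def eq1_def by auto
  have ginj: "eq1 p (g y) (g y')" if "eq2 p (y - g y) (y' - g y')" "Lam y" "Lam y'" "p \<in> P" for y y' p
  proof -
    have "eq1 p (y - (y - g y)) (y' - (y' - g y'))"
      by (rule eq1_diff[OF Lam_eq1[OF that(2-4)] eq2_imp_eq1[OF that(1)]])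
    then show ?thesis by simp
  qed
  \<comment> \<open>The image reveals the family of a point, through the residue that has changed.
    Within \<open>J\<close> the \<open>k\<close>-coordinate survives, so both chosen elements land
    the same line, and uniqueness of the landing identifies the displacements.\<close>
  have same: "(\<forall>p\<in>P. eq2 p y y')" if y: "Lam y" "eq2 i y c" "Lam y'" "eq2 i y' c"
    and eq: "\<And>p. p \<in> P \<Longrightarrow> eq2 p (y - g y) (y' - g y')" for y y'
  proof -
    have "eq1 p (g y) 0 \<longleftrightarrow> eq1 p (g y') 0" if "p \<in> P" for p
      using ginj[OF eq[OF that] y(1,3) that] eq1_left by blast
    then have JK: "J y \<longleftrightarrow> J y'" "J y \<or> \<not> K y \<longleftrightarrow> J y' \<or> \<not> K y'"
      using g_j g_k y P by blast+
    have "g y = g y'"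
    proof (cases "J y")
      case True
      note b = jb[OF y(1,2) True] and b' = jb[OF y(3,4) JK(1)[THEN iffD1, OF True]]
      have gy: "g y = jb y - b1" "g y' = jb y' - b1" using True JK unfolding g_def by auto
      have "eq2 k (g y) (g y')"
        unfolding gy by (rule eq2_diff[OF eq2_trans[OF b(4) eq2_sym[OF b'(4)]] eq2_refl])
      then have "eq2 k (y - g y + g y) (y' - g y' + g y')"
        using eq[of k] P unfolding eq2_def
        using dvd_add[of "(int k)\<^sup>2" "y - g y - (y' - g y')" "g y - g y'"] by simp
      then have "eq2 k y y'" by simp
      then have "A (y - (jb y' - b1))" "A (y - (jb y - b1))" using b(5)[of y] b'(5)[of y] y by auto
      then have "land b1 y (y - (jb y' - b1)) (jb y')" "land b1 y (y - (jb y - b1)) (jb y)"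
        using b b' b1 unfolding land_def by auto
      then show ?thesis using land_unique gy by simp
    next
      case False
      then show ?thesis using JK unfolding g_def by auto
    qed
    then show ?thesis using eq unfolding eq2_def by simp
  qed
  \<comment> \<open>By the bound even \<open>e - d\<close> is hit. Only a point moved by
    \<open>d\<close> can land there, and that point would be \<open>e\<close>, which
    \<open>g\<close> moves in direction \<open>j\<close> instead.\<close>
  have "\<exists>y. Lam y \<and> eq2 i y c \<and> (\<forall>p\<in>P. eq2 p (y - g y) (e - d))"
  proof (rule plane_bound)
    show "i \<in> P" "Lam c" "A (e - d)" using P c e by auto
    show "eq2 i (e - d) c" using eq2_diff[OF e(2) d(1)] by simp
    show "A (y - g y) \<and> eq2 i (y - g y) c" if y: "Lam y" "eq2 i y c" for y
      using eq2_diff[OF y(2) g_i[OF y]] jb(5)[OF y _ y] K[OF y] f[OF y] unfolding g_def by auto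
    show "\<forall>p\<in>P. eq2 p y y'" if "Lam y" "eq2 i y c" "Lam y'" "eq2 i y' c"
      "\<And>p. p \<in> P \<Longrightarrow> eq2 p (y - g y) (y' - g y')" for y y'
      using same that .
  qed
  then obtain y where y: "Lam y" "eq2 i y c" "\<forall>p\<in>P. eq2 p (y - g y) (e - d)" by blast
  have "eq1 p (y - (y - g y)) (e - (e - d))" if "p \<in> P" for p
    by (rule eq1_diff[OF Lam_eq1[OF y(1) e(1) that] eq2_imp_eq1]) (use that y(3) in blast)
  then have "eq1 p (g y) 0 \<longleftrightarrow> eq1 p d 0" if "p \<in> P" for p
    using that eq1_left by simp
  then have nJ: "\<not> J y" "K y" using g_j[OF y(1,2)] g_k[OF y(1,2)] d(3) eq2_imp_eq1[OF d(2)] P by blast+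
  then have "g y = d" unfolding g_def by simp
  then have "\<forall>p\<in>P. eq2 p y e" using y(3) unfolding eq2_def by simp
  then show False using Je nJ by blast
qed

end

section \<open>Full planes: a punctured line together with a plane lacking its two central
  lines\<close>

locale full_plane_core = plane_core +
  fixes i j k :: nat and c :: int
  assumes l: "labels i j k" and c: "Lam c"
    and A_iff: "Lam z \<Longrightarrow> A z \<longleftrightarrow> (\<not> eq2 i z c \<and> eq2 j z c \<and> eq2 k z c) \<or>
        (eq2 i z c \<and> \<not> eq2 j z c \<and> \<not> eq2 k z c)"
begin

lemma flip: "full_plane_core P A B x0 i k j c"
  using labels_perm(2)[OF l] c A_iff by unfold_locales blast+

lemma pt:
  assumes "Lam x" "Lam y" "Lam z"
  obtains w where "Lam w" "eq2 i w x" "eq2 j w y" "eq2 k w z"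
    "A w \<longleftrightarrow> (\<not> eq2 i x c \<and> eq2 j y c \<and> eq2 k z c) \<or> (eq2 i x c \<and> \<not> eq2 j y c \<and> \<not> eq2 k z c)"
proof -
  obtain w where w: "Lam w" "eq2 i w x" "eq2 j w y" "eq2 k w z" by (rule crt_Lam[OF l assms])
  then show ?thesis using that A_iff[OF w(1)] eq2_left[OF w(2)] eq2_left[OF w(3)] eq2_left[OF w(4)] by blast
qed

text \<open>The plane \<open>i = c\<close> without its central lines contains pairs of points with
  every pattern of equality in the coordinates \<open>j\<close> and \<open>k\<close>.\<close>

lemma near:
  assumes b: "b \<in> B" "b' \<in> B" "\<And>p. p \<in> P \<Longrightarrow> eq1 p b b'" "eq2 i b b'"
  shows "b = b'"
proof -
  note P = labels_mem[OF l]
  obtain s where s: "Lam s" "\<not> eq2 j s c" using third_point[of j c c] P c by metis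
  obtain s' where s': "Lam s'" "\<not> eq2 j s' c" "\<not> eq2 j s s'"
    using third_point[of j c c s] P c eq2_sym by metis
  obtain w where w: "Lam w" "\<not> eq2 k w c" using third_point[of k c c] P c by metis
  obtain w' where w': "Lam w'" "\<not> eq2 k w' c" "\<not> eq2 k w w'"
    using third_point[of k c c w] P c eq2_sym by metis
  define t where "t = (if eq2 j b b' then s else s')"
  define v where "v = (if eq2 k b b' then w else w')"
  have t: "Lam t" "\<not> eq2 j t c" "eq2 j s t \<longleftrightarrow> eq2 j b b'" using s s' unfolding t_def by auto
  have v: "Lam v" "\<not> eq2 k v c" "eq2 k w v \<longleftrightarrow> eq2 k b b'" using w w' unfolding v_def by auto
  obtain m where m: "Lam m" "A m" "eq2 i m c" "eq2 j m s" "eq2 k m w" using pt[OF c s(1) w(1)] s w by auto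
  obtain n where n: "Lam n" "A n" "eq2 i n c" "eq2 j n t" "eq2 k n v" using pt[OF c t(1) v(1)] t v by auto
  show ?thesis
  proof (rule near_inj[OF l b(1-3) m(1) n(1) m(2) n(2)])
    show "eq2 i m n \<longleftrightarrow> eq2 i b b'" using m n b by (simp add: eq2_left[OF m(3)] eq2_right[OF n(3)])
    show "eq2 j m n \<longleftrightarrow> eq2 j b b'" using t by (simp add: eq2_left[OF m(4)] eq2_right[OF n(4)])
    show "eq2 k m n \<longleftrightarrow> eq2 k b b'" using v by (simp add: eq2_left[OF m(5)] eq2_right[OF n(5)])
  qed
qed

text \<open>Two points of \<open>A\<close> on the \<open>i\<close>-line forbid displacement in
  \<open>i\<close>, and points of the plane then forbid it in \<open>k\<close>. The same analysis
  for each further point of the \<open>j\<close>-line leaves a landing element congruent to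
  \<open>b\<close> modulo all primes, which \<open>near\<close> identifies with
  \<open>b\<close>.\<close>

lemma shifts_j:
  assumes a: "land b0 c a b" and nj: "\<not> eq1 j a c"
  shows "shifts b0 j c"
proof -
  note P = labels_mem[OF l] and ne = l[unfolded labels_def]
  have Aa: "A a" "b0 \<in> B" "b \<in> B" using a unfolding land_def by auto
  have ac: "a \<noteq> c" using nj by auto
  obtain u where u: "Lam u" "\<not> eq2 i u c" "eq2 j u c" "eq2 k u c" "A u"
    using third_point[of i c c] P c ne A_iff by metis
  obtain u' where u': "Lam u'" "\<not> eq2 i u' c" "\<not> eq2 i u' u" "eq2 j u' c" "eq2 k u' c" "A u'"
    using third_point[of i c c u] P c ne A_iff by metis
  have i: "eq2 i a c"
    by (rule two_points[OF a c u(1) u'(1) u(5) u'(6), of i])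
      (use P ne u u' eq2_sym in auto)
  obtain s where s: "Lam s" "\<not> eq2 j s c" using third_point[of j c c] P c by metis
  \<comment> \<open>Avoiding the \<open>k\<close>-coordinate of \<open>a\<close> keeps
    \<open>a - y\<close> displaced in \<open>k\<close> when \<open>a - c\<close> is.\<close>
  obtain w where w: "Lam w" "\<not> eq2 k w c" "\<not> eq2 k w a" using third_point[of k c c a] P c by metis
  obtain y where y: "Lam y" "A y" "eq2 i y c" "eq2 j y s" "eq2 k y w" using pt[OF c s(1) w(1)] s w by auto
  have "\<not> eq2 j c y" using s y eq2_sym eq2_trans by blast
  then obtain q where "q \<in> P" "\<not> eq2 q c y" "eq1 q a c" using pair_A[OF a y(2) c y(1)] P by metis
  then have k1: "eq1 k a c" using y(3) eq2_sym nj ne by auto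
  have k: "eq2 k a c"
  proof (rule ccontr)
    assume n: "\<not> eq2 k a c"
    have L: "eq1 p c y" if "p \<in> P" for p using Lam_eq1[OF c y(1) that] .
    have e1: "eq1 p a y \<longleftrightarrow> eq1 p a c" if "p \<in> P" for p using eq1_right[OF L[OF that]] by simp
    have "a = c"
    proof (rule sands3[OF l a Aa(1) y(2)])
      show "eq1 i a y = eq1 i a c" "eq1 j a y = eq1 j a c" "eq1 k a y = eq1 k a c" using e1 P by auto
      show "eq2 i a y = eq2 i a c" using eq2_right[OF y(3)] by simp
      show "eq2 j a y = eq2 j a c" using nj e1 P eq2_imp_eq1 by blast
      show "eq2 k a y = eq2 k a c" using w n eq2_sym by (auto simp: eq2_right[OF y(5)])
    qed
    then show False using ac by simp
  qed
  have bb: "eq2 i b b0" "\<not> eq1 j b b0" "eq2 k b b0"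
    using i nj k land_eq1[OF a] land_eq2[OF a] by auto
  have line: "A (y - (b - b0))" if y: "eq1 j y c" "\<forall>q\<in>P - {j}. eq2 q y c" for y
  proof -
    have yi: "eq2 i y c" "eq2 k y c" using y ne by auto
    then have yL: "Lam y" using LamI[OF l _ y(1) _ c c c] eq2_imp_eq1 by blast
    obtain a' b' where a': "land b0 y a' b'" using land_ex Aa by blast
    \<comment> \<open>Off the center, the \<open>k\<close>-line through \<open>y\<close> contains at
      least two points of the plane that belong to \<open>A\<close>.\<close>
    have k': "eq2 k a' y" if js: "\<not> eq2 j y c"
    proof -
      obtain w where w: "Lam w" "\<not> eq2 k w c" using third_point[of k c c] P c by metis
      obtain w' where w': "Lam w'" "\<not> eq2 k w' c" "\<not> eq2 k w w'"
        using third_point[of k c c w] P c eq2_sym by metis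
      obtain m where m: "Lam m" "A m" "eq2 i m c" "eq2 j m y" "eq2 k m w" using pt[OF c yL w(1)] js w by auto
      obtain m' where m': "Lam m'" "A m'" "eq2 i m' c" "eq2 j m' y" "eq2 k m' w'" using pt[OF c yL w'(1)] js w' by auto
      show ?thesis
      proof (rule two_points[OF a' yL m(1) m'(1) m(2) m'(2), of k])
        show "k \<in> P" using P by simp
        show "\<not> eq2 k m m'" using w' by (simp add: eq2_left[OF m(5)] eq2_right[OF m'(5)])
        show "eq2 q y m \<and> eq2 q y m'" if "q \<in> P" "q \<noteq> k" for q
          using that ne yi(1) m(4)[THEN eq2_sym] m'(4)[THEN eq2_sym] eq2_right[OF m(3)] eq2_right[OF m'(3)]
          by auto
      qed
    qed
    have "b = b'"
    proof (cases "eq2 j y c")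
      case True
      have "A (a + (y - c))"
      proof (rule periodic[OF Aa(1)])
        have "\<forall>p\<in>P. eq2 p y c" using True yi by (simp add: labels_ball[OF l])
        then show "eq2 p (a + (y - c)) a" if "p \<in> P" for p using that unfolding eq2_def by simp
      qed
      then have "land b0 y (a + (y - c)) b" using a unfolding land_def by auto
      then show ?thesis using land_unique a' by blast
    next
      case False
      have k'': "eq2 k a' y" using k'[OF False] .
      obtain q where "q \<in> P" "\<not> eq2 q y c" "eq1 q b' b"
        using pair[OF a' a yL c _ False] P by blast
      then have jb: "eq1 j b' b" using yi ne by auto
      have nj': "\<not> eq1 j a' y"
        using land_eq1[OF a'] bb(2) eq1_left[OF jb] by blast
      obtain q where "q \<in> P" "\<not> eq2 q y u" "eq1 q a' y"
        using pair_A[OF a' u(5) yL u(1), of j] P False by (metis eq2_right[OF u(3)])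
      then have i1: "eq1 i a' y"
        using nj' ne yi u eq2_right[OF u(4)] by auto
      have i': "eq2 i a' y"
      proof (rule ccontr)
        assume n: "\<not> eq2 i a' y"
        obtain t where t: "Lam t" "\<not> eq2 i t c" "\<not> eq2 i t a'" "eq2 j t c" "eq2 k t c" "A t"
          using third_point[of i c c a'] P c ne A_iff by metis
        have "a' = y"
        proof (rule land_sands_labels[OF l a' yL t(1) t(6)])
          show "eq2 i a' t = eq2 i a' y" using n t eq2_sym by blast
          show "eq1 j a' y \<Longrightarrow> eq2 j a' t = eq2 j a' y" using nj' by blast
          show "eq2 k a' t = eq2 k a' y" by (simp add: eq2_right[OF t(5)] eq2_right[OF yi(2)])
        qed
        then show False using nj' by simp
      qed
      have bi: "eq2 i b b'" "eq2 k b b'"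
        using bb i' k'' land_eq2[OF a'] eq2_sym eq2_trans by blast+
      have "\<forall>p\<in>P. eq1 p b b'" using bi jb eq1_sym eq2_imp_eq1 by (simp add: labels_ball[OF l])
      then show ?thesis using near[of b b'] Aa a' bi unfolding land_def by blast
    qed
    then have "a' = y - (b - b0)" using land_diff[OF a'] by simp
    then show ?thesis using a' unfolding land_def by simp
  qed
  show ?thesis unfolding shifts_def using Aa bb line ne by (intro bexI[of _ b]) auto
qed

text \<open>If neither residue changed, \<open>near\<close> would give \<open>b = b0\<close>, and
  the missing center would belong to \<open>A\<close>.\<close>

lemma shifts_j_or_k:
  assumes "b0 \<in> B"
  shows "shifts b0 j c \<or> shifts b0 k c"
proof -
  note P = labels_mem[OF l] and ne = l[unfolded labels_def]
  interpret f: full_plane_core P A B x0 i k j c by (rule flip)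
  obtain a b where a: "land b0 c a b" using land_ex assms by blast
  have "\<not> (eq1 j a c \<and> eq1 k a c)"
  proof
    assume jk: "eq1 j a c \<and> eq1 k a c"
    obtain u where u: "Lam u" "\<not> eq2 i u c" "eq2 j u c" "eq2 k u c" "A u"
      using third_point[of i c c] P c ne A_iff by metis
    obtain u' where u': "Lam u'" "\<not> eq2 i u' c" "\<not> eq2 i u' u" "eq2 j u' c" "eq2 k u' c" "A u'"
      using third_point[of i c c u] P c ne A_iff by metis
    have i: "eq2 i a c"
      by (rule two_points[OF a c u(1) u'(1) u(5) u'(6), of i])
        (use P ne u u' eq2_sym in auto)
    have "\<forall>p\<in>P. eq1 p b b0" using i jk eq2_imp_eq1 land_eq1[OF a] by (simp add: labels_ball[OF l])
    then have "b = b0" using near[of b b0] i land_eq2[OF a] a unfolding land_def by blast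
    then have "a = c" using land_diff[OF a] by simp
    then have "A c" using a unfolding land_def by blast
    then show False using A_iff[OF c] by simp
  qed
  then show ?thesis using shifts_j[OF a] f.shifts_j[OF a] by blast
qed

text \<open>Base points with different directions would together move both central lines of the
  plane into \<open>A\<close> within one class modulo \<open>i\<^sup>2\<close>. The center lies on
  both lines and so supplies one landing point too many.\<close>

theorem shifts_all: "(\<forall>b0\<in>B. shifts b0 j c) \<or> (\<forall>b0\<in>B. shifts b0 k c)"
proof (rule ccontr)
  assume "\<not> ?thesis"
  then obtain b0 b1 where b: "b0 \<in> B" "b1 \<in> B" "shifts b0 k c" "shifts b1 j c"
    using shifts_j_or_k by blast
  note P = labels_mem[OF l] and ne = l[unfolded labels_def]
  obtain b' where b': "b' \<in> B" "\<not> eq1 k b' b0" "eq2 i b' b0" "eq2 j b' b0"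
      "\<And>y. eq1 k y c \<Longrightarrow> eq2 i y c \<Longrightarrow> eq2 j y c \<Longrightarrow> A (y - (b' - b0))"
    using b(3) ne unfolding shifts_def by auto
  obtain b'' where b'': "b'' \<in> B" "\<not> eq1 j b'' b1" "eq2 i b'' b1" "eq2 k b'' b1"
      "\<And>y. eq1 j y c \<Longrightarrow> eq2 i y c \<Longrightarrow> eq2 k y c \<Longrightarrow> A (y - (b'' - b1))"
    using b(4) ne unfolding shifts_def by auto
  show False
  proof (rule plane_contradiction[OF l c, where J = "\<lambda>y. eq2 k y c" and K = "\<lambda>y. eq2 j y c"
        and d = "b' - b0" and e = c and ?b1.0 = b1])
    show "eq2 k y c \<or> eq2 j y c \<or> A y" if "Lam y" "eq2 i y c" for y using A_iff that by blast
    show "\<exists>b\<in>B. eq2 i b b1 \<and> \<not> eq1 j b b1 \<and> eq2 k b b1 \<and>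
          (\<forall>y'. eq2 i y' c \<and> eq1 j y' c \<and> eq2 k y' y \<longrightarrow> A (y' - (b - b1)))"
      if "Lam y" "eq2 i y c" "eq2 k y c" for y
      using b'' eq2_trans that by (intro bexI[of _ b'']) blast+
    show "A (y - (b' - b0))" if "Lam y" "eq2 i y c" "eq2 j y c" for y
      using b'(5) that Lam_eq1[OF _ c] P by blast
    show "eq2 i (b' - b0) 0" "eq2 j (b' - b0) 0" "\<not> eq1 k (b' - b0) 0"
      using b' unfolding eq1_def eq2_def by auto
    show "eq2 k y c" if "\<And>p. p \<in> P \<Longrightarrow> eq2 p y c" for y using that P by blast
  qed (use b b' c in auto)
qed

end

section \<open>Almost corners: punctured lines in direction i over U and in direction j over its
  complement\<close>

locale almost_corner_core = plane_core +
  fixes i j k :: nat and c :: int and U :: "int \<Rightarrow> bool"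
  assumes l: "labels i j k" and c: "Lam c"
    and U_cong: "eq2 k x y \<Longrightarrow> U x \<longleftrightarrow> U y"
    and U_ex: "\<exists>y. Lam y \<and> U y \<and> \<not> eq2 k y x"
    and U_ex': "\<exists>y. Lam y \<and> \<not> U y \<and> \<not> eq2 k y x"
    and A_iff: "Lam z \<Longrightarrow> A z \<longleftrightarrow> (\<not> eq2 i z c \<and> eq2 j z c \<and> U z) \<or>
        (eq2 i z c \<and> \<not> eq2 j z c \<and> \<not> U z)"
begin

text \<open>Exchanging \<open>i\<close> with \<open>j\<close> and \<open>U\<close> with its
  complement preserves the structure, so points of the center line need be treated over
  \<open>U\<close> only.\<close>

lemma flip: "almost_corner_core P A B x0 j i k c (\<lambda>x. \<not> U x)"
proof unfold_locales
  show "labels j i k" by (rule labels_perm(1)[OF l])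
  show "(\<not> U x) = (\<not> U y)" if "eq2 k x y" for x y using U_cong[OF that] by simp
  show "\<exists>y. Lam y \<and> \<not> U y \<and> \<not> eq2 k y x" "\<exists>y. Lam y \<and> \<not> \<not> U y \<and> \<not> eq2 k y x" for x
    using U_ex[of x] U_ex'[of x] by auto
  show "A z \<longleftrightarrow> (\<not> eq2 j z c \<and> eq2 i z c \<and> \<not> U z) \<or>
        (eq2 j z c \<and> \<not> eq2 i z c \<and> \<not> \<not> U z)" if "Lam z" for z
    using A_iff[OF that] by blast
qed (rule c)

lemma pt:
  assumes "Lam x" "Lam y" "Lam z"
  obtains w where "Lam w" "eq2 i w x" "eq2 j w y" "eq2 k w z" "U w \<longleftrightarrow> U z"
    "A w \<longleftrightarrow> (\<not> eq2 i x c \<and> eq2 j y c \<and> U z) \<or> (eq2 i x c \<and> \<not> eq2 j y c \<and> \<not> U z)"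
proof -
  obtain w where w: "Lam w" "eq2 i w x" "eq2 j w y" "eq2 k w z" by (rule crt_Lam[OF l assms])
  then show ?thesis
    using that A_iff[OF w(1)] U_cong[OF w(4)] eq2_left[OF w(2)] eq2_left[OF w(3)] by blast
qed

lemma near:
  assumes b: "b \<in> B" "b' \<in> B" "\<And>p. p \<in> P \<Longrightarrow> eq1 p b b'" "eq2 i b b'"
  shows "b = b'"
proof -
  note P = labels_mem[OF l]
  obtain s where s: "Lam s" "\<not> eq2 j s c" using third_point[of j c c] P c by metis
  obtain s' where s': "Lam s'" "\<not> eq2 j s' c" "\<not> eq2 j s s'"
    using third_point[of j c c s] P c eq2_sym by metis
  obtain w where w: "Lam w" "\<not> U w" using U_ex' by blast
  obtain w' where w': "Lam w'" "\<not> U w'" "\<not> eq2 k w w'" using U_ex'[of w] eq2_sym by blast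
  define t where "t = (if eq2 j b b' then s else s')"
  define v where "v = (if eq2 k b b' then w else w')"
  have t: "Lam t" "\<not> eq2 j t c" "eq2 j s t \<longleftrightarrow> eq2 j b b'" using s s' unfolding t_def by auto
  have v: "Lam v" "\<not> U v" "eq2 k w v \<longleftrightarrow> eq2 k b b'" using w w' unfolding v_def by auto
  obtain m where m: "Lam m" "A m" "eq2 i m c" "eq2 j m s" "eq2 k m w" using pt[OF c s(1) w(1)] s w by auto
  obtain n where n: "Lam n" "A n" "eq2 i n c" "eq2 j n t" "eq2 k n v" using pt[OF c t(1) v(1)] t v by auto
  show ?thesis
  proof (rule near_inj[OF l b(1-3) m(1) n(1) m(2) n(2)])
    show "eq2 i m n \<longleftrightarrow> eq2 i b b'" using m n b by (simp add: eq2_left[OF m(3)] eq2_right[OF n(3)])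
    show "eq2 j m n \<longleftrightarrow> eq2 j b b'" using t by (simp add: eq2_left[OF m(4)] eq2_right[OF n(4)])
    show "eq2 k m n \<longleftrightarrow> eq2 k b b'" using v by (simp add: eq2_left[OF m(5)] eq2_right[OF n(5)])
  qed
qed

text \<open>The one pattern missing from \<open>near\<close> is a displacement in all three
  directions; it is supplied by one point from each of the two families of lines.\<close>

lemma near_k:
  assumes b: "b \<in> B" "b' \<in> B" "\<And>p. p \<in> P \<Longrightarrow> eq1 p b b'" "\<not> eq2 j b b'" "\<not> eq2 k b b'"
  shows "b = b'"
proof (cases "eq2 i b b'")
  case True
  then show ?thesis using near b by blast
next
  case False
  note P = labels_mem[OF l]
  obtain u where u: "Lam u" "\<not> eq2 i u c" using third_point[of i c c] P c by metis
  obtain s where s: "Lam s" "\<not> eq2 j s c" using third_point[of j c c] P c by metis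
  obtain w where w: "Lam w" "U w" using U_ex by blast
  obtain w' where w': "Lam w'" "\<not> U w'" using U_ex' by blast
  obtain m where m: "Lam m" "A m" "eq2 i m u" "eq2 j m c" "eq2 k m w" using pt[OF u(1) c w(1)] u w by auto
  obtain n where n: "Lam n" "A n" "eq2 i n c" "eq2 j n s" "eq2 k n w'" using pt[OF c s(1) w'(1)] s w' by auto
  show ?thesis
  proof (rule near_inj[OF l b(1-3) m(1) n(1) m(2) n(2)])
    show "eq2 i m n \<longleftrightarrow> eq2 i b b'" using u False by (simp add: eq2_left[OF m(3)] eq2_right[OF n(3)])
    show "eq2 j m n \<longleftrightarrow> eq2 j b b'" using s(2) b(4) eq2_sym eq2_left[OF m(4)] eq2_right[OF n(4)] by blast
    show "eq2 k m n \<longleftrightarrow> eq2 k b b'" using w(2) w'(2) b(5) U_cong[of w w'] eq2_left[OF m(5)] eq2_right[OF n(5)] by blast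
  qed
qed

text \<open>The common \<open>k\<close>-line of all the punctures.\<close>

definition center :: "int \<Rightarrow> bool" where
  "center x \<longleftrightarrow> Lam x \<and> eq2 i x c \<and> eq2 j x c"

lemma center_i:
  assumes a: "land b0 x a b" and x: "center x" "U x"
  shows "eq2 i a x"
proof -
  note P = labels_mem[OF l] and ne = l[unfolded labels_def] and x' = x(1)[unfolded center_def]
  obtain u where u: "Lam u" "\<not> eq2 i u c" using third_point[of i c c] P c by metis
  obtain u' where u': "Lam u'" "\<not> eq2 i u' c" "\<not> eq2 i u u'"
    using third_point[of i c c u] P c eq2_sym by metis
  have xL: "Lam x" using x' by simp
  obtain m where m: "Lam m" "A m" "eq2 i m u" "eq2 j m c" "eq2 k m x" using pt[OF u(1) c xL] u x by auto
  obtain n where n: "Lam n" "A n" "eq2 i n u'" "eq2 j n c" "eq2 k n x" using pt[OF u'(1) c xL] u' x by auto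
  show ?thesis
  proof (rule two_points[OF a xL m(1) n(1) m(2) n(2), of i])
    show "i \<in> P" using P by simp
    show "\<not> eq2 i m n" using u' by (simp add: eq2_left[OF m(3)] eq2_right[OF n(3)])
    show "eq2 q x m \<and> eq2 q x n" if "q \<in> P" "q \<noteq> i" for q
      using that ne x' m(5)[THEN eq2_sym] n(5)[THEN eq2_sym] eq2_right[OF m(4)] eq2_right[OF n(4)]
      by auto
  qed
qed

text \<open>A point of the opposite family, chosen off the \<open>j\<close>-coordinate of
  \<open>a\<close>, excludes first a change of the residue modulo \<open>j\<close> and then a
  displacement modulo its square.\<close>

lemma center_K:
  assumes a: "land b0 x a b" and x: "center x" "U x" and nk: "\<not> eq1 k a x"
  shows "eq2 j a x"
proof (rule ccontr)
  assume n: "\<not> eq2 j a x"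
  note P = labels_mem[OF l] and ne = l[unfolded labels_def] and x' = x(1)[unfolded center_def]
  have xL: "Lam x" using x' by simp
  obtain s where s: "Lam s" "\<not> eq2 j s c" "\<not> eq2 j s a" using third_point[of j c c a] P c by metis
  obtain w where w: "Lam w" "\<not> U w" using U_ex' by blast
  obtain y where y: "Lam y" "A y" "eq2 i y c" "eq2 j y s" "eq2 k y w" using pt[OF c s(1) w(1)] s w by auto
  have xy: "\<not> eq2 j x y" using s(2) x' eq2_sym eq2_right[OF y(4)] eq2_left[of j x c] by blast
  then obtain q where "q \<in> P" "\<not> eq2 q x y" "eq1 q a x" using pair_A[OF a y(2) xL y(1)] P by metis
  then have j1: "eq1 j a x" using nk ne eq2_right[OF y(3)] x' by auto
  have "a = x"
  proof (rule land_sands_labels[OF l a xL y(1) y(2)])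
    show "eq2 i a y = eq2 i a x" using x' by (simp add: eq2_right[OF y(3)] eq2_right[of i x c])
    show "eq2 j a y = eq2 j a x" using n s eq2_sym by (auto simp: eq2_right[OF y(4)])
    show "eq1 k a x \<Longrightarrow> eq2 k a y = eq2 k a x" using nk by blast
  qed
  then show False using nk by simp
qed

text \<open>With residues modulo \<open>i\<close> and \<open>k\<close> preserved, the residue modulo
  \<open>j\<close> must change, since otherwise \<open>near\<close> would put the missing point
  \<open>x\<close> into \<open>A\<close>.\<close>

lemma center_IJ:
  assumes a: "land b0 x a b" and x: "center x" "U x" and k: "eq1 k a x"
  shows "\<not> eq1 j a x" "eq2 k a x"
proof -
  note P = labels_mem[OF l] and ne = l[unfolded labels_def] and x' = x(1)[unfolded center_def]
  have xL: "Lam x" using x' by simp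
  have i: "eq2 i a x" by (rule center_i[OF a x])
  show nj: "\<not> eq1 j a x"
  proof
    assume j: "eq1 j a x"
    have "\<forall>p\<in>P. eq1 p b b0" using i j k eq2_imp_eq1 land_eq1[OF a] by (simp add: labels_ball[OF l])
    then have "b = b0" using near[of b b0] i land_eq2[OF a] a unfolding land_def by blast
    then have "a = x" using land_diff[OF a] by simp
    then have "A x" using a unfolding land_def by blast
    then show False using A_iff[OF xL] x' by simp
  qed
  show "eq2 k a x"
  proof (rule ccontr)
    assume n: "\<not> eq2 k a x"
    obtain s where s: "Lam s" "\<not> eq2 j s c" using third_point[of j c c] P c by metis
    obtain w where w: "Lam w" "\<not> U w" "\<not> eq2 k w a" using U_ex' by blast
    obtain y where y: "Lam y" "A y" "eq2 i y c" "eq2 j y s" "eq2 k y w" using pt[OF c s(1) w(1)] s w by auto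
    have "a = x"
    proof (rule land_sands_labels[OF l a xL y(1) y(2)])
      show "eq2 i a y = eq2 i a x" using x' by (simp add: eq2_right[OF y(3)] eq2_right[of i x c])
      show "eq1 j a x \<Longrightarrow> eq2 j a y = eq2 j a x" using nj by blast
      show "eq2 k a y = eq2 k a x" using n w eq2_sym by (auto simp: eq2_right[OF y(5)])
    qed
    then show False using nj by simp
  qed
qed

text \<open>Distinct points of the center line differ in direction \<open>k\<close> only, so
  \<open>k\<close> is the prime that \<open>pair\<close> provides. Which alternative holds thus
  depends on \<open>b0\<close> alone.\<close>

lemma center_const:
  assumes a: "land b0 x a b" "land b0 y a' b'" and x: "center x" "center y"
  shows "eq1 k b b'"
proof (cases "eq2 k x y")
  case False
  note P = labels_mem[OF l] and ne = l[unfolded labels_def]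
  have L: "Lam x" "Lam y" "eq2 i x y" "eq2 j x y"
    using x eq2_left[of _ x c y] eq2_sym unfolding center_def by blast+
  obtain q where "q \<in> P" "\<not> eq2 q x y" "eq1 q b b'"
    using pair[OF a L(1,2) _ False] P by blast
  then show ?thesis using L ne by auto
next
  case True
  have L: "\<forall>p\<in>P. eq2 p y x"
    using x True eq2_left[of _ y c x] eq2_sym unfolding center_def labels_ball[OF l] by blast
  have "A (a + (y - x))"
  proof (rule periodic)
    show "A a" using a unfolding land_def by simp
    show "eq2 p (a + (y - x)) a" if "p \<in> P" for p using L that unfolding eq2_def by simp
  qed
  then have "land b0 y (a + (y - x)) b" using a unfolding land_def by auto
  from land_unique(2)[OF this a(2)] show ?thesis by simp
qed

text \<open>The condition \<open>eq1 k a x\<close> singles out the second alternative for \<open>b0\<close>: instead of the center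
  line, lines in the directions \<open>i\<close> and \<open>j\<close> are shifted.\<close>

lemma IJ_line:
  assumes a: "land b0 x a b" and x: "center x" "U x" and k: "eq1 k a x"
    and y: "eq2 i y c" "eq1 j y c" "eq2 k y x"
  shows "A (y - (b - b0))"
proof -
  note P = labels_mem[OF l] and ne = l[unfolded labels_def] and x' = x(1)[unfolded center_def]
  have xL: "Lam x" using x' by simp
  have Aa: "A a" "b0 \<in> B" "b \<in> B" using a unfolding land_def by auto
  note ai = center_i[OF a x] and aj = center_IJ(1)[OF a x k] and ak = center_IJ(2)[OF a x k]
  have yL: "Lam y" using LamI[OF l eq2_imp_eq1[OF y(1)] y(2) eq2_imp_eq1[OF y(3)] c c xL] .
  have Uy: "U y" using x(2) U_cong[OF y(3)] by simp
  obtain a' b' where a': "land b0 y a' b'" using land_ex Aa by blast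
  have "b = b'"
  proof (cases "eq2 j y c")
    case True
    have "A (a + (y - x))"
    proof (rule periodic[OF Aa(1)])
      have "\<forall>p\<in>P. eq2 p y x" using True y x' by (simp add: labels_ball[OF l] eq2_right[of _ x c])
      then show "eq2 p (a + (y - x)) a" if "p \<in> P" for p using that unfolding eq2_def by simp
    qed
    then have "land b0 y (a + (y - x)) b" using a unfolding land_def by auto
    then show ?thesis using land_unique a' by blast
  next
    case False
    have yx: "eq2 i y x" "eq2 k y x" "\<not> eq2 j y x" using y x' False by (auto simp: eq2_right[of _ x c])
    obtain q where "q \<in> P" "\<not> eq2 q y x" "eq1 q b' b"
      using pair[OF a' a yL xL _ yx(3)] P by blast
    then have jb: "eq1 j b' b" using yx ne by auto
    have nj': "\<not> eq1 j a' y"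
      using aj land_eq1[OF a] land_eq1[OF a'] eq1_left[OF jb] by blast
    \<comment> \<open>Over the complement of \<open>U\<close> there is a point of \<open>A\<close>
      that differs from \<open>y\<close> in direction \<open>k\<close> only.\<close>
    have k1: "eq1 k a' y"
    proof -
      obtain w where w: "Lam w" "\<not> U w" using U_ex' by blast
      obtain z where z: "Lam z" "A z" "eq2 i z c" "eq2 j z y" "eq2 k z w" using pt[OF c yL w(1)] False w by auto
      have "\<not> eq2 k y z" using w Uy U_cong[of y w] eq2_right[OF z(5)] by blast
      then obtain q where "q \<in> P" "\<not> eq2 q y z" "eq1 q a' y" using pair_A[OF a' z(2) yL z(1)] P by metis
      then show ?thesis using ne y z(4)[THEN eq2_sym] eq2_right[OF z(3)] by auto
    qed
    \<comment> \<open>With the \<open>i\<close>-coordinate of \<open>a'\<close> avoided,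
      \<open>a' - z\<close> will be displaced in \<open>i\<close> whenever \<open>a' - y\<close>
      is.\<close>
    obtain u where u: "Lam u" "\<not> eq2 i u c" "\<not> eq2 i u a'" using third_point[of i c c a'] P c by metis
    obtain z where z: "Lam z" "A z" "eq2 i z u" "eq2 j z c" "eq2 k z y" using pt[OF u(1) c yL] u Uy by auto
    have "\<not> eq2 j y z" using False by (simp add: eq2_right[OF z(4)])
    then obtain q where q: "q \<in> P" "\<not> eq2 q y z" "eq1 q a' y" using pair_A[OF a' z(2) yL z(1)] P by metis
    then have i1: "eq1 i a' y" using ne nj' z(5)[THEN eq2_sym] by auto
    have "\<forall>p\<in>P. eq1 p b b'"
      using jb i1 k1 k eq2_imp_eq1[OF ai] land_eq1[OF a] land_eq1[OF a']
      by (simp add: labels_ball[OF l]) (blast intro: eq1_trans eq1_sym)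
    then have e: "\<And>p. p \<in> P \<Longrightarrow> eq1 p b b'" by blast
    have B: "b \<in> B" "b' \<in> B" using a a' unfolding land_def by auto
    show ?thesis
    proof (rule ccontr)
      assume nb: "b \<noteq> b'"
      \<comment> \<open>If \<open>b\<close> and \<open>b'\<close> were distinct, \<open>near\<close>
        would make them differ modulo \<open>i\<^sup>2\<close>, and the flipped
        \<open>near_k\<close> would make them agree modulo \<open>k\<^sup>2\<close>. Then
        \<open>a' - z\<close> has the type of \<open>a' - y\<close>.\<close>
      have bi: "\<not> eq2 i b b'" using near[OF B e] nb by blast
      then have ni: "\<not> eq2 i a' y"
        using ai land_eq2[OF a] land_eq2[OF a'] eq2_sym eq2_trans by blast
      have kk: "eq2 k a' y"
      proof (rule ccontr)
        interpret f: almost_corner_core P A B x0 j i k c "\<lambda>x. \<not> U x" by (rule flip)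
        assume "\<not> eq2 k a' y"
        then have "\<not> eq2 k b b'" using ak land_eq2[OF a] land_eq2[OF a'] eq2_sym eq2_trans by blast
        then show False using f.near_k[OF B e bi] nb by blast
      qed
      have "a' = y"
      proof (rule land_sands_labels[OF l a' yL z(1) z(2)])
        show "eq2 i a' z = eq2 i a' y" using ni u eq2_sym by (auto simp: eq2_right[OF z(3)])
        show "eq1 j a' y \<Longrightarrow> eq2 j a' z = eq2 j a' y" using nj' by blast
        show "eq2 k a' z = eq2 k a' y" by (simp add: eq2_right[OF z(5)])
      qed
      then show False using nj' by simp
    qed
  qed
  then have "a' = y - (b - b0)" using land_diff[OF a'] by simp
  then show ?thesis using a' unfolding land_def by simp
qed

text \<open>The lemmas \<open>near\<close>, its flipped form and \<open>near_k\<close> leave a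
  second element of the class only one type relative to \<open>b0\<close>: displaced in
  \<open>i\<close> and \<open>j\<close>, not in \<open>k\<close>. Then \<open>b - b'\<close> has the
  type of \<open>a - z\<close>, for a point \<open>z\<close> of \<open>A\<close> on the
  \<open>i\<close>-line of \<open>x\<close>.\<close>

lemma IJ_isolated:
  assumes a: "land b0 x a b" and x: "center x" "U x" and k: "eq1 k a x"
    and b': "b' \<in> B" "\<And>p. p \<in> P \<Longrightarrow> eq1 p b' b0"
  shows "b' = b0"
proof (rule ccontr)
  assume n: "b' \<noteq> b0"
  interpret f: almost_corner_core P A B x0 j i k c "\<lambda>x. \<not> U x" by (rule flip)
  note P = labels_mem[OF l] and ne = l[unfolded labels_def] and x' = x(1)[unfolded center_def]
  have xL: "Lam x" using x' by simp
  have Aa: "A a" "b0 \<in> B" "b \<in> B" using a unfolding land_def by auto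
  note ai = center_i[OF a x] and aj = center_IJ(1)[OF a x k] and ak = center_IJ(2)[OF a x k]
  have e: "\<not> eq2 i b' b0" "\<not> eq2 j b' b0" "eq2 k b' b0"
    using near[of b' b0] f.near[of b' b0] near_k[of b' b0] b' Aa n by blast+
  have bb: "\<not> eq2 i b b'" "eq1 i b b'" "\<not> eq1 j b b'" "eq2 k b b'"
  proof -
    have 1: "eq2 i b b0" "\<not> eq1 j b b0" "eq2 k b b0" using ai aj ak land_eq1[OF a] land_eq2[OF a] by auto
    show "\<not> eq2 i b b'" using 1(1) e(1) eq2_sym by (simp add: eq2_left[OF 1(1)]) blast
    show "eq1 i b b'" using eq2_imp_eq1[OF 1(1)] b'(2)[of i] P eq1_sym eq1_trans by blast
    show "\<not> eq1 j b b'" using 1(2) b'(2)[of j] P by (simp add: eq1_right[of j b' b0])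
    show "eq2 k b b'" using 1(3) e(3) by (simp add: eq2_right[of k b' b0])
  qed
  obtain u where u: "Lam u" "\<not> eq2 i u c" using third_point[of i c c] P c by metis
  obtain z where z: "Lam z" "A z" "eq2 i z u" "eq2 j z c" "eq2 k z x" using pt[OF u(1) c xL] u x by auto
  have e1: "eq1 p a z \<longleftrightarrow> eq1 p a x" if "p \<in> P" for p
    using eq1_right[OF Lam_eq1[OF xL z(1) that]] by simp
  have "\<forall>p\<in>P. (eq1 p a z \<longleftrightarrow> eq1 p b b') \<and> (eq2 p a z \<longleftrightarrow> eq2 p b b')"
  proof -
    have "eq2 i a c" using ai x' eq2_trans by blast
    then have "\<not> eq2 i a z" using u(2) eq2_sym eq2_right[OF z(3)] eq2_left[of i a c] by blast
    moreover have "eq1 i a z" "\<not> eq1 j a z" using e1 P aj eq2_imp_eq1[OF ai] by auto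
    moreover have "eq2 k a z" using ak by (simp add: eq2_right[OF z(5)])
    ultimately show ?thesis using bb eq2_imp_eq1 by (auto simp: labels_ball[OF l])
  qed
  then have "b = b'" using sands[OF Aa(1) z(2) Aa(3) b'(1)] by blast
  then show False using bb by simp
qed

text \<open>By \<open>center_i\<close> and \<open>center_K\<close>, applied on both sides of
  \<open>U\<close>, only direction \<open>k\<close> is displaced. Then \<open>center_const\<close>
  and \<open>near\<close> force one element of \<open>B\<close> for the whole center line.\<close>

lemma K_shifts:
  assumes a: "land b0 x a b" and x: "center x" and k: "\<not> eq1 k a x"
  shows "shifts b0 k c"
proof -
  interpret f: almost_corner_core P A B x0 j i k c "\<lambda>x. \<not> U x" by (rule flip)
  note P = labels_mem[OF l] and ne = l[unfolded labels_def]
  have Aa: "A a" "b0 \<in> B" "b \<in> B" using a unfolding land_def by auto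
  have type: "eq2 i b' b0 \<and> eq2 j b' b0 \<and> \<not> eq1 k b' b0"
    if y: "center y" and a': "land b0 y a' b'" for y a' b'
  proof -
    have nk: "\<not> eq1 k a' y" using k land_eq1[OF a] land_eq1[OF a'] eq1_left[OF center_const[OF a a' x y]] by blast
    have y': "f.center y" using y unfolding center_def f.center_def by simp
    show ?thesis
    proof (cases "U y")
      case True
      show ?thesis using center_i[OF a' y True] center_K[OF a' y True nk] nk land_eq1[OF a'] land_eq2[OF a'] by simp
    next
      case False
      show ?thesis using f.center_i[OF a' y' False] f.center_K[OF a' y' False nk] nk land_eq1[OF a'] land_eq2[OF a'] by simp
    qed
  qed
  have line: "A (y - (b - b0))" if y: "eq1 k y c" "\<forall>q\<in>P - {k}. eq2 q y c" for y
  proof -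
    have yi: "eq2 i y c" "eq2 j y c" using y ne by auto
    have yL: "Lam y" using LamI[OF l eq2_imp_eq1[OF yi(1)] eq2_imp_eq1[OF yi(2)] y(1) c c c] .
    then have yc: "center y" using yi unfolding center_def by simp
    obtain a' b' where a': "land b0 y a' b'" using land_ex Aa by blast
    have e: "eq2 i b b'" "eq2 j b b'" using type[OF yc a'] type[OF x a] eq2_sym eq2_trans by blast+
    have "\<forall>p\<in>P. eq1 p b b'" using center_const[OF a a' x yc] e eq2_imp_eq1 by (simp add: labels_ball[OF l])
    then have "b = b'" using near[of b b'] Aa a' e unfolding land_def by blast
    then have "a' = y - (b - b0)" using land_diff[OF a'] by simp
    then show ?thesis using a' unfolding land_def by simp
  qed
  show ?thesis unfolding shifts_def using Aa type[OF x a] line ne by (intro bexI[of _ b]) auto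
qed

text \<open>If both claims fail, then by \<open>IJ_isolated\<close> some \<open>b0\<close> moves the
  center line while another base point \<open>b1\<close> moves the \<open>j\<close>-lines over
  \<open>U\<close>. Both happen in the plane \<open>i = c\<close>, and a center point over
  \<open>U\<close> belongs to both families.\<close>

theorem shifts_or_inj:
  "(\<forall>b0\<in>B. shifts b0 k c) \<or> (\<forall>b\<in>B. \<forall>b'\<in>B. (\<forall>p\<in>P. eq1 p b b') \<longrightarrow> b = b')"
proof (rule ccontr)
  assume n: "\<not> ?thesis"
  note P = labels_mem[OF l] and ne = l[unfolded labels_def]
  obtain w where w: "Lam w" "U w" using U_ex by blast
  obtain e where e: "Lam e" "eq2 i e c" "eq2 j e c" "U e" using pt[OF c c w(1)] w by metis
  then have ec: "center e" unfolding center_def by simp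
  obtain b1 where b1: "b1 \<in> B" "\<not> shifts b1 k c" using n by blast
  obtain b0 b' where b0: "b0 \<in> B" "b' \<in> B" "\<forall>p\<in>P. eq1 p b' b0" "b' \<noteq> b0" using n by blast
  obtain a b where a: "land b0 e a b" using land_ex b0 by blast
  have nk: "\<not> eq1 k a e" using IJ_isolated[OF a ec e(4)] b0 by blast
  obtain d where d: "d \<in> B" "\<not> eq1 k d b0" "eq2 i d b0" "eq2 j d b0"
      "\<And>y. eq1 k y c \<Longrightarrow> eq2 i y c \<Longrightarrow> eq2 j y c \<Longrightarrow> A (y - (d - b0))"
    using K_shifts[OF a ec nk] ne unfolding shifts_def by auto
  have IJ: "eq1 k a' x" if "center x" "land b1 x a' b'" for x a' b'
    using K_shifts[OF that(2,1)] b1 by blast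
  show False
  proof (rule plane_contradiction[OF l c, where J = U and K = "\<lambda>y. eq2 j y c"
        and d = "d - b0" and e = e and ?b1.0 = b1])
    show "U y \<or> eq2 j y c \<or> A y" if "Lam y" "eq2 i y c" for y using A_iff that by blast
    show "\<exists>b\<in>B. eq2 i b b1 \<and> \<not> eq1 j b b1 \<and> eq2 k b b1 \<and>
          (\<forall>y'. eq2 i y' c \<and> eq1 j y' c \<and> eq2 k y' y \<longrightarrow> A (y' - (b - b1)))"
      if y: "Lam y" "eq2 i y c" "U y" for y
    proof -
      obtain x where x: "Lam x" "eq2 i x c" "eq2 j x c" "eq2 k x y" "U x" using pt[OF c c y(1)] y by metis
      then have xc: "center x" unfolding center_def by simp
      obtain a' b' where a': "land b1 x a' b'" using land_ex b1 by blast
      note k' = IJ[OF xc a']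
      have "A (y' - (b' - b1))" if "eq2 i y' c" "eq1 j y' c" "eq2 k y' y" for y'
        using IJ_line[OF a' xc x(5) k' that(1,2)] that(3) eq2_sym[OF x(4)] eq2_trans by blast
      then show ?thesis
        using center_i[OF a' xc x(5)] center_IJ[OF a' xc x(5) k'] land_eq1[OF a'] land_eq2[OF a'] a'
        unfolding land_def by blast
    qed
    show "A (y - (d - b0))" if "Lam y" "eq2 i y c" "eq2 j y c" for y
      using d(5) that Lam_eq1[OF _ c] P by blast
    show "A (e - (d - b0))" using d(5) e Lam_eq1[OF _ c] P by blast
    show "eq2 i (d - b0) 0" "eq2 j (d - b0) 0" "\<not> eq1 k (d - b0) 0"
      using d unfolding eq1_def eq2_def by auto
    show "U y" if "\<And>p. p \<in> P \<Longrightarrow> eq2 p y e" for y using that[of k] P e U_cong by blast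
  qed (use b1 e in auto)
qed

end

section \<open>Tijdeman's theorem\<close>

lemma finite_primitive_roots: "n > 0 \<Longrightarrow> finite (primitive_roots_unity n)"
proof -
  assume "n > 0"
  then have "finite {z::complex. z ^ n = 1}"
    using card_roots_unity_eq[of n] card_ge_0_finite[of "{z::complex. z ^ n = 1}"] by simp
  then show ?thesis by (rule rev_finite_subset) (auto simp: primitive_roots_unity_def)
qed

lemma poly_mask: "poly (map_poly of_int (mask_poly A)) z = (\<Sum>a\<in>A. z ^ nat a :: complex)"
proof -
  have "poly (map_poly of_int (mask_poly A)) z = (\<Sum>a\<in>A. poly (map_poly of_int (monom 1 (nat a))) z)"
    unfolding mask_poly_def
    by (induction A rule: infinite_finite_induct) (simp_all add: map_poly_of_int_add)
  also have "\<dots> = (\<Sum>a\<in>A. z ^ nat a)"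
    by (simp add: map_poly_monom poly_monom)
  finally show ?thesis .
qed

text \<open>Division by a monic polynomial stays within integer coefficients, and its remainder
  would have more roots than its degree allows.\<close>

lemma cyclotomic_dvd_iff:
  assumes "n > 0"
  shows "cyclotomic n dvd f \<longleftrightarrow> (\<forall>z\<in>primitive_roots_unity n. poly (map_poly of_int f) z = 0)"
proof
  let ?h = "map_poly of_int :: int poly \<Rightarrow> complex poly"
  note h = of_int_cyclotomic[OF assms]
  have fin: "finite (primitive_roots_unity n)" by (rule finite_primitive_roots[OF assms])
  {
    assume "cyclotomic n dvd f"
    then obtain g where "f = cyclotomic n * g" by blast
    then have "?h f = (\<Prod>z\<in>primitive_roots_unity n. [:- z, 1:]) * ?h g"
      by (simp add: map_poly_of_int_mult h)
    then show "\<forall>z\<in>primitive_roots_unity n. poly (?h f) z = 0"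
      using fin by (auto simp: poly_prod)
  next
    assume z: "\<forall>z\<in>primitive_roots_unity n. poly (?h f) z = 0"
    obtain g where g: "lead_coeff g = 1" "?h g = (\<Prod>z\<in>primitive_roots_unity n. [:- z, 1:])"
      using ex_cyclotomic[OF assms] by blast
    have gc: "g = cyclotomic n"
      by (rule injD[OF inj_map_poly_of_int]) (simp only: g h)
    have degh: "degree (?h p) = degree p" for p by (rule degree_map_poly) simp
    have "degree g = degree (?h g)" by (simp add: degh)
    also have "\<dots> = card (primitive_roots_unity n)"
      unfolding g by (subst degree_prod_eq_sum_degree) auto
    finally have dg: "degree g = card (primitive_roots_unity n)" .
    have g0: "g \<noteq> 0" using g by auto
    obtain q r where qr: "pseudo_divmod f g = (q, r)" by (metis surj_pair)
    have eq: "f = g * q + r" using pseudo_divmod(1)[OF g0 qr] g by simp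
    have deg: "r = 0 \<or> degree r < degree g" by (rule pseudo_divmod(2)[OF g0 qr])
    have "r = 0"
    proof (rule ccontr)
      assume r: "r \<noteq> 0"
      then have hr: "?h r \<noteq> 0" by (subst map_poly_eq_0_iff) auto
      have "poly (?h r) z = 0" if "z \<in> primitive_roots_unity n" for z
      proof -
        have "poly (?h g) z = 0" unfolding g using that fin by (simp add: poly_prod)
        moreover have "?h f = ?h g * ?h q + ?h r"
          by (subst eq) (simp only: map_poly_of_int_add map_poly_of_int_mult)
        moreover have "poly (?h f) z = 0" using z that by blast
        ultimately show ?thesis by (metis add_0 mult_zero_left poly_add poly_mult)
      qed
      then have "card (primitive_roots_unity n) \<le> card {z. poly (?h r) z = 0}"
        using hr by (intro card_mono poly_roots_finite) auto
      also have "\<dots> \<le> degree (?h r)" using hr by (intro card_poly_roots_bound)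
      finally show False using deg r dg by (simp add: degh)
    qed
    then show "cyclotomic n dvd f" using eq gc by simp
  }
qed

lemma cyclotomic_dvd_mask_iff:
  "n > 0 \<Longrightarrow> cyclotomic n dvd mask_poly A \<longleftrightarrow>
    (\<forall>z\<in>primitive_roots_unity n. (\<Sum>a\<in>A. z ^ nat a) = 0)"
  by (simp add: cyclotomic_dvd_iff poly_mask)

text \<open>The coefficient at \<open>n\<close> of the reduction of \<open>f\<close> modulo
  \<open>X\<^sup>M - 1\<close>, computed on representatives.\<close>

definition class_sum :: "nat \<Rightarrow> int \<Rightarrow> int poly \<Rightarrow> int" where
  "class_sum M n f = (\<Sum>m | m \<le> degree f \<and> int m mod int M = n mod int M. coeff f m)"

lemma class_sum_bound:
  assumes "degree f \<le> N"
  shows "class_sum M n f = (\<Sum>m | m \<le> N \<and> int m mod int M = n mod int M. coeff f m)"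
  unfolding class_sum_def
proof (rule sum.mono_neutral_left)
  show "finite {m. m \<le> N \<and> int m mod int M = n mod int M}" by simp
  show "\<forall>m\<in>{m. m \<le> N \<and> int m mod int M = n mod int M} -
      {m. m \<le> degree f \<and> int m mod int M = n mod int M}. coeff f m = 0"
    by (auto intro!: coeff_eq_0)
qed (use assms in auto)

lemma class_sum_add: "class_sum M n (f + g) = class_sum M n f + class_sum M n g"
proof -
  let ?N = "max (degree f) (degree g)"
  have "degree (f + g) \<le> ?N" by (rule degree_add_le) auto
  then show ?thesis by (simp add: class_sum_bound[of _ ?N] sum.distrib)
qed

lemma class_sum_0 [simp]: "class_sum M n 0 = 0"
  unfolding class_sum_def by simp

lemma class_sum_sum: "class_sum M n (\<Sum>x\<in>S. f x) = (\<Sum>x\<in>S. class_sum M n (f x))"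
  by (induction S rule: infinite_finite_induct) (simp_all add: class_sum_add)

lemma class_sum_of_nat: "class_sum M n (of_nat q * f) = int q * class_sum M n f"
proof -
  have "degree (of_nat q * f) \<le> degree f"
    using degree_mult_le[of "of_nat q" f] by simp
  then show ?thesis
    unfolding class_sum_bound[of "of_nat q * f" "degree f"] class_sum_def
    by (simp add: of_nat_poly sum_distrib_left)
qed

lemma class_sum_monom_mult: "class_sum M n (monom 1 k * f) = class_sum M (n - int k) f"
proof -
  have deg: "degree (monom 1 k * f) \<le> k + degree f"
    using degree_mult_le[of "monom 1 k" f] by (simp add: degree_monom_eq)
  have "class_sum M n (monom 1 k * f) =
      (\<Sum>m | m \<le> k + degree f \<and> int m mod int M = n mod int M. coeff (monom 1 k * f) m)"
    by (rule class_sum_bound[OF deg])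
  also have "\<dots> = (\<Sum>m | k \<le> m \<and> m \<le> k + degree f \<and> int m mod int M = n mod int M. coeff f (m - k))"
    by (rule sum.mono_neutral_cong_right) (auto simp: coeff_monom_mult)
  also have "\<dots> = class_sum M (n - int k) f"
    unfolding class_sum_def
    by (rule sum.reindex_bij_witness[of _ "\<lambda>m. m + k" "\<lambda>m. m - k"])
      (auto simp: mod_eq_dvd_iff of_nat_diff algebra_simps)
  finally show ?thesis .
qed

lemma class_sum_monom: "class_sum M n (monom 1 k) = (if int k mod int M = n mod int M then 1 else 0)"
proof -
  have "class_sum M n (monom 1 k) = (\<Sum>m | m \<le> k \<and> int m mod int M = n mod int M. if k = m then 1 else 0)"
    by (subst class_sum_bound[of _ k]) (simp_all add: degree_monom_eq)
  also have "\<dots> = (if int k mod int M = n mod int M then 1 else 0)"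
    by (subst sum.delta') auto
  finally show ?thesis .
qed

text \<open>The error term is kept explicit: it is used for integer polynomials, and divisibility by
  \<open>q\<close> is exploited only after passing to class sums.\<close>

lemma freshman:
  fixes f :: "'a \<Rightarrow> 'b::comm_ring_1"
  assumes "prime q"
  shows "\<exists>R. (\<Sum>x\<in>S. f x) ^ q = (\<Sum>x\<in>S. f x ^ q) + of_nat q * R"
proof (induction S rule: infinite_finite_induct)
  case (insert x S)
  obtain R where R: "(\<Sum>x\<in>S. f x) ^ q = (\<Sum>x\<in>S. f x ^ q) + of_nat q * R" using insert by blast
  have binom: "\<exists>R. (u + v) ^ q = u ^ q + v ^ q + of_nat q * R" for u v :: 'b
  proof -
    have q: "q \<ge> 1" using assms prime_ge_1_nat by blast
    have "(u + v) ^ q = (\<Sum>k\<le>q. of_nat (q choose k) * u ^ k * v ^ (q - k))" by (rule binomial_ring)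
    also have "{..q} = insert 0 (insert q {1..<q})" using q by auto
    also have "(\<Sum>k\<in>\<dots>. of_nat (q choose k) * u ^ k * v ^ (q - k)) =
        v ^ q + (u ^ q + (\<Sum>k\<in>{1..<q}. of_nat (q choose k) * u ^ k * v ^ (q - k)))"
      using q by (subst sum.insert, simp, force)+ simp
    also have "(\<Sum>k\<in>{1..<q}. of_nat (q choose k) * u ^ k * v ^ (q - k)) =
        (\<Sum>k\<in>{1..<q}. of_nat q * (of_nat ((q choose k) div q) * u ^ k * v ^ (q - k)))"
    proof (rule sum.cong)
      fix k assume "k \<in> {1..<q}"
      then have "q dvd (q choose k)" using assms by (intro dvd_choose_prime) auto
      then have "(of_nat (q choose k) :: 'b) = of_nat q * of_nat ((q choose k) div q)"
        by (metis dvd_mult_div_cancel of_nat_mult)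
      then show "of_nat (q choose k) * u ^ k * v ^ (q - k) =
          of_nat q * (of_nat ((q choose k) div q) * u ^ k * v ^ (q - k))" by (simp add: mult.assoc)
    qed simp
    also have "\<dots> = of_nat q * (\<Sum>k\<in>{1..<q}. of_nat ((q choose k) div q) * u ^ k * v ^ (q - k))"
      by (simp add: sum_distrib_left)
    finally show ?thesis
      by (intro exI[of _ "\<Sum>k\<in>{1..<q}. of_nat ((q choose k) div q) * u ^ k * v ^ (q - k)"])
        (simp only: ac_simps)
  qed
  obtain R' where "(f x + (\<Sum>x\<in>S. f x)) ^ q = f x ^ q + (\<Sum>x\<in>S. f x) ^ q + of_nat q * R'"
    using binom by blast
  then have "(\<Sum>x\<in>insert x S. f x) ^ q = (\<Sum>x\<in>insert x S. f x ^ q) + of_nat q * (R + R')"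
    using insert R by (simp add: algebra_simps)
  then show ?case by blast
qed (use assms prime_gt_0_nat[OF assms] in \<open>auto intro!: exI[of _ 0] simp: power_0_left\<close>)

section \<open>Tilings as bijections, and their dilates\<close>

lemma tilingD:
  assumes "tiling M A B"
  shows "A \<subseteq> Zmod M" "B \<subseteq> Zmod M" "finite A" "finite B"
    "a \<in> A \<Longrightarrow> a' \<in> A \<Longrightarrow> b \<in> B \<Longrightarrow> b' \<in> B \<Longrightarrow> (a + b) mod int M = (a' + b') mod int M \<Longrightarrow> a = a' \<and> b = b'"
proof -
  show s: "A \<subseteq> Zmod M" "B \<subseteq> Zmod M" using assms unfolding tiling_def by auto
  show "finite A" "finite B" using s finite_subset unfolding Zmod_def by blast+
  have "inj_on (\<lambda>(a, b). (a + b) mod int M) (A \<times> B)"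
    using assms unfolding tiling_def bij_betw_def by blast
  then show "a \<in> A \<Longrightarrow> a' \<in> A \<Longrightarrow> b \<in> B \<Longrightarrow> b' \<in> B \<Longrightarrow> (a + b) mod int M = (a' + b') mod int M \<Longrightarrow> a = a' \<and> b = b'"
    by (auto dest!: inj_onD[of _ _ "(a, b)" "(a', b')"])
qed

lemma tiling_ex:
  assumes "tiling M A B" "M > 0"
  obtains a b where "a \<in> A" "b \<in> B" "(a + b) mod int M = n mod int M"
proof -
  have "n mod int M \<in> (\<lambda>(a, b). (a + b) mod int M) ` (A \<times> B)"
    using assms unfolding tiling_def bij_betw_def Zmod_def by auto
  then show ?thesis using that by auto
qed

lemma tiling_card: "tiling M A B \<Longrightarrow> card A * card B = M"
  using bij_betw_same_card[of _ "A \<times> B" "Zmod M"] unfolding tiling_def Zmod_def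
  by (auto simp: card_cartesian_product)

lemma tilingI:
  assumes "A \<subseteq> Zmod M" "B \<subseteq> Zmod M" "card A * card B = M" "M > 0"
    and "\<And>n. n \<in> Zmod M \<Longrightarrow> \<exists>a\<in>A. \<exists>b\<in>B. (a + b) mod int M = n"
  shows "tiling M A B"
proof -
  have fin: "finite (A \<times> B)" using assms(1,2) finite_subset unfolding Zmod_def by blast
  let ?f = "\<lambda>(a, b). (a + b) mod int M"
  have "?f ` (A \<times> B) = Zmod M"
    using assms(4,5) by (fastforce simp: Zmod_def)
  moreover from this have "inj_on ?f (A \<times> B)"
    using assms(3) fin by (intro eq_card_imp_inj_on) (auto simp: Zmod_def card_cartesian_product)
  ultimately show ?thesis using assms unfolding tiling_def bij_betw_def by blast
qed

lemma tiling_commute: "tiling M A B \<Longrightarrow> tiling M B A"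
proof (cases "M > 0")
  case True
  assume t: "tiling M A B"
  show ?thesis
  proof (rule tilingI)
    show "\<exists>a\<in>B. \<exists>b\<in>A. (a + b) mod int M = n" if "n \<in> Zmod M" for n
      using tiling_ex[OF t True, of n] that unfolding Zmod_def by (metis add.commute atLeastLessThan_iff mod_pos_pos_trivial)
  qed (use t tilingD tiling_card[OF t] True in \<open>auto simp: mult.commute\<close>)
next
  case False
  assume "tiling M A B"
  then show ?thesis using False unfolding tiling_def Zmod_def bij_betw_def by auto
qed

definition dilate :: "nat \<Rightarrow> nat \<Rightarrow> int set \<Rightarrow> int set" where
  "dilate M r A = (\<lambda>a. (int r * a) mod int M) ` A"

text \<open>Tijdeman's theorem. Modulo the prime \<open>q\<close>, the mask of \<open>q A\<close> is the \<open>q\<close>-th power of the mask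
  of \<open>A\<close>, and \<open>A(X)\<^sup>q B(X)\<close> has all coefficients modulo \<open>X\<^sup>M - 1\<close> equal to \<open>|A|\<^sup>q\<^sup>-\<^sup>1\<close>.\<close>

lemma tiling_dilate_prime:
  assumes t: "tiling M A B" and M: "M > 0" and q: "prime q" "\<not> q dvd card A"
  shows "tiling M (dilate M q A) B" "card (dilate M q A) = card A"
proof -
  let ?A = "mask_poly A" and ?B = "mask_poly B"
  note T = tilingD[OF t]
  have nn: "a \<ge> 0" if "a \<in> A \<or> a \<in> B" for a using that T(1,2) unfolding Zmod_def by auto
  have AB: "class_sum M n (?A * ?B) = 1" for n
  proof -
    obtain a0 b0 where ab: "a0 \<in> A" "b0 \<in> B" "(a0 + b0) mod int M = n mod int M" using tiling_ex[OF t M] .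
    have "class_sum M n (?A * ?B) = (\<Sum>a\<in>A. \<Sum>b\<in>B. class_sum M n (monom 1 (nat a + nat b)))"
      by (simp add: mask_poly_def sum_product class_sum_sum mult_monom)
    also have "\<dots> = (\<Sum>a\<in>A. \<Sum>b\<in>B. if a = a0 \<and> b = b0 then 1 else 0)"
    proof (intro sum.cong refl)
      fix a b assume "a \<in> A" "b \<in> B"
      then have "(a + b) mod int M = n mod int M \<longleftrightarrow> a = a0 \<and> b = b0"
        using ab T(5)[of a a0 b b0] by auto
      then show "class_sum M n (monom 1 (nat a + nat b)) = (if a = a0 \<and> b = b0 then 1 else 0)"
        using nn \<open>a \<in> A\<close> \<open>b \<in> B\<close> by (simp add: class_sum_monom)
    qed
    also have "\<dots> = (\<Sum>a\<in>A. if a = a0 then \<Sum>b\<in>B. if b = b0 then 1 else 0 else 0)"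
      by (intro sum.cong) auto
    also have "\<dots> = 1" using ab T(3,4) by simp
    finally show ?thesis .
  qed
  have mult: "class_sum M n (?A * f) = int (card A) * K" if "\<And>n. class_sum M n f = K" for f K n
    by (simp add: mask_poly_def[of A] sum_distrib_right class_sum_sum class_sum_monom_mult that)
  have pow: "class_sum M n (?A ^ k * (?A * ?B)) = int (card A) ^ k" for n k
    by (induction k arbitrary: n) (simp_all add: AB mult mult.assoc)
  obtain R where R: "?A ^ q = (\<Sum>a\<in>A. monom 1 (nat a) ^ q) + of_nat q * R"
    unfolding mask_poly_def using freshman[OF q(1)] by blast
  have q1: "Suc (q - 1) = q" using prime_gt_0_nat[OF q(1)] by simp
  have main: "int (card A) ^ (q - 1) =
      (\<Sum>a\<in>A. \<Sum>b\<in>B. class_sum M n (monom 1 (nat a * q + nat b))) + int q * class_sum M n (R * ?B)" for n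
  proof -
    have "?A ^ (q - 1) * (?A * ?B) = ?A ^ q * ?B" using q1 by (metis mult.assoc power_Suc2)
    also have "\<dots> = (\<Sum>a\<in>A. \<Sum>b\<in>B. monom 1 (nat a * q + nat b)) + of_nat q * (R * ?B)"
      by (simp add: R distrib_right mask_poly_def[of B] sum_product monom_power mult_monom mult.assoc)
    finally show ?thesis
      using pow[of n "q - 1"] by (simp only: class_sum_add class_sum_sum class_sum_of_nat)
  qed
  \<comment> \<open>If \<open>n\<close> had no representation, the double sum in \<open>main\<close>
    would vanish and \<open>q\<close> would divide a power of \<open>|A|\<close>.\<close>
  have ex: "\<exists>a\<in>A. \<exists>b\<in>B. (int q * a + b) mod int M = n mod int M" for n
  proof (rule ccontr)
    assume n: "\<not> ?thesis"
    have "(\<Sum>a\<in>A. \<Sum>b\<in>B. class_sum M n (monom 1 (nat a * q + nat b))) = 0"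
    proof (intro sum.neutral ballI)
      fix a b assume "a \<in> A" "b \<in> B"
      then show "class_sum M n (monom 1 (nat a * q + nat b)) = 0"
        using n nn by (auto simp: class_sum_monom mult.commute)
    qed
    then have "int q dvd int (card A) ^ (q - 1)" using main[of n] by simp
    then have "q dvd card A ^ (q - 1)" by (metis int_dvd_int_iff of_nat_power)
    then have "q dvd card A" using q(1) prime_dvd_power by blast
    then show False using q(2) by simp
  qed
  let ?f = "\<lambda>(a, b). (int q * a + b) mod int M"
  have "Zmod M \<subseteq> ?f ` (A \<times> B)"
  proof
    fix n assume "n \<in> Zmod M"
    then have "n mod int M = n" unfolding Zmod_def by simp
    then show "n \<in> ?f ` (A \<times> B)" using ex[of n] by force
  qed
  \<comment> \<open>Surjectivity between sets of equal size makes the map injective, which also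
    shows that the dilation does not identify elements of \<open>A\<close>.\<close>
  then have "card (Zmod M) \<le> card (?f ` (A \<times> B))" using T(3,4) by (intro card_mono) auto
  then have "card (A \<times> B) \<le> card (?f ` (A \<times> B))"
    using tiling_card[OF t] by (simp add: Zmod_def card_cartesian_product)
  then have inj: "inj_on ?f (A \<times> B)"
    using T(3,4) card_image_le[of "A \<times> B" ?f] by (intro eq_card_imp_inj_on) auto
  have B: "B \<noteq> {}" using ex by blast
  then obtain b where b: "b \<in> B" by blast
  have "inj_on (\<lambda>a. (int q * a) mod int M) A"
  proof (rule inj_onI)
    fix a a' assume a: "a \<in> A" "a' \<in> A" "(int q * a) mod int M = (int q * a') mod int M"
    then have "?f (a, b) = ?f (a', b)" by (metis (no_types) mod_add_left_eq case_prod_conv)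
    then show "a = a'" using inj a b unfolding inj_on_def by blast
  qed
  then show c: "card (dilate M q A) = card A" unfolding dilate_def by (rule card_image)
  show "tiling M (dilate M q A) B"
  proof (rule tilingI)
    show "dilate M q A \<subseteq> Zmod M" using M unfolding dilate_def Zmod_def by auto
    show "card (dilate M q A) * card B = M" using c tiling_card[OF t] by simp
    fix n assume "n \<in> Zmod M"
    then have "n mod int M = n" unfolding Zmod_def by simp
    then obtain a b where "a \<in> A" "b \<in> B" "(int q * a + b) mod int M = n" using ex[of n] by auto
    then show "\<exists>a\<in>dilate M q A. \<exists>b\<in>B. (a + b) mod int M = n"
      unfolding dilate_def by (auto simp: mod_add_left_eq)
  qed (use T M in auto)
qed

text \<open>One prime factor of \<open>r\<close> is handled at a time. Being prime to
  \<open>M\<close>, it does not divide the cardinality of the current dilate, which is a divisor of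
  \<open>M\<close>.\<close>

lemma tiling_dilate:
  assumes "tiling M A B" "M > 0" "coprime r M" "r > 0"
  shows "tiling M (dilate M r A) B \<and> card (dilate M r A) = card A"
  using assms(3,4)
proof (induction r rule: less_induct)
  case (less r)
  show ?case
  proof (cases "r = 1")
    case True
    have "dilate M 1 A = A"
      using tilingD(1)[OF assms(1)] unfolding dilate_def Zmod_def by (force simp: image_iff)
    then show ?thesis using True assms by simp
  next
    case False
    then obtain q where q: "prime q" "q dvd r" using prime_factor_nat by blast
    then obtain s where s: "r = q * s" by blast
    have s0: "s > 0" "s < r" using less.prems s prime_gt_1_nat[OF q(1)] by auto
    have "coprime s M" "coprime q M" using less.prems s by auto
    then have IH: "tiling M (dilate M s A) B" "card (dilate M s A) = card A" using less.IH s0 by auto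
    have "\<not> q dvd card (dilate M s A)"
    proof
      assume "q dvd card (dilate M s A)"
      then have "q dvd M" using tiling_card[OF assms(1)] IH(2) by (metis dvd_mult2)
      then show False using \<open>coprime q M\<close> q(1) by (metis coprime_def dvd_refl not_prime_unit)
    qed
    note D = tiling_dilate_prime[OF IH(1) assms(2) q(1) this]
    have "dilate M q (dilate M s A) = dilate M r A"
      unfolding dilate_def image_image s by (simp add: mod_mult_right_eq mult.assoc)
    then show ?thesis using D IH by simp
  qed
qed

section \<open>Masks at roots of unity and the plane bound\<close>

lemma power_mod_eq:
  fixes z :: complex
  assumes "z ^ n = 1"
  shows "z ^ m = z ^ (m mod n)"
proof -
  have "z ^ m = (z ^ n) ^ (m div n) * z ^ (m mod n)" by (simp flip: power_mult power_add)
  then show ?thesis using assms by simp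
qed

lemma primitive_root_pow_eq_1_iff:
  assumes "z \<in> primitive_roots_unity n" "n > 0"
  shows "z ^ m = 1 \<longleftrightarrow> n dvd m"
proof
  have z: "z ^ n = 1" "\<And>m. 0 < m \<Longrightarrow> m < n \<Longrightarrow> z ^ m \<noteq> 1"
    using assms unfolding primitive_roots_unity_def by auto
  note zm = power_mod_eq[OF z(1), of m]
  show "n dvd m" if "z ^ m = 1"
    using z(2)[of "m mod n"] zm that assms(2) by (auto simp: dvd_eq_mod_eq_0)
  show "z ^ m = 1" if "n dvd m" using zm that by (simp add: dvd_eq_mod_eq_0)
qed

lemma primitive_root_generates:
  assumes w: "w \<in> primitive_roots_unity n" and n: "n > 0" and z: "z ^ n = 1"
  shows "\<exists>r. z = w ^ r"
proof -
  note wi = primitive_root_pow_eq_1_iff[OF w n]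
  have w0: "w \<noteq> 0" using w n unfolding primitive_roots_unity_def by (auto simp: power_0_left)
  have inj: "inj_on ((^) w) {..<n}"
  proof -
    have "u = v" if "w ^ u = w ^ v" "u \<le> v" "v < n" for u v
    proof -
      have "w ^ u * w ^ (v - u) = w ^ (u + (v - u))" by (simp only: power_add)
      then have "w ^ u * w ^ (v - u) = w ^ u * 1" using that by simp
      then have "w ^ (v - u) = 1" using w0 by simp
      then have "n dvd v - u" using wi by simp
      then show ?thesis using that dvd_imp_le[of n "v - u"] by (cases "v = u") auto
    qed
    then show ?thesis unfolding inj_on_def by (metis lessThan_iff linear)
  qed
  have c: "card {z::complex. z ^ n = 1} = n" using card_roots_unity_eq n by simp
  have "(^) w ` {..<n} = {z::complex. z ^ n = 1}"
  proof (rule card_seteq)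
    show "finite {z::complex. z ^ n = 1}" using c n card_ge_0_finite by metis
    show "(^) w ` {..<n} \<subseteq> {z. z ^ n = 1}"
      using wi by (auto simp flip: power_mult)
    show "card {z::complex. z ^ n = 1} \<le> card ((^) w ` {..<n})"
      using card_image[OF inj] c by simp
  qed
  then show ?thesis using z by blast
qed

lemma pow_nat_cong:
  fixes z :: complex
  assumes "z ^ n = 1" "0 \<le> x" "0 \<le> y" "int n dvd x - y"
  shows "z ^ nat x = z ^ nat y"
proof -
  have "x mod int n = y mod int n" using assms(4) by (simp add: mod_eq_dvd_iff)
  then have "nat x mod n = nat y mod n" using assms(2,3) by (metis nat_int nat_mod_distrib of_nat_0_le_iff)
  then show ?thesis using power_mod_eq[OF assms(1)] by metis
qed

lemma poly_zero_of_roots_unity: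
  fixes f :: "complex poly"
  assumes "n > 0" "degree f < n" "\<And>z. z ^ n = 1 \<Longrightarrow> poly f z = 0"
  shows "f = 0"
proof (rule ccontr)
  assume f: "f \<noteq> 0"
  have "n = card {z::complex. z ^ n = 1}" using card_roots_unity_eq assms(1) by simp
  also have "\<dots> \<le> card {z. poly f z = 0}" using assms f by (intro card_mono poly_roots_finite) auto
  also have "\<dots> \<le> degree f" using f by (intro card_poly_roots_bound)
  finally show False using assms by simp
qed

text \<open>Reducing exponents modulo \<open>n\<close> gives polynomials of degree below
  \<open>n\<close> that agree at \<open>n\<close> points, so their coefficients, which count
  residues, are equal.\<close>

lemma card_residue_eq:
  fixes f :: "'a \<Rightarrow> int" and g :: "'b \<Rightarrow> int"
  assumes n: "n > 0" and fin: "finite S" "finite T"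
    and nn: "\<And>s. s \<in> S \<Longrightarrow> f s \<ge> 0" "\<And>t. t \<in> T \<Longrightarrow> g t \<ge> 0"
    and eq: "\<And>z::complex. z ^ n = 1 \<Longrightarrow> (\<Sum>s\<in>S. z ^ nat (f s)) = (\<Sum>t\<in>T. z ^ nat (g t))"
  shows "card {s \<in> S. f s mod int n = r} = card {t \<in> T. g t mod int n = r}"
proof (cases "0 \<le> r \<and> r < int n")
  case True
  define h :: "complex poly" where
    "h = (\<Sum>s\<in>S. monom 1 (nat (f s) mod n)) - (\<Sum>t\<in>T. monom 1 (nat (g t) mod n))"
  have d: "degree (monom (1::complex) (m mod n)) < n" for m
    using n by (simp add: degree_monom_eq)
  have "degree (\<Sum>s\<in>S. monom (1::complex) (nat (f s) mod n)) < n"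
    "degree (\<Sum>t\<in>T. monom (1::complex) (nat (g t) mod n)) < n"
    using d n by (auto intro!: degree_sum_less)
  then have "degree h < n" unfolding h_def by (rule degree_diff_less)
  moreover have "poly h z = 0" if z: "z ^ n = 1" for z
  proof -
    show ?thesis
      using eq[OF z] unfolding h_def by (simp add: poly_sum poly_monom power_mod_eq[OF z, symmetric])
  qed
  ultimately have "h = 0" by (rule poly_zero_of_roots_unity[OF n])
  then have "coeff h (nat r) = 0" by simp
  have m: "nat x mod n = nat r \<longleftrightarrow> x mod int n = r" if "x \<ge> 0" for x
    using that True by (metis eq_nat_nat_iff nat_int nat_mod_distrib of_nat_0_le_iff pos_mod_sign n of_nat_0_less_iff)
  have "of_nat (card {s \<in> S. nat (f s) mod n = nat r}) = (\<Sum>s\<in>S. coeff (monom (1::complex) (nat (f s) mod n)) (nat r))"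
    using fin by (simp add: sum.If_cases Int_def)
  moreover have "of_nat (card {t \<in> T. nat (g t) mod n = nat r}) = (\<Sum>t\<in>T. coeff (monom (1::complex) (nat (g t) mod n)) (nat r))"
    using fin by (simp add: sum.If_cases Int_def)
  ultimately have "(of_nat (card {s \<in> S. nat (f s) mod n = nat r}) :: complex) = of_nat (card {t \<in> T. nat (g t) mod n = nat r})"
    using \<open>coeff h (nat r) = 0\<close> by (simp add: h_def coeff_sum)
  then have "card {s \<in> S. nat (f s) mod n = nat r} = card {t \<in> T. nat (g t) mod n = nat r}" by (simp only: of_nat_eq_iff)
  moreover have "{s \<in> S. nat (f s) mod n = nat r} = {s \<in> S. f s mod int n = r}" using m nn by blast
  moreover have "{t \<in> T. nat (g t) mod n = nat r} = {t \<in> T. g t mod int n = r}" using m nn by blast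
  ultimately show ?thesis by simp
next
  case False
  then have "{s \<in> S. f s mod int n = r} = {}" "{t \<in> T. g t mod int n = r} = {}" using n by auto
  then show ?thesis by (simp only: card.empty)
qed

definition mask_at :: "int set \<Rightarrow> complex \<Rightarrow> complex" where
  "mask_at A z = (\<Sum>a\<in>A. z ^ nat a)"

lemma cyclotomic_dvd_mask: "n > 0 \<Longrightarrow> cyclotomic n dvd mask_poly A \<longleftrightarrow>
    (\<forall>z\<in>primitive_roots_unity n. mask_at A z = 0)"
  unfolding mask_at_def by (rule cyclotomic_dvd_mask_iff)

lemma mask_at_bij:
  assumes "bij_betw h S T" "\<And>n. n \<in> S \<Longrightarrow> z ^ nat (h n) = c * z ^ nat n"
  shows "mask_at T z = c * mask_at S z"
  using sum.reindex_bij_betw[OF assms(1), of "\<lambda>n. z ^ nat n"] assms(2)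
  unfolding mask_at_def by (simp add: sum_distrib_left)

text \<open>The product of the masks is the sum of \<open>z\<close> to all residues modulo
  \<open>M\<close>, a vanishing geometric sum.\<close>

lemma mask_at_tiling:
  assumes t: "tiling M A B" and M: "M > 0" and z: "z ^ M = 1" "z \<noteq> 1"
  shows "mask_at A z = 0 \<or> mask_at B z = 0"
proof -
  note T = tilingD[OF t]
  have nn: "a \<ge> 0" if "a \<in> A \<or> a \<in> B" for a using that T(1,2) unfolding Zmod_def by auto
  have "mask_at A z * mask_at B z = (\<Sum>x\<in>A \<times> B. z ^ nat (fst x) * z ^ nat (snd x))"
    unfolding mask_at_def by (simp add: sum_product sum.cartesian_product case_prod_unfold)
  also have "\<dots> = (\<Sum>x\<in>A \<times> B. z ^ nat ((fst x + snd x) mod int M))"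
  proof (rule sum.cong)
    fix x assume "x \<in> A \<times> B"
    then have "fst x \<ge> 0" "snd x \<ge> 0" using nn by auto
    then have "z ^ nat (fst x) * z ^ nat (snd x) = z ^ nat (fst x + snd x)"
      by (simp add: nat_add_distrib power_add)
    also have "\<dots> = z ^ nat ((fst x + snd x) mod int M)"
      using \<open>fst x \<ge> 0\<close> \<open>snd x \<ge> 0\<close> M by (intro pow_nat_cong[OF z(1)]) auto
    finally show "z ^ nat (fst x) * z ^ nat (snd x) = z ^ nat ((fst x + snd x) mod int M)" .
  qed simp
  also have "\<dots> = (\<Sum>n\<in>Zmod M. z ^ nat n)"
    using sum.reindex_bij_betw[of "\<lambda>x. (fst x + snd x) mod int M" "A \<times> B" "Zmod M" "\<lambda>n. z ^ nat n"] t
    unfolding tiling_def by (simp add: case_prod_unfold)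
  also have "\<dots> = (\<Sum>m<M. z ^ m)"
    unfolding Zmod_def
    by (rule sum.reindex_bij_witness[of _ int nat]) auto
  also have "\<dots> = 0"
    using z geometric_sum[of z M] by simp
  finally show ?thesis by simp
qed

text \<open>Modulo \<open>p\<^sup>2\<close>, integers of the same type are associates. The factor is
  a quotient of the two, formed after a common factor \<open>p\<close> is removed in the
  intermediate case.\<close>

lemma unit_scaling:
  fixes p :: nat and d e :: int
  assumes p: "prime p" and 1: "int p dvd d \<longleftrightarrow> int p dvd e" and 2: "(int p)\<^sup>2 dvd d \<longleftrightarrow> (int p)\<^sup>2 dvd e"
  shows "\<exists>r. (int p)\<^sup>2 dvd r * d - e \<and> \<not> int p dvd r"
proof -
  have ip: "prime (int p)" using p by simp
  consider "(int p)\<^sup>2 dvd d" | "int p dvd d" "\<not> (int p)\<^sup>2 dvd d" | "\<not> int p dvd d" by blast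
  then show ?thesis
  proof cases
    case 1
    then have "(int p)\<^sup>2 dvd 1 * d - e" using 2 by simp
    moreover have "\<not> int p dvd 1" using ip not_prime_unit by blast
    ultimately show ?thesis by blast
  next
    case 2
    then obtain d' e' where de: "d = int p * d'" "e = int p * e'" using 1 by blast
    have n: "\<not> int p dvd d'" "\<not> int p dvd e'"
      using 2 assms(3) p prime_gt_0_nat unfolding de power2_eq_square by auto
    then have "coprime d' (int p)" using ip n prime_imp_coprime coprime_commute by blast
    then obtain x where x: "[d' * x = 1] (mod int p)" using cong_solve_coprime_int by blast
    then have dv: "int p dvd d' * x - 1" by (simp add: cong_iff_dvd_diff)
    have "(e' * x) * d - e = int p * (e' * (d' * x - 1))" unfolding de by (simp add: algebra_simps)
    moreover have "int p * int p dvd int p * (e' * (d' * x - 1))" using dv by (intro mult_dvd_mono) auto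
    moreover have "\<not> int p dvd x"
    proof
      assume "int p dvd x"
      then have "int p dvd d' * x - (d' * x - 1)" by (rule dvd_diff[OF dvd_mult dv])
      then have "int p dvd 1" by simp
      then show False using ip not_prime_unit by blast
    qed
    then have "\<not> int p dvd e' * x" using n ip prime_dvd_mult_iff by blast
    ultimately show ?thesis by (intro exI[of _ "e' * x"]) (simp add: power2_eq_square)
  next
    case 3
    then have "coprime d (int p)" using ip prime_imp_coprime coprime_commute by blast
    then have "coprime d ((int p)\<^sup>2)" by simp
    then obtain x where x: "[d * x = 1] (mod (int p)\<^sup>2)" using cong_solve_coprime_int by blast
    then have dv: "(int p)\<^sup>2 dvd d * x - 1" by (simp add: cong_iff_dvd_diff)
    then have dv1: "int p dvd d * x - 1" by (metis dvd_mult_left power2_eq_square)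
    have "(e * x) * d - e = e * (d * x - 1)" by (simp add: algebra_simps)
    moreover have "\<not> int p dvd x"
    proof
      assume "int p dvd x"
      then have "int p dvd d * x - (d * x - 1)" by (rule dvd_diff[OF dvd_mult dv1])
      then have "int p dvd 1" by simp
      then show False using ip not_prime_unit by blast
    qed
    then have "\<not> int p dvd e * x" using 3 1 ip prime_dvd_mult_iff by blast
    ultimately show ?thesis using dv by (metis dvd_mult)
  qed
qed

context prime_triple
begin

lemma labels_ex: obtains i j k where "labels i j k"
proof -
  obtain p where "p \<in> P" using card_P by fastforce
  then show ?thesis using labels_obtain that by metis
qed

lemma finite_P: "finite P" using card_P card.infinite by fastforce

lemma labels_prod: "labels i j k \<Longrightarrow> (\<Prod>p\<in>P. f p) = f i * f j * (f k :: 'a::comm_monoid_mult)"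
  unfolding labels_def by (auto simp: mult.assoc)

end

definition wrap :: "nat \<Rightarrow> int set \<Rightarrow> int \<Rightarrow> bool" where
  "wrap M A n \<longleftrightarrow> n mod int M \<in> A"

section \<open>The actual tiling, its periodic extension and its cyclotomic divisors\<close>

locale tiling_setting = prime_triple +
  fixes M :: nat and A B :: "int set"
  assumes M_def: "M = (\<Prod>p\<in>P. p\<^sup>2)"
    and tile: "tiling M A B"
    and card_A: "card A = \<Prod>P" and card_B: "card B = \<Prod>P"
begin

lemma swap: "tiling_setting P M B A"
  using M_def tiling_commute[OF tile] card_A card_B by unfold_locales auto

lemma M_pos: "M > 0"
  unfolding M_def using prime_P prime_gt_0_nat by (intro prod_pos) auto

lemma dvd_M_iff: "int M dvd d \<longleftrightarrow> (\<forall>p\<in>P. (int p)\<^sup>2 dvd d)"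
proof -
  obtain i j k where l: "labels i j k" by (rule labels_ex)
  note c = labels_coprime[OF l]
  have M: "int M = (int i)\<^sup>2 * (int j)\<^sup>2 * (int k)\<^sup>2"
    unfolding M_def by (simp add: labels_prod[OF l])
  show ?thesis
  proof
    assume "\<forall>p\<in>P. (int p)\<^sup>2 dvd d"
    then have d: "(int i)\<^sup>2 dvd d" "(int j)\<^sup>2 dvd d" "(int k)\<^sup>2 dvd d" by (auto simp: labels_ball[OF l])
    then have "(int i)\<^sup>2 * (int j)\<^sup>2 dvd d" using c by (intro divides_mult) auto
    then show "int M dvd d" unfolding M using c d by (intro divides_mult) auto
  next
    assume "int M dvd d"
    then show "\<forall>p\<in>P. (int p)\<^sup>2 dvd d"
      unfolding M by (auto simp: labels_ball[OF l] dest: dvd_mult_left dvd_mult_right)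
  qed
qed

lemma eq2_iff_mod: "(\<forall>p\<in>P. eq2 p x y) \<longleftrightarrow> x mod int M = y mod int M"
  by (simp add: mod_eq_dvd_iff dvd_M_iff eq2_def)

lemma eq2_mod [simp]: "p \<in> P \<Longrightarrow> eq2 p (x mod int M) y \<longleftrightarrow> eq2 p x y"
  and eq1_mod [simp]: "p \<in> P \<Longrightarrow> eq1 p (x mod int M) y \<longleftrightarrow> eq1 p x y"
proof -
  assume p: "p \<in> P"
  have "\<forall>p\<in>P. eq2 p (x mod int M) x" unfolding eq2_iff_mod by simp
  then have "eq2 p (x mod int M) x" using p by blast
  then show "eq2 p (x mod int M) y \<longleftrightarrow> eq2 p x y" "eq1 p (x mod int M) y \<longleftrightarrow> eq1 p x y"
    using eq2_left eq1_left eq2_imp_eq1 by blast+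
qed

lemma wrap_mem: "n \<in> Zmod M \<Longrightarrow> wrap M A n \<longleftrightarrow> n \<in> A"
  unfolding wrap_def Zmod_def by simp

text \<open>Local units are glued by the Chinese remainder theorem; adding \<open>M\<close> to the
  residue keeps \<open>s\<close> positive.\<close>

lemma coprime_unit:
  assumes "\<And>p. p \<in> P \<Longrightarrow> \<not> int p dvd r p"
  obtains s where "s > 0" "coprime s M" "\<And>p. p \<in> P \<Longrightarrow> eq2 p (int s) (r p)"
proof -
  obtain i j k where l: "labels i j k" by (rule labels_ex)
  obtain w where w: "eq2 i w (r i)" "eq2 j w (r j)" "eq2 k w (r k)" using crt[OF l] by blast
  define s where "s = nat (w mod int M) + M"
  have "(int s) mod int M = w mod int M" unfolding s_def using M_pos by simp
  then have "\<forall>p\<in>P. eq2 p (int s) w" using eq2_iff_mod by blast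
  moreover have "\<forall>p\<in>P. eq2 p w (r p)" using w by (simp add: labels_ball[OF l])
  ultimately have s: "\<forall>p\<in>P. eq2 p (int s) (r p)" using eq2_trans by blast
  have "coprime s M"
    unfolding M_def
  proof (rule prod_coprime_right)
    fix p assume p: "p \<in> P"
    have "\<not> int p dvd int s"
    proof
      assume "int p dvd int s"
      moreover have "int p dvd int s - r p" using s p eq2_imp_eq1 unfolding eq1_def by blast
      ultimately have "int p dvd int s - (int s - r p)" by (rule dvd_diff)
      then show False using assms[OF p] by simp
    qed
    then have "\<not> p dvd s" by simp
    then show "coprime s (p\<^sup>2)"
      using prime_P[OF p] by (simp add: coprime_commute prime_imp_coprime)
  qed
  then show ?thesis using that[of s] s M_pos unfolding s_def by auto
qed

text \<open>Differences of equal type are related by a unit \<open>s\<close> of the integers modulo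
  \<open>M\<close>. Then \<open>s * a + b'\<close> and \<open>s * a' + b\<close> are congruent,
  whereas the dilate of \<open>A\<close> by \<open>s\<close> still tiles with
  \<open>B\<close>.\<close>

lemma sands_tiling:
  assumes "a \<in> A" "a' \<in> A" "b \<in> B" "b' \<in> B"
    and "\<And>p. p \<in> P \<Longrightarrow> eq1 p a a' \<longleftrightarrow> eq1 p b b'"
    and "\<And>p. p \<in> P \<Longrightarrow> eq2 p a a' \<longleftrightarrow> eq2 p b b'"
  shows "b = b'"
proof -
  have "\<exists>r. (int p)\<^sup>2 dvd r * (a - a') - (b - b') \<and> \<not> int p dvd r" if "p \<in> P" for p
    using unit_scaling[OF prime_P[OF that]] assms(5,6)[OF that] unfolding eq1_def eq2_def by blast
  then obtain r where r: "\<And>p. p \<in> P \<Longrightarrow> (int p)\<^sup>2 dvd r p * (a - a') - (b - b') \<and> \<not> int p dvd r p"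
    by metis
  obtain s where s: "s > 0" "coprime s M" "\<And>p. p \<in> P \<Longrightarrow> eq2 p (int s) (r p)"
    using coprime_unit[of r] r by blast
  have "(int p)\<^sup>2 dvd int s * (a - a') - (b - b')" if "p \<in> P" for p
  proof -
    have "(int p)\<^sup>2 dvd (int s - r p) * (a - a') + (r p * (a - a') - (b - b'))"
      using s(3)[OF that] r[OF that] unfolding eq2_def by (intro dvd_add dvd_mult2) auto
    then show ?thesis by (simp add: algebra_simps)
  qed
  then have "int M dvd int s * (a - a') - (b - b')" unfolding dvd_M_iff by blast
  then have "(int s * a + b') mod int M = (int s * a' + b) mod int M"
    by (simp add: mod_eq_dvd_iff algebra_simps)
  then have e: "((int s * a) mod int M + b') mod int M = ((int s * a') mod int M + b) mod int M"
    by (simp add: mod_add_left_eq)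
  have "tiling M (dilate M s A) B" using tiling_dilate[OF tile M_pos s(2,1)] by blast
  from tilingD(5)[OF this _ _ assms(4,3) e] show ?thesis
    using assms(1,2) unfolding dilate_def by blast
qed

lemma tiling_core: "tiling_core P (wrap M A) B"
proof unfold_locales
  show "\<exists>b\<in>B. wrap M A (n - b)" for n
  proof -
    obtain a b where ab: "a \<in> A" "b \<in> B" "(a + b) mod int M = n mod int M"
      using tiling_ex[OF tile M_pos] .
    have "(n - b) mod int M = a mod int M" using ab(3) by (metis add_diff_cancel_right' mod_diff_left_eq)
    also have "\<dots> = a" using ab(1) tilingD(1)[OF tile] unfolding Zmod_def by auto
    finally show ?thesis using ab unfolding wrap_def by auto
  qed
  show "wrap M A n" if "wrap M A m" "\<And>p. p \<in> P \<Longrightarrow> eq2 p n m" for m n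
    using that eq2_iff_mod[of n m] unfolding wrap_def by auto
  show "b = b'" if "wrap M A m" "wrap M A n" "b \<in> B" "b' \<in> B"
      "\<And>p. p \<in> P \<Longrightarrow> eq1 p m n \<longleftrightarrow> eq1 p b b'" "\<And>p. p \<in> P \<Longrightarrow> eq2 p m n \<longleftrightarrow> eq2 p b b'" for m n b b'
  proof (rule sands_tiling[of "m mod int M" "n mod int M"])
    have "eq1 p n' (n mod int M) \<longleftrightarrow> eq1 p n' n" "eq2 p n' (n mod int M) \<longleftrightarrow> eq2 p n' n" if "p \<in> P" for n' p
      using eq1_mod[OF that] eq2_mod[OF that] eq1_sym eq2_sym by blast+
    then show "eq1 p (m mod int M) (n mod int M) \<longleftrightarrow> eq1 p b b'"
      "eq2 p (m mod int M) (n mod int M) \<longleftrightarrow> eq2 p b b'" if "p \<in> P" for p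
      using that \<open>\<And>p. p \<in> P \<Longrightarrow> eq1 p m n \<longleftrightarrow> eq1 p b b'\<close> \<open>\<And>p. p \<in> P \<Longrightarrow> eq2 p m n \<longleftrightarrow> eq2 p b b'\<close> by auto
  qed (use that in \<open>auto simp: wrap_def\<close>)
qed

text \<open>Dilating \<open>A\<close> by units, the mask of \<open>A\<close> is seen to vanish at all primitive roots of order \<open>s\<close>
  as soon as that of \<open>B\<close> does not vanish at one of them.\<close>

lemma dichotomy:
  assumes p: "p \<in> P" and e: "e = 1 \<or> e = 2"
  shows "(\<forall>z\<in>primitive_roots_unity (p ^ e). mask_at A z = 0) \<or>
    (\<forall>z\<in>primitive_roots_unity (p ^ e). mask_at B z = 0)"
proof (rule disjCI)
  let ?s = "p ^ e"
  have pp: "prime p" "p > 1" using prime_P[OF p] prime_gt_1_nat by auto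
  have s1: "?s > 1" using pp e by (auto simp: power2_eq_square one_less_mult)
  have sp: "?s dvd p\<^sup>2" using e by (auto simp: power2_eq_square)
  have "int (p\<^sup>2) dvd int M" using dvd_M_iff[of "int M"] p by auto
  then have sM: "?s dvd M" using sp by (meson dvd_trans int_dvd_int_iff)
  assume "\<not> (\<forall>z\<in>primitive_roots_unity ?s. mask_at B z = 0)"
  then obtain w where w: "w \<in> primitive_roots_unity ?s" "mask_at B w \<noteq> 0" by blast
  have s0: "?s > 0" using s1 by linarith
  note wi = primitive_root_pow_eq_1_iff[OF w(1) s0]
  show "\<forall>z\<in>primitive_roots_unity ?s. mask_at A z = 0"
  proof
    fix z assume z: "z \<in> primitive_roots_unity ?s"
    obtain r where r: "z = w ^ r"
      using primitive_root_generates[OF w(1) s0] z unfolding primitive_roots_unity_def by blast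
    have "\<not> p dvd r"
    proof
      assume "p dvd r"
      then obtain t where t: "r = p * t" by blast
      have se: "?s = p * p ^ (e - 1)" using e by (auto simp: power2_eq_square)
      have "z ^ (p ^ (e - 1)) = w ^ (?s * t)" unfolding r t se by (simp flip: power_mult add: ac_simps)
      also have "\<dots> = 1" using wi s1 by simp
      finally have "?s dvd p ^ (e - 1)" using primitive_root_pow_eq_1_iff[OF z s0] by simp
      then have "?s \<le> p ^ (e - 1)" using pp by (intro dvd_imp_le) auto
      moreover have "p ^ (e - 1) < ?s" using pp e by (intro power_strict_increasing) auto
      ultimately show False by simp
    qed
    \<comment> \<open>The unit is to act as \<open>r\<close> at \<open>p\<close> and trivially at
      the other primes, so that dilation by it carries \<open>w\<close> to \<open>z\<close> and
      remains prime to \<open>M\<close>.\<close>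
    then have nd: "\<not> int q dvd (if q = p then int r else 1)" if "q \<in> P" for q
      using prime_P[OF that] not_prime_unit[of "int q"] by auto
    obtain s where s: "s > 0" "coprime s M" "\<And>q. q \<in> P \<Longrightarrow> eq2 q (int s) (if q = p then int r else 1)"
      using coprime_unit[of "\<lambda>q. if q = p then int r else 1", OF nd] by blast
    have sr: "eq2 p (int s) (int r)" using s(3)[OF p] by simp
    have tl: "tiling M (dilate M s A) B" and cd: "card (dilate M s A) = card A"
      using tiling_dilate[OF tile M_pos s(2,1)] by auto
    have wM: "w ^ M = 1" "w \<noteq> 1"
      using wi[of M] sM s1 wi[of 1] by auto
    have "mask_at (dilate M s A) w = 0"
      using mask_at_tiling[OF tl M_pos wM] w(2) by blast
    moreover have "mask_at (dilate M s A) w = mask_at A (w ^ s)"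
    proof -
      have inj: "inj_on (\<lambda>a. (int s * a) mod int M) A"
        using cd tilingD(3)[OF tile] unfolding dilate_def by (intro eq_card_imp_inj_on)
      have "w ^ nat ((int s * a) mod int M) = (w ^ s) ^ nat a" if "a \<in> A" for a
      proof -
        have a: "a \<ge> 0" using that tilingD(1)[OF tile] unfolding Zmod_def by auto
        have "w ^ nat ((int s * a) mod int M) = w ^ nat (int s * a)"
          using a M_pos by (intro pow_nat_cong[OF wM(1)]) (auto simp: mod_eq_dvd_iff[symmetric])
        then show ?thesis using a by (simp add: nat_mult_distrib power_mult)
      qed
      then show ?thesis
        unfolding mask_at_def dilate_def by (simp add: sum.reindex[OF inj])
    qed
    moreover have "w ^ s = w ^ r"
    proof -
      have "int ?s dvd int s - int r"
        using sr sp unfolding eq2_def by (metis dvd_trans of_nat_dvd_iff of_nat_power)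
      from pow_nat_cong[OF _ _ _ this, of w] show ?thesis using wi[of ?s] s1 by simp
    qed
    ultimately show "mask_at A z = 0" using r by simp
  qed
qed

text \<open>Replace each \<open>a\<close> once by \<open>n\<close> copies of itself and once by
  \<open>a, ..., a + n - 1\<close>. The exponential sums agree at all \<open>n\<close>-th roots of
  unity: away from \<open>1\<close> both the mask and the geometric sum vanish. The second family
  meets every class once per element of \<open>A\<close>.\<close>

lemma card_residue_class_1:
  assumes n: "n > 0" and z: "\<And>z. z ^ n = 1 \<Longrightarrow> z \<noteq> 1 \<Longrightarrow> mask_at A z = 0" and r: "0 \<le> r" "r < int n"
  shows "n * card {a \<in> A. a mod int n = r} = card A"
proof -
  have fin: "finite A" using tilingD(3)[OF tile] .
  have nn: "a \<ge> 0" if "a \<in> A" for a using that tilingD(1)[OF tile] unfolding Zmod_def by auto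
  have "card {x \<in> A \<times> {..<n}. fst x mod int n = r} = card {x \<in> A \<times> {..<n}. (fst x + int (snd x)) mod int n = r}"
  proof (rule card_residue_eq[OF n])
    fix z :: complex assume zn: "z ^ n = 1"
    have 1: "(\<Sum>x\<in>A \<times> {..<n}. z ^ nat (fst x)) = of_nat n * mask_at A z"
      unfolding mask_at_def by (simp add: sum.cartesian_product' sum_distrib_left)
    have "(\<Sum>x\<in>A \<times> {..<n}. z ^ nat (fst x + int (snd x))) = (\<Sum>a\<in>A. \<Sum>t<n. z ^ nat a * z ^ t)"
      unfolding sum.cartesian_product' by (intro sum.cong refl) (use nn in \<open>simp add: nat_add_distrib power_add\<close>)
    also have "\<dots> = mask_at A z * (\<Sum>t<n. z ^ t)"
      unfolding mask_at_def by (simp add: sum_product)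
    finally show "(\<Sum>x\<in>A \<times> {..<n}. z ^ nat (fst x)) = (\<Sum>x\<in>A \<times> {..<n}. z ^ nat (fst x + int (snd x)))"
      using 1 z[OF zn] by (cases "z = 1") auto
  qed (use fin nn in auto)
  moreover have "{x \<in> A \<times> {..<n}. fst x mod int n = r} = {a \<in> A. a mod int n = r} \<times> {..<n}" by auto
  moreover have "card {x \<in> A \<times> {..<n}. (fst x + int (snd x)) mod int n = r} = card A"
  proof -
    have "bij_betw fst {x \<in> A \<times> {..<n}. (fst x + int (snd x)) mod int n = r} A"
    proof (rule bij_betw_byWitness[where f' = "\<lambda>a. (a, nat ((r - a) mod int n))"])
      show "\<forall>x\<in>{x \<in> A \<times> {..<n}. (fst x + int (snd x)) mod int n = r}. (fst x, nat ((r - fst x) mod int n)) = x"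
      proof (clarsimp)
        fix a t assume "t < n" "r = (a + int t) mod int n"
        then show "nat (((a + int t) mod int n - a) mod int n) = t" by (simp add: mod_diff_left_eq)
      qed
      show "(\<lambda>a. (a, nat ((r - a) mod int n))) ` A \<subseteq> {x \<in> A \<times> {..<n}. (fst x + int (snd x)) mod int n = r}"
        using n r by (auto simp: mod_add_right_eq nat_less_iff)
    qed auto
    then show ?thesis by (rule bij_betw_same_card)
  qed
  ultimately show ?thesis by (simp add: card_cartesian_product mult.commute)
qed

text \<open>Translation of \<open>A\<close> by a multiple of \<open>p\<close> leaves its exponential
  sums at the roots of order dividing \<open>p\<^sup>2\<close> unchanged: the root is a
  \<open>p\<close>-th root of unity, or the mask vanishes. So the \<open>p\<close> classes modulo
  \<open>p\<^sup>2\<close> inside one class modulo \<open>p\<close> contain equally many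
  elements.\<close>

lemma card_residue_class_2:
  assumes p: "p > 0" and z: "\<And>z. z \<in> primitive_roots_unity (p\<^sup>2) \<Longrightarrow> mask_at A z = 0"
    and order: "\<And>z. z ^ (p\<^sup>2) = 1 \<Longrightarrow> z ^ p = 1 \<or> z \<in> primitive_roots_unity (p\<^sup>2)"
  shows "p * card {a \<in> A. (int p)\<^sup>2 dvd a - c} \<le> card A"
proof -
  have fin: "finite A" using tilingD(3)[OF tile] .
  have nn: "a \<ge> 0" if "a \<in> A" for a using that tilingD(1)[OF tile] unfolding Zmod_def by auto
  define S where "S t = {a \<in> A. (int p)\<^sup>2 dvd a - (c - int (p * t))}" for t
  have p2: "p\<^sup>2 > 0" using p by simp
  have "card {a \<in> A. a mod int (p\<^sup>2) = (c - int (p * t)) mod int (p\<^sup>2)} = card {a \<in> A. a mod int (p\<^sup>2) = c mod int (p\<^sup>2)}" for t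
  proof -
    have "card {a \<in> A. (a + int (p * t)) mod int (p\<^sup>2) = c mod int (p\<^sup>2)} = card {a \<in> A. a mod int (p\<^sup>2) = c mod int (p\<^sup>2)}"
    proof (rule card_residue_eq[OF p2])
      fix w :: complex assume w: "w ^ p\<^sup>2 = 1"
      have "(\<Sum>a\<in>A. w ^ nat (a + int (p * t))) = (w ^ p) ^ t * mask_at A w"
        unfolding mask_at_def sum_distrib_left
        by (rule sum.cong) (use nn in \<open>auto simp: nat_add_distrib power_add power_mult nat_mult_distrib\<close>)
      also have "\<dots> = mask_at A w" using order[OF w] z by auto
      finally show "(\<Sum>a\<in>A. w ^ nat (a + int (p * t))) = (\<Sum>a\<in>A. w ^ nat a)" unfolding mask_at_def .
    qed (use fin nn in auto)
    moreover have "(a + int (p * t)) mod int (p\<^sup>2) = c mod int (p\<^sup>2) \<longleftrightarrow>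
        a mod int (p\<^sup>2) = (c - int (p * t)) mod int (p\<^sup>2)" for a
      by (simp add: mod_eq_dvd_iff algebra_simps)
    ultimately show ?thesis by simp
  qed
  then have cS: "card (S t) = card {a \<in> A. (int p)\<^sup>2 dvd a - c}" for t
    unfolding S_def by (simp add: mod_eq_dvd_iff)
  have disj: "\<forall>t\<in>{..<p}. \<forall>t'\<in>{..<p}. t \<noteq> t' \<longrightarrow> S t \<inter> S t' = {}"
  proof -
    have "t = t'" if "a \<in> S t" "a \<in> S t'" "t < p" "t' < p" for a t t'
    proof -
      have "(int p)\<^sup>2 dvd (a - (c - int (p * t))) - (a - (c - int (p * t')))"
        using that unfolding S_def by (metis (no_types, lifting) dvd_diff mem_Collect_eq)
      moreover have "(a - (c - int (p * t))) - (a - (c - int (p * t'))) = int p * (int t - int t')"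
        by (simp add: algebra_simps)
      ultimately have "int p dvd int t - int t'" using p by (simp add: power2_eq_square)
      then show ?thesis using that by (metis mod_eq_dvd_iff mod_less of_nat_eq_iff zmod_int)
    qed
    then show ?thesis by blast
  qed
  have "p * card {a \<in> A. (int p)\<^sup>2 dvd a - c} = (\<Sum>t<p. card (S t))" by (simp add: cS)
  also have "\<dots> = card (\<Union>t<p. S t)"
    using disj fin by (intro card_UN_disjoint[symmetric]) (auto simp: S_def)
  also have "\<dots> \<le> card A" using fin by (intro card_mono) (auto simp: S_def)
  finally show ?thesis .
qed


definition vanishes :: "int set \<Rightarrow> nat \<Rightarrow> bool" where
  "vanishes S n \<longleftrightarrow> (\<forall>z\<in>primitive_roots_unity n. mask_at S z = 0)"

lemma order_square:
  fixes z :: complex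
  assumes p: "prime p" and z: "z ^ p\<^sup>2 = 1"
  shows "z ^ p = 1 \<or> z \<in> primitive_roots_unity (p\<^sup>2)"
proof -
  have "p > 0" using p prime_gt_0_nat by simp
  then have "p\<^sup>2 > 0" by simp
  moreover have "z \<in> {z. z ^ p\<^sup>2 = 1}" using z by simp
  ultimately have "z \<in> (\<Union>d\<in>{d. d dvd p\<^sup>2}. primitive_roots_unity d)"
    by (simp only: roots_unity_eq_Union)
  then obtain d where d: "d dvd p\<^sup>2" "z \<in> primitive_roots_unity d" by blast
  then obtain m where "m \<le> 2" "d = p ^ m" using divides_primepow_nat[OF p] by blast
  then have "d dvd p \<or> d = p\<^sup>2" by (cases "m = 2") (auto simp: le_Suc_eq numeral_2_eq_2)
  moreover have "z ^ p = 1" if "d dvd p"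
  proof -
    have "d > 0" using that \<open>p > 0\<close> dvd_pos_nat by blast
    then show ?thesis using primitive_root_pow_eq_1_iff[OF d(2)] that by blast
  qed
  ultimately show ?thesis using d by auto
qed

lemma order_prime:
  fixes z :: complex
  assumes p: "prime p" and z: "z ^ p = 1" "z \<noteq> 1"
  shows "z \<in> primitive_roots_unity p"
proof -
  have "p > 0" using p prime_gt_0_nat by simp
  moreover have "z \<in> {z. z ^ p = 1}" using z by simp
  ultimately have "z \<in> (\<Union>d\<in>{d. d dvd p}. primitive_roots_unity d)"
    by (simp only: roots_unity_eq_Union)
  then obtain d where d: "d dvd p" "z \<in> primitive_roots_unity d" by blast
  then have "d = 1 \<or> d = p" using p prime_nat_iff by blast
  moreover have "d \<noteq> 1" using d z unfolding primitive_roots_unity_def by auto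
  ultimately show ?thesis using d by simp
qed

lemma prod_P: "p \<in> P \<Longrightarrow> \<exists>m. \<Prod>P = p * m \<and> \<not> p dvd m \<and> m > 0"
proof -
  assume p: "p \<in> P"
  then obtain j k where l: "labels p j k" using labels_obtain by blast
  have "\<Prod>P = p * (j * k)" using labels_prod[OF l, of "\<lambda>x. x"] by (simp add: mult.assoc)
  moreover have "\<not> p dvd j * k"
  proof
    assume "p dvd j * k"
    then have "p dvd j \<or> p dvd k" using prime_P[OF p] prime_dvd_mult_iff by blast
    then show False
      using primes_dvd_imp_eq prime_P labels_mem[OF l] l unfolding labels_def by metis
  qed
  moreover have "j * k > 0" using prime_P labels_mem[OF l] prime_gt_0_nat by simp
  ultimately show ?thesis by blast
qed

text \<open>Otherwise \<open>A\<close> would be equidistributed modulo \<open>p\<^sup>2\<close>, but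
  \<open>|A|\<close> contains \<open>p\<close> only once.\<close>

lemma not_vanishes_both:
  assumes p: "p \<in> P"
  shows "\<not> (vanishes A p \<and> vanishes A (p\<^sup>2))"
proof
  assume v: "vanishes A p \<and> vanishes A (p\<^sup>2)"
  have p0: "p > 0" using prime_P[OF p] prime_gt_0_nat by simp
  have "p\<^sup>2 * card {a \<in> A. a mod int (p\<^sup>2) = 0} = card A"
  proof (rule card_residue_class_1)
    fix z :: complex assume z: "z ^ p\<^sup>2 = 1" "z \<noteq> 1"
    then have "z \<in> primitive_roots_unity p \<or> z \<in> primitive_roots_unity (p\<^sup>2)"
      using order_square[OF prime_P[OF p]] order_prime[OF prime_P[OF p]] by blast
    then show "mask_at A z = 0" using v unfolding vanishes_def by blast
  qed (use p0 in auto)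
  then have "p\<^sup>2 dvd \<Prod>P" unfolding card_A[symmetric] by (rule dvdI[OF sym])
  then show False using prod_P[OF p] p0 by (auto simp: power2_eq_square)
qed

text \<open>At each of the two orders one factor vanishes by \<open>dichotomy\<close>, and neither
  factor can vanish at both, so the two orders are split between \<open>A\<close> and
  \<open>B\<close>.\<close>

lemma vanishes_iff:
  assumes p: "p \<in> P"
  shows "vanishes A (p\<^sup>2) \<longleftrightarrow> \<not> vanishes A p" "vanishes B p \<longleftrightarrow> \<not> vanishes A p"
proof -
  interpret s: tiling_setting P M B A by (rule swap)
  have "vanishes A p \<or> vanishes B p" "vanishes A (p\<^sup>2) \<or> vanishes B (p\<^sup>2)"
    using dichotomy[OF p, of 1] dichotomy[OF p, of 2] unfolding vanishes_def by auto
  then show "vanishes A (p\<^sup>2) \<longleftrightarrow> \<not> vanishes A p" "vanishes B p \<longleftrightarrow> \<not> vanishes A p"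
    using not_vanishes_both[OF p] s.not_vanishes_both[OF p] unfolding vanishes_def s.vanishes_def by blast+
qed

text \<open>Vanishing at order \<open>p\<^sup>2\<close> compares the class with its translates by
  multiples of \<open>p\<close>; vanishing at order \<open>p\<close> already bounds the larger class
  modulo \<open>p\<close>.\<close>

lemma plane_card:
  assumes p: "p \<in> P"
  shows "p * card {a \<in> A. eq2 p a c} \<le> card A"
proof (cases "vanishes A p")
  case False
  then have "vanishes A (p\<^sup>2)" using vanishes_iff[OF p] by blast
  then show ?thesis
    using card_residue_class_2[of p c] order_square[OF prime_P[OF p]] prime_gt_0_nat[OF prime_P[OF p]]
    unfolding vanishes_def eq2_def by blast
next
  case True
  have p0: "p > 0" using prime_P[OF p] prime_gt_0_nat by simp
  have "p * card {a \<in> A. a mod int p = c mod int p} = card A"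
    using True order_prime[OF prime_P[OF p]] p0 unfolding vanishes_def
    by (intro card_residue_class_1) auto
  moreover have "card {a \<in> A. eq2 p a c} \<le> card {a \<in> A. a mod int p = c mod int p}"
    using tilingD(3)[OF tile] eq2_imp_eq1 unfolding eq1_def by (intro card_mono) (auto simp: mod_eq_dvd_iff)
  then have "p * card {a \<in> A. eq2 p a c} \<le> p * card {a \<in> A. a mod int p = c mod int p}"
    by (rule mult_le_mono2)
  ultimately show ?thesis by linarith
qed

text \<open>The plane has \<open>j * k\<close> points. If \<open>e\<close> were missed, its class
  modulo \<open>i\<^sup>2\<close> would contain \<open>j * k + 1\<close> elements of
  \<open>A\<close>, more than \<open>|A| / i\<close>.\<close>

lemma plane_core: "plane_core P (wrap M A) B x0"
proof -
  interpret c: tiling_core P "wrap M A" B by (rule tiling_core)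
  interpret c: grid_core P "wrap M A" B x0 by unfold_locales
  show ?thesis
  proof unfold_locales
    fix i c f e
    assume i: "i \<in> P" and c: "c.Lam c"
      and f: "\<And>y. c.Lam y \<Longrightarrow> eq2 i y c \<Longrightarrow> wrap M A (f y) \<and> eq2 i (f y) c"
      and inj: "\<And>y y'. c.Lam y \<Longrightarrow> eq2 i y c \<Longrightarrow> c.Lam y' \<Longrightarrow> eq2 i y' c \<Longrightarrow>
         (\<And>p. p \<in> P \<Longrightarrow> eq2 p (f y) (f y')) \<Longrightarrow> (\<forall>p\<in>P. eq2 p y y')"
      and e: "wrap M A e" "eq2 i e c"
    show "\<exists>y. c.Lam y \<and> eq2 i y c \<and> (\<forall>p\<in>P. eq2 p (f y) e)"
    proof (rule ccontr)
      assume n: "\<not> ?thesis"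
      obtain j k where l: "labels i j k" using labels_obtain i by blast
      note P = labels_mem[OF l]
      have pos: "i > 0" "j > 0" "k > 0" using P prime_P prime_gt_0_nat by auto
      have "\<forall>x. \<exists>y. eq2 i y c \<and> eq2 j y (c + int j * int (fst x)) \<and> eq2 k y (c + int k * int (snd x))" for x :: "nat \<times> nat"
        using crt[OF l] by metis
      then obtain y :: "nat \<times> nat \<Rightarrow> int" where y: "\<And>x. eq2 i (y x) c"
        "\<And>x. eq2 j (y x) (c + int j * int (fst x))" "\<And>x. eq2 k (y x) (c + int k * int (snd x))"
        by metis
      have yL: "c.Lam (y x)" for x
      proof (rule c.LamI[OF l _ _ _ c c c])
        show "eq1 i (y x) c" using y eq2_imp_eq1 by blast
        have "eq1 j (c + int j * int (fst x)) c" "eq1 k (c + int k * int (snd x)) c"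
          unfolding eq1_def by auto
        then show "eq1 j (y x) c" "eq1 k (y x) c" using y eq2_imp_eq1 eq1_trans by blast+
      qed
      define g where "g x = f (y x) mod int M" for x
      have res: "s = t" if "eq2 p (c + int p * int s) (c + int p * int t)" "s < p" "t < p" for p s t
      proof -
        have "int p * int p dvd int p * (int s - int t)"
          using that(1) unfolding eq2_def by (simp add: power2_eq_square algebra_simps)
        then have "int p dvd int s - int t" using that(2) by simp
        then have "int s mod int p = int t mod int p" by (simp add: mod_eq_dvd_iff)
        then show ?thesis using that by simp
      qed
      have inj_g: "inj_on g ({..<j} \<times> {..<k})"
      proof (rule inj_onI)
        fix x x' assume x: "x \<in> {..<j} \<times> {..<k}" "x' \<in> {..<j} \<times> {..<k}" and "g x = g x'"
        then have "\<forall>p\<in>P. eq2 p (f (y x)) (f (y x'))" unfolding g_def eq2_iff_mod by simp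
        then have yy: "\<forall>p\<in>P. eq2 p (y x) (y x')" using inj[OF yL y(1) yL y(1)] by blast
        have "eq2 j (c + int j * int (fst x)) (c + int j * int (fst x'))"
          using yy P y(2)[of x] y(2)[of x'] eq2_left eq2_right by blast
        moreover have "eq2 k (c + int k * int (snd x)) (c + int k * int (snd x'))"
          using yy P y(3)[of x] y(3)[of x'] eq2_left eq2_right by blast
        ultimately show "x = x'" using res x by (auto simp: prod_eq_iff)
      qed
      have em: "e mod int M \<notin> g ` ({..<j} \<times> {..<k})"
      proof
        assume "e mod int M \<in> g ` ({..<j} \<times> {..<k})"
        then obtain x where "f (y x) mod int M = e mod int M" unfolding g_def by auto
        then show False using n yL[of x] y(1)[of x] eq2_iff_mod by blast
      qed
      have "insert (e mod int M) (g ` ({..<j} \<times> {..<k})) \<subseteq> {a \<in> A. eq2 i a c}"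
        using e f[OF yL y(1)] i unfolding g_def wrap_def by auto
      then have "card (insert (e mod int M) (g ` ({..<j} \<times> {..<k}))) \<le> card {a \<in> A. eq2 i a c}"
        using tilingD(3)[OF tile] by (intro card_mono) auto
      then have "j * k + 1 \<le> card {a \<in> A. eq2 i a c}"
        using em card_image[OF inj_g] by (simp add: card_cartesian_product)
      then have "i * (j * k + 1) \<le> i * (j * k)"
        using plane_card[OF i, of c] card_A labels_prod[OF l, of "\<lambda>x. x"]
        by (metis (no_types, lifting) dual_order.trans mult.assoc mult_le_mono2)
      then show False using pos by simp
    qed
  qed
qed

section \<open>Greatest common divisors with M read off from types\<close>

lemma dvd_by_types:
  assumes x: "x dvd M" and t: "\<And>p. p \<in> P \<Longrightarrow> p dvd x \<Longrightarrow> int p dvd d"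
    "\<And>p. p \<in> P \<Longrightarrow> p\<^sup>2 dvd x \<Longrightarrow> (int p)\<^sup>2 dvd d"
  shows "int x dvd d"
proof -
  obtain i j k where l: "labels i j k" by (rule labels_ex)
  note P = labels_mem[OF l]
  have part: "int u dvd d" if u: "u dvd p\<^sup>2" "u dvd x" "p \<in> P" for u p
  proof -
    obtain m where m: "m \<le> 2" "u = p ^ m" using divides_primepow_nat[OF prime_P[OF u(3)]] u(1) by blast
    then have "u = 1 \<or> u = p \<or> u = p\<^sup>2" by (auto simp: le_Suc_eq numeral_2_eq_2)
    then show ?thesis using t[OF u(3)] u(2) by auto
  qed
  have "x dvd i\<^sup>2 * j\<^sup>2 * k\<^sup>2" using x unfolding M_def by (simp add: labels_prod[OF l])
  then obtain y w where yw: "x = y * w" "y dvd i\<^sup>2 * j\<^sup>2" "w dvd k\<^sup>2" using division_decomp by blast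
  then obtain u v where uv: "y = u * v" "u dvd i\<^sup>2" "v dvd j\<^sup>2" using division_decomp by blast
  have cop: "coprime (i\<^sup>2) (j\<^sup>2)" "coprime (i\<^sup>2 * j\<^sup>2) (k\<^sup>2)"
    using labels_coprime[OF l] by (auto simp: coprime_int_iff simp flip: of_nat_power)
  have "coprime u v" using cop(1) uv by (meson coprime_divisors)
  moreover have "coprime y w" using cop(2) yw by (meson coprime_divisors)
  moreover have "int u dvd d" "int v dvd d" "int w dvd d"
    using part[OF uv(2)] part[OF uv(3)] part[OF yw(3)] P uv(1) yw(1) by auto
  ultimately show ?thesis
    unfolding yw uv of_nat_mult by (intro divides_mult) (auto simp: uv simp flip: of_nat_mult)
qed

lemma gcdM_dvd: "m dvd M \<Longrightarrow> m dvd gcdM M d \<longleftrightarrow> int m dvd d"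
proof -
  assume m: "m dvd M"
  have "m dvd gcdM M d \<longleftrightarrow> int m dvd gcd d (int M)"
    unfolding gcdM_def by (simp flip: int_dvd_int_iff)
  then show ?thesis using m by simp
qed

lemma p_dvd_M: "p \<in> P \<Longrightarrow> p dvd M" "p \<in> P \<Longrightarrow> p\<^sup>2 dvd M"
proof -
  assume "p \<in> P"
  then show "p\<^sup>2 dvd M" unfolding M_def using finite_P by (intro dvd_prodI) auto
  then show "p dvd M" by (metis dvd_trans dvd_triv_left power2_eq_square)
qed

text \<open>This dictionary turns all gcd conditions in the definitions of the structures into
  conditions on types.\<close>

lemma gcdM_iff:
  assumes "m dvd M"
  shows "gcdM M d = m \<longleftrightarrow> (\<forall>p\<in>P. (int p dvd d \<longleftrightarrow> p dvd m) \<and> ((int p)\<^sup>2 dvd d \<longleftrightarrow> p\<^sup>2 dvd m))"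
proof
  assume "gcdM M d = m"
  then show "\<forall>p\<in>P. (int p dvd d \<longleftrightarrow> p dvd m) \<and> ((int p)\<^sup>2 dvd d \<longleftrightarrow> p\<^sup>2 dvd m)"
    using gcdM_dvd[OF p_dvd_M(1), of _ d] gcdM_dvd[OF p_dvd_M(2), of _ d] by auto
next
  assume *: "\<forall>p\<in>P. (int p dvd d \<longleftrightarrow> p dvd m) \<and> ((int p)\<^sup>2 dvd d \<longleftrightarrow> p\<^sup>2 dvd m)"
  have gM: "gcdM M d dvd M"
    unfolding gcdM_def by (simp flip: int_dvd_int_iff)
  have "int (gcdM M d) dvd int m"
  proof (rule dvd_by_types[OF gM])
    show "int p dvd int m" if "p \<in> P" "p dvd gcdM M d" for p
      using that * gcdM_dvd[OF p_dvd_M(1)] by auto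
    show "(int p)\<^sup>2 dvd int m" if "p \<in> P" "p\<^sup>2 dvd gcdM M d" for p
      using that * gcdM_dvd[OF p_dvd_M(2)] by (simp flip: of_nat_power)
  qed
  moreover have "int m dvd d" by (rule dvd_by_types[OF assms]) (use * in auto)
  then have "m dvd gcdM M d" using gcdM_dvd[OF assms] by blast
  ultimately show "gcdM M d = m" by (simp add: dvd_antisym)
qed

end

section \<open>Fiber shifts\<close>

lemma prod_coprime_dvd:
  fixes f :: "'a \<Rightarrow> nat"
  assumes "finite Q" "\<And>q r. q \<in> Q \<Longrightarrow> r \<in> Q \<Longrightarrow> q \<noteq> r \<Longrightarrow> coprime (f q) (f r)" "\<And>q. q \<in> Q \<Longrightarrow> f q dvd m"
  shows "prod f Q dvd m"
  using assms
proof (induction Q rule: finite_induct)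
  case (insert x Q)
  have "coprime (f x) (prod f Q)" using insert by (intro prod_coprime_right) auto
  then show ?case using insert by (simp add: divides_mult)
qed simp

context tiling_setting
begin

lemma eq1_mod_right [simp]: "p \<in> P \<Longrightarrow> eq1 p x (y mod int M) \<longleftrightarrow> eq1 p x y"
  using eq1_mod[of p y x] eq1_sym by blast

lemma eq2_mod_right [simp]: "p \<in> P \<Longrightarrow> eq2 p x (y mod int M) \<longleftrightarrow> eq2 p x y"
  using eq2_mod[of p y x] eq2_sym by blast

text \<open>The \<open>M\<close>-fiber through \<open>x\<close> in direction \<open>p\<close>,
  described by congruences; see \<open>line_fiber\<close>.\<close>

definition line :: "nat \<Rightarrow> int \<Rightarrow> int set" where
  "line p x = {n \<in> Zmod M. eq1 p n x \<and> (\<forall>q\<in>P - {p}. eq2 q n x)}"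

lemma M_div:
  assumes p: "p \<in> P"
  shows "p * (M div p) = M" "p dvd M div p" "\<not> p\<^sup>2 dvd M div p" "\<And>q. q \<in> P \<Longrightarrow> q \<noteq> p \<Longrightarrow> q\<^sup>2 dvd M div p"
    "M div p = p * (M div p\<^sup>2)" "\<not> p dvd M div p\<^sup>2" "\<And>q. q \<in> P \<Longrightarrow> q \<noteq> p \<Longrightarrow> q\<^sup>2 dvd M div p\<^sup>2"
proof -
  obtain j k where l: "labels p j k" using labels_obtain[OF p] by blast
  note P = labels_mem[OF l]
  have p0: "p > 0" using prime_P[OF p] prime_gt_0_nat by simp
  have M: "M = p * (p * (j\<^sup>2 * k\<^sup>2))" unfolding M_def by (simp add: labels_prod[OF l] power2_eq_square)
  have d: "M div p = p * (j\<^sup>2 * k\<^sup>2)" "M div p\<^sup>2 = j\<^sup>2 * k\<^sup>2"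
    using p0 unfolding M power2_eq_square by (simp_all add: div_mult2_eq)
  show "p * (M div p) = M" "p dvd M div p" "M div p = p * (M div p\<^sup>2)" unfolding d using M by auto
  show n: "\<not> p dvd M div p\<^sup>2"
  proof
    assume "p dvd M div p\<^sup>2"
    then have "p dvd j \<or> p dvd k" unfolding d using prime_P[OF p] by (simp add: prime_dvd_mult_iff prime_dvd_power_iff)
    then show False using primes_dvd_imp_eq prime_P P l unfolding labels_def by metis
  qed
  show "\<not> p\<^sup>2 dvd M div p"
  proof
    assume "p\<^sup>2 dvd M div p"
    then have "p * p dvd p * (M div p\<^sup>2)" unfolding d by (simp add: power2_eq_square)
    then show False using n p0 by simp
  qed
  show "q\<^sup>2 dvd M div p" "q\<^sup>2 dvd M div p\<^sup>2" if "q \<in> P" "q \<noteq> p" for q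
    unfolding d using that l unfolding labels_def by auto
qed

lemma line_fiber: assumes p: "p \<in> P" shows "sumset M {x} (fiber M p) = line p x"
proof (intro equalityI subsetI)
  fix n assume "n \<in> sumset M {x} (fiber M p)"
  then obtain t where n: "n = (x + int (t * (M div p))) mod int M" unfolding sumset_def fiber_def by auto
  have "int p dvd int (t * (M div p))" using M_div(2)[OF p] by (metis dvd_mult int_dvd_int_iff)
  moreover have "(int q)\<^sup>2 dvd int (t * (M div p))" if "q \<in> P" "q \<noteq> p" for q
    using M_div(4)[OF p that] by (metis dvd_mult int_dvd_int_iff of_nat_power)
  ultimately have "eq1 p (x + int (t * (M div p))) x" "\<forall>q\<in>P - {p}. eq2 q (x + int (t * (M div p))) x"
    by (auto simp: eq1_def eq2_def)
  then have "eq1 p n x" "\<forall>q\<in>P - {p}. eq2 q n x"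
    unfolding n using p by auto
  then show "n \<in> line p x" unfolding line_def Zmod_def n using M_pos by simp
next
  fix n assume n: "n \<in> line p x"
  have "int (M div p) dvd n - x"
  proof (rule dvd_by_types)
    show "M div p dvd M" using M_div(1)[OF p] by (metis dvd_triv_right)
    show "int q dvd n - x" if "q \<in> P" for q
      using n that eq2_imp_eq1 unfolding line_def eq1_def[symmetric] by blast
    show "(int q)\<^sup>2 dvd n - x" if "q \<in> P" "q\<^sup>2 dvd M div p" for q
      using n that M_div(3)[OF p] unfolding line_def eq2_def by (cases "q = p") auto
  qed
  then obtain s where s: "n - x = int (M div p) * s" by blast
  define t where "t = nat (s mod int p)"
  have p0: "p > 0" using prime_P[OF p] prime_gt_0_nat by simp
  have t: "int t = s mod int p" "t < p" unfolding t_def using p0 by (auto simp: nat_less_iff)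
  have "n - (x + int (t * (M div p))) = int (M div p) * (s - s mod int p)"
    using s t by (simp add: algebra_simps)
  also have "\<dots> = int (p * (M div p)) * (s div int p)"
    by (simp add: minus_mod_eq_mult_div)
  finally have "n mod int M = (x + int (t * (M div p))) mod int M"
    using M_div(1)[OF p] by (simp add: mod_eq_dvd_iff)
  then have "n = (x + int (t * (M div p))) mod int M" using n unfolding line_def Zmod_def by simp
  moreover have "(x, int (t * (M div p))) \<in> {x} \<times> fiber M p"
    unfolding fiber_def using t(2) by blast
  ultimately show "n \<in> sumset M {x} (fiber M p)"
    unfolding sumset_def by (metis (no_types, lifting) case_prod_conv image_eqI)
qed

lemma line_shift:
  assumes p: "p \<in> P"
  shows "bij_betw (\<lambda>n. (n + t) mod int M) (line p x) (line p (x + t))"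
proof (rule bij_betw_byWitness[where f' = "\<lambda>n. (n - t) mod int M"])
  show "\<forall>n\<in>line p x. ((n + t) mod int M - t) mod int M = n"
    "\<forall>n\<in>line p (x + t). ((n - t) mod int M + t) mod int M = n"
    unfolding line_def Zmod_def by (auto simp: mod_diff_left_eq mod_add_left_eq)
  have a: "eq1 q (n + t) (x + t) \<longleftrightarrow> eq1 q n x" "eq2 q (n + t) (x + t) \<longleftrightarrow> eq2 q n x"
    "eq1 q (n - t) x \<longleftrightarrow> eq1 q n (x + t)" "eq2 q (n - t) x \<longleftrightarrow> eq2 q n (x + t)" for q n
    unfolding eq1_def eq2_def by (auto simp: algebra_simps)
  show "(\<lambda>n. (n + t) mod int M) ` line p x \<subseteq> line p (x + t)"
    "(\<lambda>n. (n - t) mod int M) ` line p (x + t) \<subseteq> line p x"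
    using p M_pos unfolding line_def Zmod_def by (auto simp: a)
qed

text \<open>If \<open>p\<close> does not divide the order \<open>s\<close>, then \<open>s\<close>
  divides \<open>t\<close> and the shift is invisible. If \<open>p\<^sup>2\<close> divides
  \<open>s\<close>, the mask of a line is zero: the line is invariant under \<open>M div p\<close>,
  whereas \<open>z\<close> to this power is not \<open>1\<close>.\<close>

lemma mask_at_line_shift:
  assumes p: "p \<in> P" and s: "s dvd M" "s > 0" and ps: "p dvd s \<Longrightarrow> p\<^sup>2 dvd s"
    and t: "\<forall>q\<in>P - {p}. (int q)\<^sup>2 dvd t" and z: "z \<in> primitive_roots_unity s"
  shows "mask_at (line p (x + t)) z = mask_at (line p x) z"
proof -
  have zM: "z ^ M = 1" and zs: "z ^ s = 1" using primitive_root_pow_eq_1_iff[OF z s(2)] s by auto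
  have shift: "mask_at (line p (y + u)) z = z ^ nat (u mod int M) * mask_at (line p y) z" for y u
  proof (rule mask_at_bij[OF line_shift[OF p]])
    fix n assume "n \<in> line p y"
    then have n: "n \<ge> 0" unfolding line_def Zmod_def by simp
    have "z ^ nat ((n + u) mod int M) = z ^ nat (n + u mod int M)"
      using n M_pos by (intro pow_nat_cong[OF zM]) (auto simp: mod_eq_dvd_iff[symmetric] mod_add_right_eq)
    also have "\<dots> = z ^ nat (u mod int M) * z ^ nat n"
      using n M_pos by (simp add: nat_add_distrib power_add)
    finally show "z ^ nat ((n + u) mod int M) = z ^ nat (u mod int M) * z ^ nat n" .
  qed
  show ?thesis
  proof (cases "p dvd s")
    case False
    have "int s dvd t"
    proof (rule dvd_by_types[OF s(1)])
      show "int q dvd t" if "q \<in> P" "q dvd s" for q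
        using t that False dvd_trans[of "int q" "(int q)\<^sup>2" t] by (cases "q = p") (auto simp: power2_eq_square)
      show "(int q)\<^sup>2 dvd t" if "q \<in> P" "q\<^sup>2 dvd s" for q
        using t that False dvd_trans[of q "q\<^sup>2" s] by (cases "q = p") (auto simp: power2_eq_square)
    qed
    then have "int s dvd t mod int M" using s(1) by (simp add: dvd_mod)
    then have "z ^ nat (t mod int M) = z ^ nat 0"
      using M_pos by (intro pow_nat_cong[OF zs]) auto
    then show ?thesis using shift[of x t] by simp
  next
    case True
    have "mask_at (line p y) z = 0" for y
    proof -
      define u where "u = int (M div p)"
      have "line p (y + u) = line p y"
      proof -
        have "int p dvd u" "\<forall>q\<in>P - {p}. (int q)\<^sup>2 dvd u"
          using M_div(2,4)[OF p] unfolding u_def by (auto simp flip: of_nat_power)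
        then have "eq1 p (y + u) y" "\<forall>q\<in>P - {p}. eq2 q (y + u) y" by (auto simp: eq1_def eq2_def)
        then show ?thesis unfolding line_def using eq1_right eq2_right by blast
      qed
      moreover have "z ^ nat (u mod int M) \<noteq> 1"
      proof -
        have "M div p < M" using M_pos prime_gt_1_nat[OF prime_P[OF p]] by simp
        then have "nat (u mod int M) = M div p" unfolding u_def by simp
        moreover have "\<not> s dvd M div p" using ps[OF True] M_div(3)[OF p] dvd_trans by blast
        ultimately show ?thesis using primitive_root_pow_eq_1_iff[OF z s(2)] by simp
      qed
      ultimately show ?thesis using shift[of y u] by simp
    qed
    then show ?thesis by simp
  qed
qed

text \<open>The elements of \<open>B\<close> selected by the base points form a permutation
  \<open>h\<close> that acts as addition of a fixed \<open>t\<close>, up to multiples of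
  \<open>M div p\<close>. Representations through the removed line can therefore be rewritten
  through the added one, and equal cardinality turns covering into tiling.\<close>

lemma fiber_shift_ex:
  assumes p: "p \<in> P" and sh: "\<And>b0. b0 \<in> B \<Longrightarrow> grid_core.shifts P (wrap M A) B b0 p x"
  obtains A' where "fiber_shift M P B A A'" "tiling_setting P M A' B"
    "\<And>n. (\<forall>q\<in>P. eq1 q n x) \<Longrightarrow> wrap M A' n \<longleftrightarrow> wrap M A n \<or> (\<forall>q\<in>P - {p}. eq2 q n x)"
    "vanishes B p"
    "\<And>s. s dvd M \<Longrightarrow> s > 0 \<Longrightarrow> (p dvd s \<Longrightarrow> p\<^sup>2 dvd s) \<Longrightarrow>
      cyclotomic s dvd mask_poly A \<longleftrightarrow> cyclotomic s dvd mask_poly A'"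
proof -
  interpret c: tiling_core P "wrap M A" B by (rule tiling_core)
  interpret c: grid_core P "wrap M A" B x by unfold_locales
  obtain j k where l: "labels p j k" using labels_obtain[OF p] by blast
  have "\<forall>b0\<in>B. \<exists>b. b \<in> B \<and> \<not> eq1 p b b0 \<and> (\<forall>q\<in>P - {p}. eq2 q b b0) \<and>
      (\<forall>y. eq1 p y x \<and> (\<forall>q\<in>P - {p}. eq2 q y x) \<longrightarrow> wrap M A (y - (b - b0)))"
    using sh unfolding c.shifts_def by blast
  from bchoice[OF this] obtain h where "\<forall>b0\<in>B. h b0 \<in> B \<and> \<not> eq1 p (h b0) b0 \<and> (\<forall>q\<in>P - {p}. eq2 q (h b0) b0) \<and>
      (\<forall>y. eq1 p y x \<and> (\<forall>q\<in>P - {p}. eq2 q y x) \<longrightarrow> wrap M A (y - (h b0 - b0)))" ..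
  then have h: "\<And>b0. b0 \<in> B \<Longrightarrow> h b0 \<in> B" "\<And>b0. b0 \<in> B \<Longrightarrow> \<not> eq1 p (h b0) b0"
    "\<And>b0 q. b0 \<in> B \<Longrightarrow> q \<in> P \<Longrightarrow> q \<noteq> p \<Longrightarrow> eq2 q (h b0) b0"
    "\<And>b0 y. b0 \<in> B \<Longrightarrow> eq1 p y x \<Longrightarrow> \<forall>q\<in>P - {p}. eq2 q y x \<Longrightarrow> wrap M A (y - (h b0 - b0))"
    by blast+
  obtain b0 where b0: "b0 \<in> B" using tiling_ex[OF tile M_pos] by metis
  \<comment> \<open>Any base point may serve as reference: lines are invariant under
    \<open>M div p\<close>, so only the residue modulo \<open>p\<close> of a displacement
    matters.\<close>
  define t where "t = h b0 - b0"
  have tq: "\<forall>q\<in>P - {p}. (int q)\<^sup>2 dvd t" "\<not> int p dvd t"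
    using h(2,3)[OF b0] unfolding t_def eq1_def eq2_def by auto
  \<comment> \<open>Different residues would give two points of \<open>A\<close> whose difference
    has the type of \<open>h b0 - b0\<close>.\<close>
  have same: "eq1 p (h b - b) t" if b: "b \<in> B" for b
  proof (rule ccontr)
    assume n: "\<not> eq1 p (h b - b) t"
    have A: "wrap M A (x - t)" "wrap M A (x - (h b - b))"
      using h(4)[OF b0, of x] h(4)[OF b, of x] unfolding t_def by auto
    have "h b0 = b0"
    proof (rule c.sands[OF A h(1)[OF b0] b0])
      have hq: "(int q)\<^sup>2 dvd h b - b" "(int q)\<^sup>2 dvd t" if "q \<in> P" "q \<noteq> p" for q
        using h(3)[OF b that] tq that unfolding eq2_def by auto
      have e: "x - t - (x - (h b - b)) = (h b - b) - t" by simp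
      have "\<not> eq1 p (x - t) (x - (h b - b))" using n unfolding eq1_def e by simp
      moreover have "eq2 q (x - t) (x - (h b - b))" if "q \<in> P" "q \<noteq> p" for q
        unfolding eq2_def e using hq[OF that] by (rule dvd_diff)
      ultimately show "eq1 q (x - t) (x - (h b - b)) \<longleftrightarrow> eq1 q (h b0) b0"
        "eq2 q (x - t) (x - (h b - b)) \<longleftrightarrow> eq2 q (h b0) b0" if "q \<in> P" for q
        using h(2,3)[OF b0] eq2_imp_eq1 that by (metis (full_types))+
    qed
    then show False using h(2)[OF b0] by simp
  qed
  have tB: "eq1 p (h b) (b + t) \<and> (\<forall>q\<in>P - {p}. eq2 q (h b) (b + t))" if b: "b \<in> B" for b
  proof
    show "eq1 p (h b) (b + t)" using same[OF b] unfolding eq1_def by (simp add: algebra_simps)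
    show "\<forall>q\<in>P - {p}. eq2 q (h b) (b + t)"
    proof
      fix q assume q: "q \<in> P - {p}"
      have "(int q)\<^sup>2 dvd (h b - b) - t" 
        using h(3)[OF b, of q] tq q unfolding eq2_def by (intro dvd_diff[of _ "h b - b" t]) auto
      then show "eq2 q (h b) (b + t)" unfolding eq2_def by (simp add: algebra_simps)
    qed
  qed
  define L where "L = line p x"
  define L' where "L' = line p (x - t)"
  have L'A: "L' \<subseteq> A"
  proof
    fix n assume n: "n \<in> L'"
    then have "eq1 p (n + t) x" "\<forall>q\<in>P - {p}. eq2 q (n + t) x"
      unfolding L'_def line_def eq1_def eq2_def by (auto simp: algebra_simps)
    then have "wrap M A (n + t - (h b0 - b0))" using h(4)[OF b0] by blast
    then show "n \<in> A" using n wrap_mem unfolding t_def L'_def line_def by simp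
  qed
  \<comment> \<open>A point of \<open>A\<close> on the line and its translate by \<open>-t\<close>,
    also in \<open>A\<close>, would differ by \<open>h b0 - b0\<close>.\<close>
  have LA: "L \<inter> A = {}"
  proof (rule ccontr)
    assume "L \<inter> A \<noteq> {}"
    then obtain n where n: "n \<in> L" "n \<in> A" by blast
    then have nl: "n \<in> Zmod M" "eq1 p n x" "\<forall>q\<in>P - {p}. eq2 q n x" unfolding L_def line_def by auto
    have A: "wrap M A n" "wrap M A (n - t)"
      using wrap_mem nl n h(4)[OF b0 nl(2,3)] unfolding t_def by auto
    have "h b0 = b0"
    proof (rule c.sands[OF A h(1)[OF b0] b0])
      show "eq1 q n (n - t) \<longleftrightarrow> eq1 q (h b0) b0" "eq2 q n (n - t) \<longleftrightarrow> eq2 q (h b0) b0" for q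
        unfolding t_def eq1_def eq2_def by auto
    qed
    then show False using h(2)[OF b0] by simp
  qed
  have bijL: "bij_betw (\<lambda>n. (n + t) mod int M) L' L"
    using line_shift[OF p, of t "x - t"] unfolding L_def L'_def by simp
  define A' where "A' = (A - L') \<union> L"
  have "L \<subseteq> {0..<int M}" unfolding L_def line_def Zmod_def by auto
  then have fin: "finite A" "finite L" using tilingD(3)[OF tile] finite_subset by blast+
  have cA': "card A' = card A"
  proof -
    have "card A' = card (A - L') + card L"
      unfolding A'_def using fin LA by (intro card_Un_disjoint) auto
    also have "card (A - L') = card A - card L'" using finite_subset[OF L'A fin(1)] L'A by (rule card_Diff_subset)
    also have "card L = card L'" using bij_betw_same_card[OF bijL] by simp
    finally show ?thesis using card_mono[OF fin(1) L'A] by simp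
  qed
  have inj_h: "inj_on h B"
  proof (rule inj_onI)
    fix b b' assume b: "b \<in> B" "b' \<in> B" "h b = h b'"
    have 1: "eq1 p b b'"
    proof -
      have "int p dvd (h b' - b' - t) - (h b - b - t)"
        by (rule dvd_diff[OF same[OF b(2), unfolded eq1_def] same[OF b(1), unfolded eq1_def]])
      then show ?thesis using b(3) unfolding eq1_def by simp
    qed
    have 2: "eq2 q b b'" if "q \<in> P" "q \<noteq> p" for q
      using h(3)[OF b(1) that] h(3)[OF b(2) that] b(3) eq2_sym eq2_trans by metis
    show "b = b'"
    proof (cases "eq2 p b b'")
      case True
      then have "\<forall>q\<in>P. eq2 q b b'" using 2 by blast
      then have "b mod int M = b' mod int M" by (simp add: eq2_iff_mod)
      moreover have "b \<in> Zmod M" "b' \<in> Zmod M" using b tilingD(2)[OF tile] by blast+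
      ultimately show ?thesis unfolding Zmod_def by simp
    next
      case False
      \<comment> \<open>Up to sign, the difference of these two points of the removed line is
        \<open>b' - b\<close>.\<close>
      have A: "wrap M A (x - t)" "wrap M A ((x + (b' - b)) - t)"
      proof -
        show "wrap M A (x - t)" using h(4)[OF b0, of x] unfolding t_def by auto
        have "eq1 p (x + (b' - b)) x" "\<forall>q\<in>P - {p}. eq2 q (x + (b' - b)) x"
          using eq1_sym[OF 1] 2[THEN eq2_sym] unfolding eq1_def eq2_def by auto
        then show "wrap M A ((x + (b' - b)) - t)" using h(4)[OF b0] unfolding t_def by blast
      qed
      show ?thesis
        by (rule c.sands[OF A b(1,2)]) (auto simp: eq1_def eq2_def)
    qed
  qed
  have surj_h: "h ` B = B"
    using inj_h h(1) tilingD(4)[OF tile] by (intro endo_inj_surj) auto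
  have tile': "tiling M A' B"
  proof (rule tilingI)
    show "A' \<subseteq> Zmod M" using tilingD(1)[OF tile] unfolding A'_def L_def line_def by auto
    show "card A' * card B = M" using cA' tiling_card[OF tile] by simp
    fix n assume n: "n \<in> Zmod M"
    obtain a b where ab: "a \<in> A" "b \<in> B" "(a + b) mod int M = n mod int M" using tiling_ex[OF tile M_pos] .
    have n': "n mod int M = n" using n unfolding Zmod_def by simp
    show "\<exists>a\<in>A'. \<exists>b\<in>B. (a + b) mod int M = n"
    proof (cases "a \<in> L'")
      case False
      then show ?thesis using ab n' unfolding A'_def by auto
    next
      case True
      \<comment> \<open>The sum \<open>a + h b1\<close> is rewritten as
        \<open>(a + h b1 - b1) + b1\<close>, whose first term lies on the added line.\<close>
      have "b \<in> h ` B" using surj_h ab(2) by simp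
      then obtain b1 where b1: "b1 \<in> B" "h b1 = b" by blast
      define a' where "a' = (a + b - b1) mod int M"
      have "eq1 p (a + b - b1) x"
      proof -
        have "int p dvd (a - (x - t)) + (h b1 - (b1 + t))"
          using True tB[OF b1(1)] unfolding L'_def line_def eq1_def by (intro dvd_add) auto
        then show ?thesis unfolding eq1_def b1(2) by (simp add: algebra_simps)
      qed
      moreover have "eq2 q (a + b - b1) x" if "q \<in> P - {p}" for q
      proof -
        have "(int q)\<^sup>2 dvd (a - (x - t)) + (h b1 - (b1 + t))"
          using True tB[OF b1(1)] that unfolding L'_def line_def eq2_def by (intro dvd_add) auto
        then show ?thesis unfolding eq2_def b1(2) by (simp add: algebra_simps)
      qed
      ultimately have "a' \<in> L" unfolding a'_def L_def line_def Zmod_def using p M_pos by auto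
      moreover have "(a' + b1) mod int M = n" unfolding a'_def using ab n' by (simp add: mod_add_left_eq)
      ultimately show ?thesis using b1 unfolding A'_def by blast
    qed
  qed (use tilingD(2)[OF tile] M_pos in auto)
  have 1: "fiber_shift M P B A A'"
    unfolding fiber_shift_def
  proof (intro bexI conjI)
    have lm: "line p (y mod int M) = line p y" for y
      unfolding line_def using p by auto
    show "gcdM M ((x - t) mod int M - x mod int M) = M div p\<^sup>2"
    proof (subst gcdM_iff)
      show "M div p\<^sup>2 dvd M" using p_dvd_M(2)[OF p] by (metis dvd_div_mult_self dvd_triv_left)
      show "\<forall>q\<in>P. (int q dvd (x - t) mod int M - x mod int M \<longleftrightarrow> q dvd M div p\<^sup>2) \<and>
          ((int q)\<^sup>2 dvd (x - t) mod int M - x mod int M \<longleftrightarrow> q\<^sup>2 dvd M div p\<^sup>2)"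
      proof
        fix q assume q: "q \<in> P"
        have "eq1 q ((x - t) mod int M) (x mod int M) \<longleftrightarrow> eq1 q (x - t) x"
          "eq2 q ((x - t) mod int M) (x mod int M) \<longleftrightarrow> eq2 q (x - t) x" using q by simp_all
        then have e: "int q dvd (x - t) mod int M - x mod int M \<longleftrightarrow> int q dvd t"
          "(int q)\<^sup>2 dvd (x - t) mod int M - x mod int M \<longleftrightarrow> (int q)\<^sup>2 dvd t"
          unfolding eq1_def eq2_def by simp_all
        show "(int q dvd (x - t) mod int M - x mod int M \<longleftrightarrow> q dvd M div p\<^sup>2) \<and>
          ((int q)\<^sup>2 dvd (x - t) mod int M - x mod int M \<longleftrightarrow> q\<^sup>2 dvd M div p\<^sup>2)"
        proof (cases "q = p")
          case True
          have "\<not> (int p)\<^sup>2 dvd t" using tq(2) by (metis dvd_mult_left power2_eq_square)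
          moreover have "\<not> p\<^sup>2 dvd M div p\<^sup>2" using M_div(6)[OF p] by (metis dvd_mult_left power2_eq_square)
          ultimately show ?thesis unfolding e using True tq(2) M_div(6)[OF p] by simp
        next
          case False
          have "(int q)\<^sup>2 dvd t" "q\<^sup>2 dvd M div p\<^sup>2" using tq(1) M_div(7)[OF p q False] q False by auto
          then show ?thesis unfolding e by (metis dvd_mult_left power2_eq_square)
        qed
      qed
    qed
    show "sumset M {(x - t) mod int M} (fiber M p) \<subseteq> A"
      using L'A unfolding line_fiber[OF p] lm L'_def .
    show "A' = (A - sumset M {(x - t) mod int M} (fiber M p)) \<union> sumset M {x mod int M} (fiber M p)"
      unfolding line_fiber[OF p] lm A'_def L_def L'_def ..
  qed (use p tile' M_pos in \<open>auto simp: Zmod_def\<close>)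
  have 2: "tiling_setting P M A' B"
    using M_def tile' cA' card_A card_B by unfold_locales auto
  have 3: "wrap M A' n \<longleftrightarrow> wrap M A n \<or> (\<forall>q\<in>P - {p}. eq2 q n x)" if n: "\<forall>q\<in>P. eq1 q n x" for n
  proof -
    have nz: "n mod int M \<in> Zmod M" unfolding Zmod_def using M_pos by simp
    have "n mod int M \<in> L \<longleftrightarrow> (\<forall>q\<in>P - {p}. eq2 q n x)"
      unfolding L_def line_def using nz n p by auto
    moreover have "n mod int M \<notin> L'"
    proof
      assume "n mod int M \<in> L'"
      then have "eq1 p n (x - t)" unfolding L'_def line_def using p by auto
      then have "eq1 p x (x - t)" using n p eq1_left[of p n x] by blast
      then show False using tq(2) unfolding eq1_def by simp
    qed
    ultimately show ?thesis unfolding wrap_def A'_def by blast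
  qed
  have 4: "vanishes B p"
    unfolding vanishes_def
  proof
    fix z assume z: "z \<in> primitive_roots_unity p"
    have p0: "p > 0" using prime_P[OF p] prime_gt_0_nat by simp
    have zp: "z ^ p = 1" using primitive_root_pow_eq_1_iff[OF z p0] by simp
    have nn: "b \<ge> 0" if "b \<in> B" for b using that tilingD(2)[OF tile] unfolding Zmod_def by auto
    \<comment> \<open>Permuting \<open>B\<close> by \<open>h\<close> multiplies its mask at a
      primitive \<open>p\<close>-th root of unity by a factor other than \<open>1\<close>, and yet
      leaves it unchanged.\<close>
    have "bij_betw h B B" using inj_h surj_h unfolding bij_betw_def by blast
    then have "mask_at B z = z ^ nat (t mod int p) * mask_at B z"
    proof (rule mask_at_bij)
      fix b assume b: "b \<in> B"
      have "z ^ nat (h b) = z ^ nat (b + t mod int p)"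
      proof (rule pow_nat_cong[OF zp])
        have "int p dvd (h b - (b + t)) + (t - t mod int p)"
          using tB[OF b] unfolding eq1_def by (intro dvd_add) auto
        then show "int p dvd h b - (b + t mod int p)" by (simp add: algebra_simps)
      qed (use nn[OF b] nn[OF h(1)[OF b]] p0 in auto)
      then show "z ^ nat (h b) = z ^ nat (t mod int p) * z ^ nat b"
        using nn[OF b] p0 by (simp add: nat_add_distrib power_add)
    qed
    moreover have "z ^ nat (t mod int p) \<noteq> 1"
    proof
      assume "z ^ nat (t mod int p) = 1"
      then have "p dvd nat (t mod int p)" using primitive_root_pow_eq_1_iff[OF z p0] by simp
      then have "int p dvd t mod int p" using p0 by (metis int_dvd_int_iff int_nat_eq pos_mod_sign of_nat_0_less_iff)
      then show False using tq(2) by (simp add: dvd_mod_iff)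
    qed
    ultimately show "mask_at B z = 0" by simp
  qed
  have 5: "cyclotomic s dvd mask_poly A \<longleftrightarrow> cyclotomic s dvd mask_poly A'"
    if s: "s dvd M" "s > 0" "p dvd s \<Longrightarrow> p\<^sup>2 dvd s" for s
  proof -
    have "mask_at A' z = mask_at A z" if z: "z \<in> primitive_roots_unity s" for z
    proof -
      have "mask_at A' z = mask_at (A - L') z + mask_at L z"
        unfolding A'_def mask_at_def using fin LA by (intro sum.union_disjoint) auto
      also have "mask_at L z = mask_at L' z"
        using mask_at_line_shift[OF p s tq(1) z, of "x - t"] unfolding L_def L'_def by simp
      also have "mask_at (A - L') z + mask_at L' z = mask_at A z"
        unfolding mask_at_def using L'A fin by (intro sum.subset_diff[symmetric])
      finally show ?thesis .
    qed
    then show ?thesis using s(2) by (simp add: cyclotomic_dvd_mask)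
  qed
  show ?thesis by (rule that[OF 1 2 3 4 5])
qed

lemma vanishes_cyclotomic: "n > 0 \<Longrightarrow> vanishes S n \<longleftrightarrow> cyclotomic n dvd mask_poly S"
  unfolding vanishes_def by (simp add: cyclotomic_dvd_mask)

text \<open>As the mask of \<open>B\<close> vanishes at order \<open>p\<close>, those of
  \<open>A\<close> and \<open>A'\<close> do not. Hence \<open>p\<close> can enter the products in
  (T2) only through \<open>p\<^sup>2\<close>, and at such orders the two masks have the same
  cyclotomic divisors.\<close>

lemma T2_cong:
  assumes p: "p \<in> P" and A': "tiling_setting P M A' B" and v: "vanishes B p"
    and eq: "\<And>s. s dvd M \<Longrightarrow> s > 0 \<Longrightarrow> (p dvd s \<Longrightarrow> p\<^sup>2 dvd s) \<Longrightarrow>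
      cyclotomic s dvd mask_poly A \<longleftrightarrow> cyclotomic s dvd mask_poly A'"
  shows "T2 M A \<longleftrightarrow> T2 M A'"
proof -
  interpret s: tiling_setting P M A' B by (rule A')
  have pp: "prime p" "p > 0" using prime_P[OF p] prime_gt_0_nat by auto
  have np: "p \<notin> SA M A" "p \<notin> SA M A'"
  proof -
    have "\<not> vanishes A p" using vanishes_iff[OF p] v by blast
    moreover have "\<not> s.vanishes A' p" using s.vanishes_iff[OF p] v unfolding vanishes_def s.vanishes_def by blast
    ultimately show "p \<notin> SA M A" "p \<notin> SA M A'"
      using vanishes_cyclotomic[of p] s.vanishes_cyclotomic[of p] pp unfolding SA_def by auto
  qed
  have SA: "SA M A = SA M A'"
  proof -
    have "s \<in> SA M A \<longleftrightarrow> s \<in> SA M A'" if s: "primepow s" "s dvd M" for s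
    proof (cases "s = p")
      case False
      have "p\<^sup>2 dvd s" if "p dvd s"
      proof -
        obtain q e where qe: "prime q" "e > 0" "s = q ^ e" using s(1) unfolding primepow_def by blast
        then have "p = q" using that pp primes_dvd_imp_eq prime_dvd_power by metis
        then have "e \<noteq> 1" using qe False by auto
        then have "2 \<le> e" using qe by simp
        then show ?thesis unfolding qe \<open>p = q\<close> by (rule le_imp_power_dvd)
      qed
      moreover have "s > 0" using s(2) M_pos dvd_pos_nat by blast
      ultimately show ?thesis using eq[OF s(2)] s unfolding SA_def by blast
    qed (use np in simp)
    then show ?thesis unfolding SA_def by blast
  qed
  have "cyclotomic (\<Prod>q\<in>Q. q ^ e q) dvd mask_poly A \<longleftrightarrow> cyclotomic (\<Prod>q\<in>Q. q ^ e q) dvd mask_poly A'"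
    if Q: "finite Q" "\<forall>q\<in>Q. prime q \<and> q ^ e q \<in> SA M A" for Q and e :: "nat \<Rightarrow> nat"
  proof (rule eq)
    have "coprime (q ^ e q) (r ^ e r)" if "q \<in> Q" "r \<in> Q" "q \<noteq> r" for q r
      using Q that by (simp add: primes_coprime)
    then show d: "(\<Prod>q\<in>Q. q ^ e q) dvd M"
      using Q unfolding SA_def by (intro prod_coprime_dvd) auto
    then show "(\<Prod>q\<in>Q. q ^ e q) > 0" using M_pos dvd_pos_nat by blast
    show "p\<^sup>2 dvd (\<Prod>q\<in>Q. q ^ e q)" if pd: "p dvd (\<Prod>q\<in>Q. q ^ e q)"
    proof -
      obtain q where q: "q \<in> Q" "p dvd q ^ e q"
        using pd prime_dvd_prod_iff[OF Q(1) pp(1), of "\<lambda>q. q ^ e q"] by auto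
      then have "p = q" using pp Q primes_dvd_imp_eq prime_dvd_power by metis
      have "e q \<noteq> 1" using np(1) Q(2) q(1) \<open>p = q\<close> by force
      moreover have "e q \<noteq> 0" using q pp by (metis not_prime_unit power_0)
      ultimately have "2 \<le> e q" by simp
      then have "p\<^sup>2 dvd q ^ e q" unfolding \<open>p = q\<close> by (rule le_imp_power_dvd)
      then show ?thesis by (rule dvd_trans[OF _ dvd_prodI[OF Q(1) q(1), of "\<lambda>q. q ^ e q"]])
    qed
  qed
  then show ?thesis unfolding T2_def SA by blast
qed


lemma fiber_shift_T2:
  assumes p: "p \<in> P" and sh: "\<And>b0. b0 \<in> B \<Longrightarrow> grid_core.shifts P (wrap M A) B b0 p x"
  obtains A' where "fiber_shift M P B A A'" "tiling_setting P M A' B" "T2 M A \<longleftrightarrow> T2 M A'"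
    "\<forall>n. (\<forall>q\<in>P. eq1 q n x) \<longrightarrow> (wrap M A' n \<longleftrightarrow> wrap M A n \<or> (\<forall>q\<in>P - {p}. eq2 q n x))"
proof (rule fiber_shift_ex[OF p sh])
  fix A'
  assume A': "fiber_shift M P B A A'" "tiling_setting P M A' B"
    "\<And>n. (\<forall>q\<in>P. eq1 q n x) \<Longrightarrow> wrap M A' n \<longleftrightarrow> wrap M A n \<or> (\<forall>q\<in>P - {p}. eq2 q n x)"
    "vanishes B p"
    "\<And>s. s dvd M \<Longrightarrow> s > 0 \<Longrightarrow> (p dvd s \<Longrightarrow> p\<^sup>2 dvd s) \<Longrightarrow>
      cyclotomic s dvd mask_poly A \<longleftrightarrow> cyclotomic s dvd mask_poly A'"
  show thesis
    by (rule that[OF A'(1,2) T2_cong[OF p A'(2,4,5)]]) (use A'(3) in blast)+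
qed

section \<open>Coordinates on a grid\<close>

definition Grid :: "int \<Rightarrow> int set" where
  "Grid x0 = {n \<in> Zmod M. \<forall>p\<in>P. eq1 p n x0}"

text \<open>Since \<open>M div p = p * (M div p\<^sup>2)\<close> and the second factor is a unit
  modulo \<open>p\<close>, the steps \<open>t * (M div p)\<close> run through all multiples of
  \<open>p\<close> modulo \<open>p\<^sup>2\<close>.\<close>

lemma coord_ex:
  assumes p: "p \<in> P" and e: "eq1 p y x"
  obtains t where "t < p" "eq2 p y (x + int (t * (M div p)))"
proof -
  have p0: "p > 0" using prime_P[OF p] prime_gt_0_nat by simp
  obtain s where s: "y - x = int p * s" using e unfolding eq1_def by blast
  define m where "m = int (M div p\<^sup>2)"
  have "\<not> int p dvd m" using M_div(6)[OF p] unfolding m_def by simp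
  then have "coprime m (int p)" using prime_P[OF p] prime_imp_coprime coprime_commute
    by (metis prime_int_nat_transfer prime_nat_int_transfer)
  then obtain u where "[m * u = 1] (mod int p)" using cong_solve_coprime_int by blast
  then have u: "int p dvd m * u - 1" by (simp add: cong_iff_dvd_diff)
  define t where "t = nat ((u * s) mod int p)"
  have t: "int t = (u * s) mod int p" "t < p" unfolding t_def using p0 by (auto simp: nat_less_iff)
  have "int p dvd s - int t * m"
  proof -
    have "int p dvd u * s - int t" unfolding t(1) by (rule dvd_minus_mod)
    then have "int p dvd (u * s - int t) * m - s * (m * u - 1)" using u by (intro dvd_diff) auto
    then show ?thesis by (simp add: algebra_simps)
  qed
  then have "int p * int p dvd int p * (s - int t * m)" by (intro mult_dvd_mono) auto
  moreover have "y - (x + int (t * (M div p))) = int p * (s - int t * m)"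
    using s M_div(5)[OF p] unfolding m_def by (simp add: algebra_simps)
  ultimately have "eq2 p y (x + int (t * (M div p)))" unfolding eq2_def by (simp add: power2_eq_square)
  then show ?thesis using that t by blast
qed

lemma coord_unique:
  assumes p: "p \<in> P" and e: "eq2 p (x + int (s * (M div p))) (x + int (t * (M div p)))" and lt: "s < p" "t < p"
  shows "s = t"
proof -
  have p0: "p > 0" using prime_P[OF p] prime_gt_0_nat by simp
  have "x + int (s * (M div p)) - (x + int (t * (M div p))) = int p * ((int s - int t) * int (M div p\<^sup>2))"
    using M_div(5)[OF p] by (simp add: algebra_simps)
  then have "int p * int p dvd int p * ((int s - int t) * int (M div p\<^sup>2))"
    using e unfolding eq2_def by (simp add: power2_eq_square)
  then have "int p dvd (int s - int t) * int (M div p\<^sup>2)" using p0 by simp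
  moreover have "prime (int p)" using prime_P[OF p] by simp
  ultimately have "int p dvd int s - int t" using M_div(6)[OF p] prime_dvd_mult_iff int_dvd_int_iff by blast
  then have "int s mod int p = int t mod int p" by (simp add: mod_eq_dvd_iff)
  then show ?thesis using lt by simp
qed

lemma coord_other:
  assumes "p \<in> P" "q \<in> P" "q \<noteq> p"
  shows "eq2 q (x + int (t * (M div p))) x"
  using M_div(4)[OF assms] unfolding eq2_def by (auto simp flip: of_nat_power)

lemma coord_sum:
  assumes l: "labels i j k"
  shows "eq2 i (x + int (u * (M div i) + v * (M div j) + w * (M div k))) (x + int (u * (M div i)))"
    "eq2 j (x + int (u * (M div i) + v * (M div j) + w * (M div k))) (x + int (v * (M div j)))"
    "eq2 k (x + int (u * (M div i) + v * (M div j) + w * (M div k))) (x + int (w * (M div k)))"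
proof -
  note P = labels_mem[OF l] and ne = l[unfolded labels_def]
  have "(int q)\<^sup>2 dvd int (t * (M div p))" if "p \<in> P" "q \<in> P" "q \<noteq> p" for p q t
    using M_div(4)[OF that] by (auto simp flip: of_nat_power)
  then show "eq2 i (x + int (u * (M div i) + v * (M div j) + w * (M div k))) (x + int (u * (M div i)))"
    "eq2 j (x + int (u * (M div i) + v * (M div j) + w * (M div k))) (x + int (v * (M div j)))"
    "eq2 k (x + int (u * (M div i) + v * (M div j) + w * (M div k))) (x + int (w * (M div k)))"
    using P ne unfolding eq2_def by (auto intro!: dvd_add)
qed

lemma mod_eq_sum:
  assumes l: "labels i j k" and y: "eq2 i y (x + int (u * (M div i)))" "eq2 j y (x + int (v * (M div j)))"
    "eq2 k y (x + int (w * (M div k)))"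
  shows "y mod int M = (x + int (u * (M div i) + v * (M div j) + w * (M div k))) mod int M"
proof -
  have "\<forall>p\<in>P. eq2 p y (x + int (u * (M div i) + v * (M div j) + w * (M div k)))"
    using eq2_trans[OF y(1) eq2_sym[OF coord_sum(1)[OF l]]] eq2_trans[OF y(2) eq2_sym[OF coord_sum(2)[OF l]]]
      eq2_trans[OF y(3) eq2_sym[OF coord_sum(3)[OF l]]]
    by (simp add: labels_ball[OF l])
  then show ?thesis by (simp only: eq2_iff_mod)
qed

lemma prod_dvd_iff: "int (\<Prod>P) dvd d \<longleftrightarrow> (\<forall>p\<in>P. int p dvd d)"
proof -
  obtain i j k where l: "labels i j k" by (rule labels_ex)
  have c: "coprime (int i) (int j)" "coprime (int i * int j) (int k)"
    using labels_coprime[OF l] by auto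
  have D: "\<Prod>P = i * j * k" using labels_prod[OF l, of "\<lambda>x. x"] by simp
  show ?thesis
    unfolding D using c by (auto simp: labels_ball[OF l] intro!: divides_mult dest: dvd_mult_left dvd_mult_right)
qed

lemma prod_pos: "\<Prod>P > 0"
  using prime_P prime_gt_0_nat by (intro prod_pos) auto

lemma prod_dvd_M: "\<Prod>P dvd M"
  unfolding M_def by (intro prod_dvd_prod) (simp add: power2_eq_square)

lemma grid_eq: "grid M (\<Prod>P) x = Grid x"
proof (intro equalityI subsetI)
  fix n assume "n \<in> grid M (\<Prod>P) x"
  then obtain t where n: "n = (x + int (\<Prod>P) * t) mod int M" unfolding grid_def by blast
  have "int (\<Prod>P) dvd x + int (\<Prod>P) * t - x" by simp
  then have "\<forall>p\<in>P. eq1 p (x + int (\<Prod>P) * t) x" unfolding eq1_def prod_dvd_iff .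
  then show "n \<in> Grid x" unfolding Grid_def n Zmod_def using M_pos by simp
next
  fix n assume n: "n \<in> Grid x"
  then have "int (\<Prod>P) dvd n - x" unfolding Grid_def eq1_def prod_dvd_iff by simp
  then obtain s where s: "n - x = int (\<Prod>P) * s" by blast
  have "int M dvd int (\<Prod>P) * (s - s mod int M)"
    by (simp add: minus_mod_eq_mult_div)
  then have "(x + int (\<Prod>P) * (s mod int M)) mod int M = n mod int M"
    using s by (simp add: mod_eq_dvd_iff algebra_simps dvd_diff_commute)
  also have "\<dots> = n" using n unfolding Grid_def Zmod_def by simp
  finally show "n \<in> grid M (\<Prod>P) x"
    unfolding grid_def Zmod_def using M_pos by (intro image_eqI[of _ _ "s mod int M"]) auto
qed

text \<open>The number of elements of \<open>B\<close> equals the number of classes modulo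
  \<open>D(M)\<close>.\<close>

lemma B_residues:
  assumes inj: "\<And>b b'. b \<in> B \<Longrightarrow> b' \<in> B \<Longrightarrow> (\<And>p. p \<in> P \<Longrightarrow> eq1 p b b') \<Longrightarrow> b = b'"
  shows "\<exists>b\<in>B. \<forall>p\<in>P. eq1 p b n"
proof -
  let ?D = "int (\<Prod>P)"
  have e: "(\<forall>p\<in>P. eq1 p x y) \<longleftrightarrow> x mod ?D = y mod ?D" for x y
    unfolding eq1_def mod_eq_dvd_iff prod_dvd_iff ..
  have "inj_on (\<lambda>b. b mod ?D) B"
    by (rule inj_onI) (use inj e in blast)
  then have "card ((\<lambda>b. b mod ?D) ` B) = \<Prod>P" using card_B by (simp add: card_image)
  moreover have "(\<lambda>b. b mod ?D) ` B \<subseteq> {0..<?D}" using prod_pos by (auto simp del: of_nat_prod)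
  ultimately have "(\<lambda>b. b mod ?D) ` B = {0..<?D}"
    by (intro card_subset_eq) (auto simp del: of_nat_prod)
  moreover have "n mod ?D \<in> {0..<?D}" using prod_pos by (simp del: of_nat_prod)
  ultimately obtain b where "b \<in> B" "b mod ?D = n mod ?D" by (metis (no_types, lifting) imageE)
  then show ?thesis using e by blast
qed

lemma Grid_cover:
  assumes "\<And>n. \<exists>b\<in>B. \<forall>p\<in>P. eq1 p b n"
  shows "\<exists>a\<in>Grid x0. \<exists>b\<in>B. (a + b) mod int M = n mod int M"
proof -
  obtain b where b: "b \<in> B" "\<forall>p\<in>P. eq1 p b (n - x0)" using assms by blast
  have "\<forall>p\<in>P. eq1 p (n - b) x0"
    using b(2) eq1_sym unfolding eq1_def by (metis add.commute diff_diff_eq2 diff_diff_add dvd_diff_commute)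
  then have "(n - b) mod int M \<in> Grid x0" unfolding Grid_def Zmod_def using M_pos by auto
  moreover have "((n - b) mod int M + b) mod int M = n mod int M" by (simp add: mod_add_left_eq)
  ultimately show ?thesis using b by blast
qed

lemma card_Grid_tiling:
  assumes "tiling M (Grid x0) B"
  shows "tiling_setting P M (Grid x0) B"
proof -
  have "card (Grid x0) * card B = card A * card B" using tiling_card[OF assms] tiling_card[OF tile] by simp
  then have "card (Grid x0) = \<Prod>P" using card_A card_B prod_pos by simp
  then show ?thesis using assms M_def card_B by unfold_locales auto
qed

end

text \<open>The boxes survive each fiber shift, so the missing lines can be filled one after the other.\<close>

lemma box_core_shifts:
  assumes "tiling_setting P M A B" "box_core P (wrap M A) B x0 U"
  shows "T2_equivalent_via_fiber_shifts M P B A (tiling_setting.Grid P M x0)"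
  using assms
proof (induction "card (tiling_setting.Grid P M x0 - A)" arbitrary: A rule: less_induct)
  case (less A)
  interpret t: tiling_setting P M A B by (rule less.prems(1))
  interpret b: box_core P "wrap M A" B x0 U by (rule less.prems(2))
  have finG: "finite (t.Grid x0)"
  proof -
    have "t.Grid x0 \<subseteq> {0..<int M}" unfolding t.Grid_def Zmod_def by auto
    then show ?thesis using finite_subset by blast
  qed
  have finA: "finite A" using tilingD(3)[OF t.tile] .
  show ?case
  proof (cases "t.Grid x0 \<subseteq> A")
    case True
    \<comment> \<open>Every residue is a sum of a grid point and an element of \<open>B\<close>. So
      the grid has at least as many elements as \<open>A\<close>, and the inclusion is an
      equality.\<close>
    have "M \<le> card (t.Grid x0) * card B"
    proof -
      have "Zmod M \<subseteq> (\<lambda>(a, b). (a + b) mod int M) ` (t.Grid x0 \<times> B)"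
      proof
        fix n assume "n \<in> Zmod M"
        then have "n mod int M = n" unfolding Zmod_def by simp
        then show "n \<in> (\<lambda>(a, b). (a + b) mod int M) ` (t.Grid x0 \<times> B)"
          using t.Grid_cover[OF b.B_surj, of x0 n] by force
      qed
      then have "card (Zmod M) \<le> card ((\<lambda>(a, b). (a + b) mod int M) ` (t.Grid x0 \<times> B))"
        using finG tilingD(4)[OF t.tile] by (intro card_mono) auto
      also have "\<dots> \<le> card (t.Grid x0 \<times> B)" using finG tilingD(4)[OF t.tile] by (intro card_image_le) auto
      finally show ?thesis by (simp add: Zmod_def card_cartesian_product)
    qed
    then have "card A * card B \<le> card (t.Grid x0) * card B" using tiling_card[OF t.tile] by simp
    then have "card A \<le> card (t.Grid x0)" using t.card_B t.prod_pos by simp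
    then have "t.Grid x0 = A" using True finA card_seteq by blast
    then show ?thesis
      unfolding T2_equivalent_via_fiber_shifts_def T2_equivalent_def using t.tile by simp
  next
    case False
    then obtain x where x: "x \<in> t.Grid x0" "x \<notin> A" by blast
    then have xL: "b.Lam x" and nA: "\<not> wrap M A x"
      using t.wrap_mem unfolding t.Grid_def b.Lam_def by auto
    obtain i where i: "i \<in> P" "\<And>b0. b0 \<in> B \<Longrightarrow> b.shifts b0 i x" using b.missing_point_shifts[OF xL nA] by blast
    obtain A' where A': "fiber_shift M P B A A'" "tiling_setting P M A' B" and T2: "T2 M A \<longleftrightarrow> T2 M A'"
      and wr: "\<forall>n. (\<forall>q\<in>P. eq1 q n x) \<longrightarrow> (wrap M A' n \<longleftrightarrow> wrap M A n \<or> (\<forall>q\<in>P - {i}. eq2 q n x))"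
      using t.fiber_shift_T2[OF i] by blast
    interpret t': tiling_setting P M A' B by (rule A'(2))
    interpret c': tiling_core P "wrap M A'" B by (rule t'.tiling_core)
    have sub: "wrap M A' n" if "wrap M A n" "b.Lam n" for n
    proof -
      have "\<forall>q\<in>P. eq1 q n x" using b.Lam_eq1[OF that(2) xL] by blast
      then show ?thesis using wr that by blast
    qed
    have "box_core P (wrap M A') B x0 U"
    proof unfold_locales
      show "U p x = U p y" if "p \<in> P" "eq2 p x y" for p x y using b.U_cong[OF that] .
      show "\<exists>x. b.Lam x \<and> U p x" "\<exists>x. b.Lam x \<and> \<not> U p x" if "p \<in> P" for p
        using b.U_ex[OF that] b.U_ex'[OF that] by auto
      show "wrap M A' x" if "b.Lam x" "(\<forall>p\<in>P. U p x) \<or> (\<forall>p\<in>P. \<not> U p x)" for x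
        using sub[OF b.boxes[OF that] that(1)] .
      show "b = b'" if "b \<in> B" "b' \<in> B" "\<And>p. p \<in> P \<Longrightarrow> eq1 p b b'" for b b'
        using b.B_inj that .
      show "\<exists>b\<in>B. \<forall>p\<in>P. eq1 p b n" for n by (rule b.B_surj)
    qed
    moreover have "card (t.Grid x0 - A') < card (t.Grid x0 - A)"
    proof (rule psubset_card_mono)
      have "x \<in> A'" using wr[rule_format, of x] t'.wrap_mem[of x] x unfolding t.Grid_def by auto
      moreover have "t.Grid x0 - A' \<subseteq> t.Grid x0 - A"
        using sub t.wrap_mem t'.wrap_mem unfolding t.Grid_def b.Lam_def by auto
      ultimately show "t.Grid x0 - A' \<subset> t.Grid x0 - A" using x by blast
    qed (use finG in simp)
    ultimately have "T2_equivalent_via_fiber_shifts M P B A' (t.Grid x0)"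
      using less.hyps A'(2) by blast
    then show ?thesis
      using T2 A'(1) t.tile
      unfolding T2_equivalent_via_fiber_shifts_def T2_equivalent_def
      by (auto intro: converse_rtranclp_into_rtranclp)
  qed
qed

section \<open>The tiling by the grid\<close>

context tiling_setting
begin

lemma mask_at_Grid:
  assumes z: "z ^ \<Prod>P = 1"
  shows "mask_at (Grid x0) z = of_nat (card (Grid x0)) * z ^ nat (x0 mod int M)"
proof -
  have "mask_at (Grid x0) z = (\<Sum>n\<in>Grid x0. z ^ nat (x0 mod int M))"
    unfolding mask_at_def
  proof (rule sum.cong)
    fix n assume n: "n \<in> Grid x0"
    show "z ^ nat n = z ^ nat (x0 mod int M)"
    proof (rule pow_nat_cong[OF z])
      have "\<forall>p\<in>P. int p dvd n - x0 mod int M"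
        using n unfolding Grid_def eq1_def[symmetric] by simp
      then show "int (\<Prod>P) dvd n - x0 mod int M" unfolding prod_dvd_iff .
    qed (use n M_pos in \<open>auto simp: Grid_def Zmod_def\<close>)
  qed simp
  then show ?thesis by simp
qed

lemma prime_dvd_M:
  assumes "prime q" "q dvd M"
  shows "q \<in> P"
proof -
  have "\<exists>p\<in>P. q dvd p\<^sup>2" using assms(2) prime_dvd_prod_iff[OF finite_P assms(1), of "\<lambda>p. p\<^sup>2"] unfolding M_def by simp
  then obtain p where p: "p \<in> P" "q dvd p" using prime_dvd_power[OF assms(1)] by blast
  then have "q = p" using primes_dvd_imp_eq[OF assms(1) prime_P[OF p(1)]] by blast
  then show ?thesis using p by simp
qed

lemma prime_power_dvd_M:
  assumes q: "prime q" and d: "q ^ e dvd M" and e: "e > 0"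
  shows "q \<in> P" "e = 1 \<or> e = 2"
proof -
  have "q dvd q ^ e" using e by simp
  then have "q dvd M" using d dvd_trans by blast
  then show P: "q \<in> P" by (rule prime_dvd_M[OF q])
  show "e = 1 \<or> e = 2"
  proof (rule ccontr)
    assume "\<not> ?thesis"
    then have "3 \<le> e" using e by simp
    then have "q ^ 3 dvd M" using d le_imp_power_dvd dvd_trans by blast
    then have "q\<^sup>2 * q dvd q\<^sup>2 * (M div q\<^sup>2)"
      using p_dvd_M(2)[OF P] by (simp add: power3_eq_cube power2_eq_square)
    then have "q dvd M div q\<^sup>2" using prime_gt_0_nat[OF q] by simp
    then show False using M_div(6)[OF P] by simp
  qed
qed

lemma SA_iff:
  assumes "prime q" "q ^ e \<in> SA M S"
  shows "q \<in> P" "e = 1 \<or> e = 2" "cyclotomic (q ^ e) dvd mask_poly S"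
proof -
  have "e > 0" using assms unfolding SA_def by (cases e) auto
  moreover have "q ^ e dvd M" "cyclotomic (q ^ e) dvd mask_poly S" using assms unfolding SA_def by auto
  ultimately show "q \<in> P" "e = 1 \<or> e = 2" "cyclotomic (q ^ e) dvd mask_poly S"
    using prime_power_dvd_M[OF assms(1)] by auto
qed

lemma P_pos: "p \<in> P \<Longrightarrow> p > 0" using prime_P prime_gt_0_nat by blast

text \<open>The grid lies in a single class modulo \<open>p\<close>, so its mask at a
  \<open>p\<close>-th root of unity is its cardinality times a root of unity. The remaining claims
  follow from \<open>vanishes_iff\<close>.\<close>

lemma Grid_vanishes:
  assumes t: "tiling M (Grid x0) B" and p: "p \<in> P"
  shows "\<not> vanishes (Grid x0) p" "vanishes B p" "\<not> vanishes B (p\<^sup>2)" "\<not> vanishes A p" "vanishes A (p\<^sup>2)"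
proof -
  interpret g: tiling_setting P M "Grid x0" B by (rule card_Grid_tiling[OF t])
  interpret s: tiling_setting P M B "Grid x0" by (rule g.swap)
  have v: "g.vanishes S n \<longleftrightarrow> vanishes S n" "s.vanishes S n \<longleftrightarrow> vanishes S n" for S n
    unfolding vanishes_def g.vanishes_def s.vanishes_def by auto
  have "vanishes (Grid x0) p \<Longrightarrow> False"
  proof -
    assume van: "vanishes (Grid x0) p"
    have "primitive_roots_unity p \<noteq> {}"
    proof -
      have p2: "p > 1" using prime_P[OF p] prime_gt_1_nat by blast
      have "card {z::complex. z ^ p = 1} = p" using card_roots_unity_eq p2 by simp
      then have "\<exists>z::complex. z ^ p = 1 \<and> z \<noteq> 1"
      proof -
        have "{z::complex. z ^ p = 1} \<noteq> {1}" using \<open>card {z::complex. z ^ p = 1} = p\<close> p2 by auto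
        moreover have "1 \<in> {z::complex. z ^ p = 1}" by simp
        ultimately show ?thesis by blast
      qed
      then show ?thesis using order_prime[OF prime_P[OF p]] by blast
    qed
    then obtain z where z: "z \<in> primitive_roots_unity p" by blast
    have zp: "z ^ p = 1" using primitive_root_pow_eq_1_iff[OF z P_pos[OF p]] by simp
    have "p dvd \<Prod>P" using p finite_P by auto
    then have zD: "z ^ \<Prod>P = 1" using primitive_root_pow_eq_1_iff[OF z P_pos[OF p]] by simp
    have "z \<noteq> 0" using zp P_pos[OF p] by (auto simp: power_0_left)
    then have "mask_at (Grid x0) z \<noteq> 0"
      using mask_at_Grid[OF zD] g.card_A prod_pos by (simp del: of_nat_prod)
    then show False using van z unfolding vanishes_def by blast
  qed
  then show 1: "\<not> vanishes (Grid x0) p" by blast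
  then show 2: "vanishes B p" using g.vanishes_iff[OF p] v by simp
  then show "\<not> vanishes B (p\<^sup>2)" using s.vanishes_iff[OF p] v by simp
  show "\<not> vanishes A p" "vanishes A (p\<^sup>2)" using 2 vanishes_iff[OF p] by auto
qed

lemma prod_squares_dvd: "Q \<subseteq> P \<Longrightarrow> (\<Prod>q\<in>Q. q\<^sup>2) dvd M"
  unfolding M_def using finite_P by (rule prod_dvd_prod_subset)

text \<open>Only squares of primes occur in \<open>SA\<close>. At a root whose order is a product of
  such squares, translation by \<open>D(M)\<close> preserves the grid but multiplies its mask by a
  number other than \<open>1\<close>.\<close>

lemma T2_Grid:
  assumes t: "tiling M (Grid x0) B"
  shows "T2 M (Grid x0)"
  unfolding T2_def
proof (intro allI impI, elim conjE)
  fix Q e assume Q: "finite Q" "Q \<noteq> {}" "\<forall>q\<in>Q. prime q \<and> q ^ e q \<in> SA M (Grid x0)"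
  have e2: "q \<in> P \<and> e q = 2" if "q \<in> Q" for q
  proof -
    note s = SA_iff[of q "e q" "Grid x0"]
    have qq: "prime q" "q ^ e q \<in> SA M (Grid x0)" using Q that by auto
    have "e q \<noteq> 1"
    proof
      assume "e q = 1"
      then have "vanishes (Grid x0) q" using s(3)[OF qq] vanishes_cyclotomic P_pos[OF s(1)[OF qq]] by simp
      then show False using Grid_vanishes(1)[OF t s(1)[OF qq]] by blast
    qed
    then show ?thesis using s(1,2)[OF qq] by blast
  qed
  define s where "s = (\<Prod>q\<in>Q. q\<^sup>2)"
  have se: "(\<Prod>q\<in>Q. q ^ e q) = s" unfolding s_def by (rule prod.cong) (use e2 in auto)
  have QP: "Q \<subseteq> P" using e2 by blast
  have sM: "s dvd M" unfolding s_def by (rule prod_squares_dvd[OF QP])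
  have s0: "s > 0" using sM M_pos dvd_pos_nat by blast
  have "mask_at (Grid x0) z = 0" if z: "z \<in> primitive_roots_unity s" for z
  proof -
    note zi = primitive_root_pow_eq_1_iff[OF z s0]
    have zM: "z ^ M = 1" using zi sM by simp
    let ?D = "\<Prod>P"
    have zD: "z ^ ?D \<noteq> 1"
    proof
      assume "z ^ ?D = 1"
      then have sD: "s dvd ?D" using zi by blast
      obtain q where q: "q \<in> Q" using Q by blast
      then have "q\<^sup>2 dvd s" unfolding s_def using Q(1) by auto
      then have "q\<^sup>2 dvd ?D" using sD dvd_trans by blast
      moreover obtain m where "?D = q * m" "\<not> q dvd m" using prod_P QP q by blast
      ultimately show False using P_pos QP q by (auto simp: power2_eq_square)
    qed
    have "bij_betw (\<lambda>n. (n + int ?D) mod int M) (Grid x0) (Grid x0)"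
    proof (rule bij_betw_byWitness[where f' = "\<lambda>n. (n - int ?D) mod int M"])
      have d: "int p dvd int ?D" if "p \<in> P" for p using prod_dvd_iff[THEN iffD1, OF dvd_refl] that by blast
      have a: "eq1 p (n + int ?D) x0 \<longleftrightarrow> eq1 p n x0" "eq1 p (n - int ?D) x0 \<longleftrightarrow> eq1 p n x0" if "p \<in> P" for n p
      proof -
        have "n + int ?D - x0 = (n - x0) + int ?D" "n - int ?D - x0 = (n - x0) - int ?D" by simp_all
        then show "eq1 p (n + int ?D) x0 \<longleftrightarrow> eq1 p n x0" "eq1 p (n - int ?D) x0 \<longleftrightarrow> eq1 p n x0"
          unfolding eq1_def using dvd_add_left_iff[OF d[OF that]] dvd_diff_left_iff[OF d[OF that]] by metis+
      qed
      show "\<forall>n\<in>Grid x0. ((n + int ?D) mod int M - int ?D) mod int M = n"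
        "\<forall>n\<in>Grid x0. ((n - int ?D) mod int M + int ?D) mod int M = n"
        unfolding Grid_def Zmod_def by (auto simp: mod_diff_left_eq mod_add_left_eq simp del: of_nat_prod)
      show "(\<lambda>n. (n + int ?D) mod int M) ` Grid x0 \<subseteq> Grid x0"
        "(\<lambda>n. (n - int ?D) mod int M) ` Grid x0 \<subseteq> Grid x0"
        using M_pos a unfolding Grid_def Zmod_def by (auto simp del: of_nat_prod)
    qed
    then have "mask_at (Grid x0) z = z ^ ?D * mask_at (Grid x0) z"
    proof (rule mask_at_bij)
      fix n assume "n \<in> Grid x0"
      then have n: "n \<ge> 0" unfolding Grid_def Zmod_def by simp
      have "z ^ nat ((n + int ?D) mod int M) = z ^ nat (n + int ?D)"
        using n M_pos by (intro pow_nat_cong[OF zM]) (auto simp: mod_eq_dvd_iff[symmetric] simp del: of_nat_prod)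
      then show "z ^ nat ((n + int ?D) mod int M) = z ^ ?D * z ^ nat n"
        using n by (simp add: nat_add_distrib power_add del: of_nat_prod)
    qed
    then show ?thesis using zD by simp
  qed
  then show "cyclotomic (\<Prod>q\<in>Q. q ^ e q) dvd mask_poly (Grid x0)"
    unfolding se using s0 by (simp add: cyclotomic_dvd_mask)
qed

text \<open>For \<open>B\<close> only the primes themselves occur, so the orders divide
  \<open>D(M)\<close>. There the mask of the grid is nonzero, and the product of both masks
  vanishes.\<close>

lemma T2_B:
  assumes t: "tiling M (Grid x0) B"
  shows "T2 M B"
  unfolding T2_def
proof (intro allI impI, elim conjE)
  interpret g: tiling_setting P M "Grid x0" B by (rule card_Grid_tiling[OF t])
  fix Q e assume Q: "finite Q" "Q \<noteq> {}" "\<forall>q\<in>Q. prime q \<and> q ^ e q \<in> SA M B"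
  have e1: "q \<in> P \<and> e q = 1" if "q \<in> Q" for q
  proof -
    note s = SA_iff[of q "e q" B]
    have qq: "prime q" "q ^ e q \<in> SA M B" using Q that by auto
    have "e q \<noteq> 2"
    proof
      assume "e q = 2"
      then have "vanishes B (q\<^sup>2)" using s(3)[OF qq] vanishes_cyclotomic P_pos[OF s(1)[OF qq]] by simp
      then show False using Grid_vanishes(3)[OF t s(1)[OF qq]] by blast
    qed
    then show ?thesis using s(1,2)[OF qq] by blast
  qed
  have QP: "Q \<subseteq> P" using e1 by blast
  have se: "(\<Prod>q\<in>Q. q ^ e q) = \<Prod>Q" by (rule prod.cong) (use e1 in auto)
  have sD: "\<Prod>Q dvd \<Prod>P" using finite_P QP by (rule prod_dvd_prod_subset)
  have s0: "\<Prod>Q > 0" using sD prod_pos dvd_pos_nat by blast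
  have s1: "\<Prod>Q \<noteq> 1"
  proof
    assume "\<Prod>Q = 1"
    moreover obtain q where q: "q \<in> Q" using Q by blast
    ultimately have "q dvd 1" using Q(1) by (metis dvd_prodI)
    then show False using prime_P QP q not_prime_unit by blast
  qed
  have "mask_at B z = 0" if z: "z \<in> primitive_roots_unity (\<Prod>Q)" for z
  proof -
    note zi = primitive_root_pow_eq_1_iff[OF z s0]
    have zD: "z ^ \<Prod>P = 1" using zi sD by blast
    have zM: "z ^ M = 1" using zi dvd_trans[OF sD prod_dvd_M] by blast
    have z1: "z \<noteq> 1" using zi[of 1] s1 by auto
    have "z \<noteq> 0" using zM M_pos by (auto simp: power_0_left)
    then have "mask_at (Grid x0) z \<noteq> 0"
      using mask_at_Grid[OF zD] g.card_A prod_pos by (simp del: of_nat_prod)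
    then show ?thesis using mask_at_tiling[OF t M_pos zM z1] by blast
  qed
  then show "cyclotomic (\<Prod>q\<in>Q. q ^ e q) dvd mask_poly B"
    unfolding se using s0 by (simp add: cyclotomic_dvd_mask)
qed

lemma monom_mod_dvd: "(monom 1 M - 1 :: int poly) dvd monom 1 a - monom 1 (a mod M)"
proof -
  have "monom 1 M - 1 dvd (monom 1 M ^ (a div M) - 1 :: int poly)"
    using power_diff_1_eq[of "monom 1 M :: int poly" "a div M"] by (cases "a div M = 0") auto
  then have "monom 1 M - 1 dvd monom 1 (a mod M) * (monom 1 M ^ (a div M) - 1 :: int poly)" by (rule dvd_mult)
  also have "monom 1 (a mod M) * (monom 1 M ^ (a div M) - 1) = (monom 1 a - monom 1 (a mod M) :: int poly)"
    by (simp add: monom_power mult_monom algebra_simps)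
  finally show ?thesis .
qed

text \<open>Under the hypothesis every index set in the definition is \<open>{2}\<close>, so the
  flat mask is a product of the masks of three fibers. Reduced modulo \<open>M\<close>, its
  exponents run once through the grid of \<open>0\<close>.\<close>

lemma is_flat_Grid:
  assumes v: "\<And>p. p \<in> P \<Longrightarrow> \<not> vanishes A p \<and> vanishes A (p\<^sup>2)"
  shows "is_flat M P A (Grid 0)"
proof -
  obtain i j k where l: "labels i j k" by (rule labels_ex)
  note P = labels_mem[OF l]
  have inner: "(\<Prod>\<alpha> | \<alpha> \<in> {1, 2} \<and> cyclotomic (p ^ \<alpha>) dvd mask_poly A.
        \<Sum>t<p. monom 1 (t * (M div p\<^sup>2) * p ^ (\<alpha> - 1))) = (\<Sum>t<p. monom 1 (t * (M div p)) :: int poly)"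
    if p: "p \<in> P" for p
  proof -
    have "\<not> cyclotomic (p ^ 1) dvd mask_poly A" "cyclotomic (p ^ 2) dvd mask_poly A"
      using v[OF p] P_pos[OF p] by (simp_all add: vanishes_cyclotomic)
    then have "{\<alpha>. \<alpha> \<in> {1, 2} \<and> cyclotomic (p ^ \<alpha>) dvd mask_poly A} = {2::nat}" by auto
    then show ?thesis using M_div(5)[OF p] by (simp add: mult.assoc mult.left_commute mult.commute)
  qed
  define g where "g = (\<lambda>(u, v, w). u * (M div i) + v * (M div j) + w * (M div k))"
  define T where "T = {..<i} \<times> {..<j} \<times> {..<k}"
  have flat: "flat_mask M P A = (\<Sum>x\<in>T. monom 1 (g x))"
  proof -
    have "flat_mask M P A = (\<Prod>p\<in>P. \<Sum>t<p. monom 1 (t * (M div p)))"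
      unfolding flat_mask_def by (rule prod.cong) (use inner in auto)
    also have "\<dots> = (\<Sum>u<i. monom 1 (u * (M div i))) * ((\<Sum>v<j. monom 1 (v * (M div j))) * (\<Sum>w<k. monom 1 (w * (M div k))))"
      by (simp add: labels_prod[OF l] mult.assoc)
    also have "\<dots> = (\<Sum>x\<in>T. monom 1 (g x))"
      unfolding T_def g_def sum_product
      by (simp add: sum.cartesian_product' sum_distrib_left mult_monom add.assoc)
    finally show ?thesis .
  qed
  have bij: "bij_betw (\<lambda>x. int (g x) mod int M) T (Grid 0)"
    unfolding bij_betw_def
  proof
    have gc: "eq2 i (int (g x)) (0 + int (fst x * (M div i)))" "eq2 j (int (g x)) (0 + int (fst (snd x) * (M div j)))"
      "eq2 k (int (g x)) (0 + int (snd (snd x) * (M div k)))" for x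
      using coord_sum[OF l, of 0 "fst x" "fst (snd x)" "snd (snd x)"] unfolding g_def by (auto simp: case_prod_unfold)
    show "inj_on (\<lambda>x. int (g x) mod int M) T"
    proof (rule inj_onI)
      fix x y assume x: "x \<in> T" "y \<in> T" and "int (g x) mod int M = int (g y) mod int M"
      then have e: "eq2 p (int (g x)) (int (g y))" if "p \<in> P" for p using that eq2_iff_mod by blast
      have "fst x = fst y"
        using x P unfolding T_def
        by (intro coord_unique[OF _ eq2_trans[OF eq2_sym[OF gc(1)[of x]] eq2_trans[OF e[of i] gc(1)[of y]]]]) auto
      moreover have "fst (snd x) = fst (snd y)"
        using x P unfolding T_def
        by (intro coord_unique[OF _ eq2_trans[OF eq2_sym[OF gc(2)[of x]] eq2_trans[OF e[of j] gc(2)[of y]]]]) auto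
      moreover have "snd (snd x) = snd (snd y)"
        using x P unfolding T_def
        by (intro coord_unique[OF _ eq2_trans[OF eq2_sym[OF gc(3)[of x]] eq2_trans[OF e[of k] gc(3)[of y]]]]) auto
      ultimately show "x = y" by (auto simp: prod_eq_iff)
    qed
    show "(\<lambda>x. int (g x) mod int M) ` T = Grid 0"
    proof (intro equalityI subsetI)
      fix n assume "n \<in> (\<lambda>x. int (g x) mod int M) ` T"
      then obtain x where n: "n = int (g x) mod int M" by blast
      have z: "eq1 p (0 + int (t * (M div p))) 0" if "p \<in> P" for p t
        using M_div(2)[OF that] unfolding eq1_def by auto
      have "\<forall>p\<in>P. eq1 p (int (g x)) 0"
        unfolding labels_ball[OF l]
        using eq1_trans[OF eq2_imp_eq1[OF gc(1)] z] eq1_trans[OF eq2_imp_eq1[OF gc(2)] z]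
          eq1_trans[OF eq2_imp_eq1[OF gc(3)] z] P by blast
      then show "n \<in> Grid 0" unfolding n Grid_def Zmod_def using M_pos by simp
    next
      fix n assume n: "n \<in> Grid 0"
      then have "\<forall>p\<in>P. eq1 p n 0" unfolding Grid_def by blast
      then obtain u v w where uvw: "u < i" "eq2 i n (0 + int (u * (M div i)))" "v < j" "eq2 j n (0 + int (v * (M div j)))"
        "w < k" "eq2 k n (0 + int (w * (M div k)))" using coord_ex P by metis
      have "n mod int M = int (g (u, v, w)) mod int M"
        using mod_eq_sum[OF l uvw(2,4,6)] unfolding g_def by simp
      moreover have "n mod int M = n" using n unfolding Grid_def Zmod_def by simp
      moreover have "(u, v, w) \<in> T" using uvw unfolding T_def by simp
      ultimately show "n \<in> (\<lambda>x. int (g x) mod int M) ` T" by (metis (no_types, lifting) image_eqI)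
    qed
  qed
  have "mask_poly (Grid 0) = (\<Sum>x\<in>T. monom 1 (g x mod M))"
    unfolding mask_poly_def sum.reindex_bij_betw[OF bij, symmetric]
    by (rule sum.cong) (auto simp flip: of_nat_mod)
  then have "mask_poly (Grid 0) - flat_mask M P A = - (\<Sum>x\<in>T. monom 1 (g x) - monom 1 (g x mod M))"
    unfolding flat by (simp add: sum_subtractf)
  moreover have "(monom 1 M - 1 :: int poly) dvd (\<Sum>x\<in>T. monom 1 (g x) - monom 1 (g x mod M))"
    by (rule dvd_sum) (rule monom_mod_dvd)
  ultimately show ?thesis unfolding is_flat_def Grid_def by auto
qed

lemma Grid_translate: "Grid x0 = sumset M {x0} (Grid 0)"
proof (intro equalityI subsetI)
  fix n assume n: "n \<in> Grid x0"
  then have "\<forall>p\<in>P. eq1 p (n - x0) 0" unfolding Grid_def eq1_def by simp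
  then have "(n - x0) mod int M \<in> Grid 0" unfolding Grid_def Zmod_def using M_pos by simp
  moreover have "n = (x0 + (n - x0) mod int M) mod int M"
    using n unfolding Grid_def Zmod_def by (simp add: mod_add_right_eq)
  ultimately show "n \<in> sumset M {x0} (Grid 0)" unfolding sumset_def by force
next
  fix n assume "n \<in> sumset M {x0} (Grid 0)"
  then obtain s where s: "s \<in> Grid 0" "n = (x0 + s) mod int M" unfolding sumset_def by auto
  then have "\<forall>p\<in>P. eq1 p (x0 + s) x0" unfolding Grid_def eq1_def by simp
  then show "n \<in> Grid x0" unfolding s Grid_def Zmod_def using M_pos by simp
qed

lemma T2_and_flat_of_Grid:
  assumes "T2_equivalent M B A (Grid x0)"
  shows "(\<exists>F x. is_flat M P A F \<and> Grid x0 = sumset M {x} F) \<and> T2 M A \<and> T2 M B"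
proof -
  have t: "tiling M (Grid x0) B" and T: "T2 M A \<longleftrightarrow> T2 M (Grid x0)"
    using assms unfolding T2_equivalent_def by auto
  show ?thesis
    using is_flat_Grid Grid_vanishes(4,5)[OF t] Grid_translate T T2_Grid[OF t] T2_B[OF t] by blast
qed

end

section \<open>The three structures\<close>

context tiling_setting
begin

lemma sumset_lines: "p \<in> P \<Longrightarrow> sumset M S (fiber M p) = (\<Union>s\<in>S. line p s)"
  unfolding line_fiber[symmetric] sumset_def by auto

lemma plane_fibers:
  assumes l: "labels n b g"
  shows "sumset M (sumset M {a} (fiber M b)) (fiber M g) =
    {y \<in> Zmod M. eq2 n y a \<and> eq1 b y a \<and> eq1 g y a}"
proof -
  note P = labels_mem[OF l] and ne = l[unfolded labels_def]
  have pm: "(\<forall>q\<in>P - {b}. Q q) \<longleftrightarrow> Q n \<and> Q g" "(\<forall>q\<in>P - {g}. Q q) \<longleftrightarrow> Q n \<and> Q b" for Q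
    using ne by auto
  show ?thesis
    unfolding line_fiber[OF P[THEN conjunct2, THEN conjunct1]] sumset_lines[OF P[THEN conjunct2, THEN conjunct2]]
  proof (intro equalityI subsetI)
    fix y assume "y \<in> (\<Union>s\<in>line b a. line g s)"
    then obtain s where s: "eq1 b s a" "eq2 n s a" "eq2 g s a" "y \<in> Zmod M" "eq1 g y s" "eq2 n y s" "eq2 b y s"
      unfolding line_def pm by auto
    then show "y \<in> {y \<in> Zmod M. eq2 n y a \<and> eq1 b y a \<and> eq1 g y a}"
      using eq2_trans[OF s(6,2)] eq1_trans[OF eq2_imp_eq1[OF s(7)] s(1)] eq1_trans[OF s(5) eq2_imp_eq1[OF s(3)]] by simp
  next
    fix y assume y: "y \<in> {y \<in> Zmod M. eq2 n y a \<and> eq1 b y a \<and> eq1 g y a}"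
    obtain w where w: "eq2 n w a" "eq2 b w y" "eq2 g w a" using crt[OF l] by blast
    define s where "s = w mod int M"
    have s: "eq2 n s a" "eq2 b s y" "eq2 g s a" "s \<in> Zmod M"
      using w P M_pos unfolding s_def Zmod_def by auto
    have "s \<in> line b a"
      unfolding line_def pm using s eq1_trans[OF eq2_imp_eq1[OF s(2)]] y by blast
    moreover have "y \<in> line g s"
      unfolding line_def pm
      using y eq2_trans[OF _ eq2_sym[OF s(1)]] eq2_sym[OF s(2)] eq1_trans[OF _ eq2_imp_eq1[OF eq2_sym[OF s(3)]]] by blast
    ultimately show "y \<in> (\<Union>s\<in>line b a. line g s)" by blast
  qed
qed

lemma M_div_dvd: "p \<in> P \<Longrightarrow> M div p dvd M"
  using M_div(1) by (metis dvd_triv_right)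

lemma gcdM_line:
  assumes l: "labels n b g" and e: "\<And>p. p \<in> P \<Longrightarrow> eq1 p x y"
  shows "gcdM M (x - y) = M div n \<longleftrightarrow> \<not> eq2 n x y \<and> eq2 b x y \<and> eq2 g x y"
proof -
  note P = labels_mem[OF l] and ne = l[unfolded labels_def]
  have n: "n \<in> P" using P by simp
  have "q dvd M div n" if "q \<in> P" for q
    using M_div(2)[OF n] M_div(4)[OF n that] by (cases "q = n") (auto simp: power2_eq_square dest: dvd_mult_left)
  then show ?thesis
    using e M_div(3)[OF n] M_div(4)[OF n] P ne
    unfolding gcdM_iff[OF M_div_dvd[OF n]] labels_ball[OF l] eq1_def[symmetric] eq2_def[symmetric] by auto
qed

lemma gcdM_plane:
  assumes l: "labels n b g" and e: "\<And>p. p \<in> P \<Longrightarrow> eq1 p x y"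
  shows "gcdM M (x - y) = M div (b * g) \<longleftrightarrow> eq2 n x y \<and> \<not> eq2 b x y \<and> \<not> eq2 g x y"
proof -
  note P = labels_mem[OF l] and ne = l[unfolded labels_def]
  have pos: "b > 0" "g > 0" using P_pos P by auto
  define m where "m = M div (b * g)"
  have M: "M = (b * g) * (n\<^sup>2 * (b * g))" unfolding M_def by (simp add: labels_prod[OF l] power2_eq_square)
  have m: "m = n\<^sup>2 * (b * g)" unfolding m_def using pos by (subst M) simp
  have pr: "prime n" "prime b" "prime g" using prime_P P by auto
  have nd: "\<not> b dvd n\<^sup>2 * g" "\<not> g dvd n\<^sup>2 * b"
    using pr ne primes_dvd_imp_eq[of b n] primes_dvd_imp_eq[of b g] primes_dvd_imp_eq[of g n] primes_dvd_imp_eq[of g b]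
    by (auto simp: prime_dvd_mult_iff prime_dvd_power_iff)
  have "\<not> b\<^sup>2 dvd m"
  proof
    assume "b\<^sup>2 dvd m"
    then have "b * b dvd b * (n\<^sup>2 * g)" unfolding m by (simp add: power2_eq_square ac_simps)
    then show False using nd pos by simp
  qed
  moreover have "\<not> g\<^sup>2 dvd m"
  proof
    assume "g\<^sup>2 dvd m"
    then have "g * g dvd g * (n\<^sup>2 * b)" unfolding m by (simp add: power2_eq_square ac_simps)
    then show False using nd pos by simp
  qed
  moreover have "n\<^sup>2 dvd m" "n dvd m" "b dvd m" "g dvd m" unfolding m by (auto simp: power2_eq_square)
  moreover have "m dvd M" unfolding M m by simp
  ultimately show ?thesis
    using e P unfolding m_def[symmetric] gcdM_iff[OF \<open>m dvd M\<close>] labels_ball[OF l] eq1_def[symmetric] eq2_def[symmetric]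
    by auto
qed

lemma Grid_eq1: "x \<in> Grid x0 \<Longrightarrow> y \<in> Grid x0 \<Longrightarrow> p \<in> P \<Longrightarrow> eq1 p x y"
  unfolding Grid_def using eq1_sym eq1_trans by blast

lemma Grid_mem: "(\<forall>p\<in>P. eq1 p n x0) \<Longrightarrow> n mod int M \<in> Grid x0"
  unfolding Grid_def Zmod_def using M_pos by auto

text \<open>The two planes of a corner lie inside the grid, so it suffices to know \<open>A\<close>
  on the points of the grid sharing one coordinate with \<open>a\<close> or
  \<open>a'\<close>.\<close>

lemma cornerI:
  assumes l: "labels n b g" and a: "a \<in> Grid x0" "a' \<in> Grid x0"
    and e: "\<not> eq2 n a a'" "eq2 b a a'" "eq2 g a a'"
    and A: "\<And>y. y \<in> Grid x0 \<Longrightarrow> eq2 n y a \<Longrightarrow> y \<in> A \<longleftrightarrow> eq2 g y a"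
    and A': "\<And>y. y \<in> Grid x0 \<Longrightarrow> eq2 n y a' \<Longrightarrow> y \<in> A \<longleftrightarrow> eq2 b y a'"
  shows "corner M P n (Grid x0) A"
proof -
  note P = labels_mem[OF l] and ne = l[unfolded labels_def]
  have pm: "(\<forall>q\<in>P - {b}. Q q) \<longleftrightarrow> Q n \<and> Q g" "(\<forall>q\<in>P - {g}. Q q) \<longleftrightarrow> Q n \<and> Q b" for Q
    using ne by auto
  have 1: "{n, b, g} = P" using ne by simp
  have 2: "a \<in> A \<inter> Grid x0" "a' \<in> A \<inter> Grid x0" using a A[OF a(1)] A'[OF a(2)] by auto
  have 3: "gcdM M (a - a') = M div n" using gcdM_line[OF l Grid_eq1[OF a]] e by blast
  have G: "y \<in> Grid x0" if "y \<in> Zmod M" "c \<in> Grid x0" "eq2 n y c" "eq1 b y c" "eq1 g y c" for y c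
  proof -
    have "\<forall>p\<in>P. eq1 p y c" 
      unfolding labels_ball[OF l] using eq2_imp_eq1[OF that(3)] that(4,5) by (intro conjI)
    then have "\<forall>p\<in>P. eq1 p y x0" using that(2) eq1_trans unfolding Grid_def by blast
    then show ?thesis using that(1) unfolding Grid_def by blast
  qed
  have l': "labels n g b" using labels_perm(2)[OF l] .
  have line: "line b a = {y \<in> Zmod M. eq2 n y a \<and> eq1 b y a \<and> eq2 g y a}"
    "line g a' = {y \<in> Zmod M. eq2 n y a' \<and> eq2 b y a' \<and> eq1 g y a'}"
    unfolding line_def pm by auto
  have F: "sumset M {a} (fiber M b) = line b a" "sumset M {a'} (fiber M g) = line g a'"
    using line_fiber P by auto
  have 4: "A \<inter> sumset M (sumset M {a} (fiber M b)) (fiber M g) = sumset M {a} (fiber M b)"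
    unfolding plane_fibers[OF l] unfolding F line
    using A G[OF _ a(1)] eq2_imp_eq1 by blast
  have 5: "A \<inter> sumset M (sumset M {a'} (fiber M b)) (fiber M g) = sumset M {a'} (fiber M g)"
    unfolding plane_fibers[OF l] unfolding F line
    using A' G[OF _ a(2)] eq2_imp_eq1 by blast
  show ?thesis
    unfolding corner_def
    by (rule exI[of _ b], rule exI[of _ g], rule conjI[OF 1], rule bexI[OF _ 2(1)], rule bexI[OF _ 2(2)])
      (intro conjI 3 4 5)
qed

text \<open>In two planes orthogonal to direction \<open>n\<close>, the set \<open>A\<close> is a
  line punctured at \<open>a\<close> and a line of the other direction punctured at
  \<open>a'\<close>. Both punctures lie on the \<open>n\<close>-line of \<open>a\<close>, and
  shifting a fiber onto it completes both lines.\<close>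

lemma corner_of_shift:
  assumes l: "labels n b g" and sh: "\<And>b0. b0 \<in> B \<Longrightarrow> grid_core.shifts P (wrap M A) B b0 n a"
    and a: "a \<in> Grid x0" "a' \<in> Grid x0"
    and e: "\<not> eq2 n a a'" "eq2 b a a'" "eq2 g a a'"
    and A: "\<And>y. y \<in> Grid x0 \<Longrightarrow> eq2 n y a \<Longrightarrow> y \<in> A \<longleftrightarrow> \<not> eq2 b y a \<and> eq2 g y a"
    and A': "\<And>y. y \<in> Grid x0 \<Longrightarrow> eq2 n y a' \<Longrightarrow> y \<in> A \<longleftrightarrow> eq2 b y a' \<and> \<not> eq2 g y a'"
  shows "\<exists>A'. T2_equivalent M B A A' \<and> (\<exists>n\<in>P. corner M P n (Grid x0) A')"
proof -
  note P = labels_mem[OF l] and ne = l[unfolded labels_def]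
  have pm: "(\<forall>q\<in>P - {n}. Q q) \<longleftrightarrow> Q b \<and> Q g" for Q using ne by auto
  have n: "n \<in> P" using P by simp
  obtain A1 where A1: "tiling_setting P M A1 B" and T2: "T2 M A \<longleftrightarrow> T2 M A1"
    and wr: "\<forall>y. (\<forall>q\<in>P. eq1 q y a) \<longrightarrow> (wrap M A1 y \<longleftrightarrow> wrap M A y \<or> (\<forall>q\<in>P - {n}. eq2 q y a))"
    by (rule fiber_shift_T2[OF n sh]) blast
  interpret s: tiling_setting P M A1 B by (rule A1)
  have m: "y \<in> A1 \<longleftrightarrow> y \<in> A \<or> eq2 b y a \<and> eq2 g y a" if y: "y \<in> Grid x0" for y
  proof -
    have "y \<in> Zmod M" using y unfolding Grid_def by simp
    then show ?thesis
      using wr[rule_format, of y] Grid_eq1[OF y a(1)] wrap_mem[of y] s.wrap_mem[of y] unfolding pm by blast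
  qed
  have "corner M P n (s.Grid x0) A1"
  proof (rule s.cornerI[OF l a e])
    show "y \<in> A1 \<longleftrightarrow> eq2 g y a" if "y \<in> Grid x0" "eq2 n y a" for y
      using m[OF that(1)] A[OF that] by blast
    show "y \<in> A1 \<longleftrightarrow> eq2 b y a'" if "y \<in> Grid x0" "eq2 n y a'" for y
      using m[OF that(1)] A'[OF that] eq2_right[OF e(2), of y] eq2_right[OF e(3), of y] eq2_left eq2_sym e by (metis eq2_right)
  qed
  then show ?thesis using n T2 tile s.tile unfolding T2_equivalent_def by blast
qed

text \<open>For a shift in direction \<open>j\<close>, the plane \<open>j = c\<close> meets
  \<open>A\<close> in a punctured \<open>i\<close>-line, and every parallel plane within the grid
  meets it in a punctured \<open>k\<close>-line. Direction \<open>k\<close> is symmetric.\<close>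

lemma full_plane_corner:
  assumes "full_plane_structure M P (Grid x0) A"
  shows "\<exists>A'. T2_equivalent M B A A' \<and> (\<exists>n\<in>P. corner M P n (Grid x0) A')"
proof -
  obtain i j k c where ijk: "{i, j, k} = P" and c: "c \<in> Grid x0" "c \<notin> A"
    and AL: "A \<inter> Grid x0 = {y \<in> Grid x0. gcdM M (y - c) \<in> {M div i, M div (j * k)}}"
    using assms unfolding full_plane_structure_def by blast
  have l: "labels i j k"
    unfolding labels_def using ijk card_P by (auto simp: card_insert_if split: if_splits)
  note P = labels_mem[OF l] and ne = l[unfolded labels_def]
  have A: "y \<in> A \<longleftrightarrow> (\<not> eq2 i y c \<and> eq2 j y c \<and> eq2 k y c) \<or> (eq2 i y c \<and> \<not> eq2 j y c \<and> \<not> eq2 k y c)"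
    if y: "y \<in> Grid x0" for y
    using AL gcdM_line[OF l Grid_eq1[OF y c(1)]] gcdM_plane[OF l Grid_eq1[OF y c(1)]] y by blast
  interpret p: plane_core P "wrap M A" B x0 by (rule plane_core)
  have L: "p.Lam z \<longleftrightarrow> z mod int M \<in> Grid x0" for z
    unfolding p.Lam_def Grid_def Zmod_def using M_pos by auto
  interpret f: full_plane_core P "wrap M A" B x0 i j k c
  proof unfold_locales
    show "labels i j k" by (rule l)
    show "p.Lam c" using c unfolding p.Lam_def Grid_def by auto
    show "wrap M A z \<longleftrightarrow> (\<not> eq2 i z c \<and> eq2 j z c \<and> eq2 k z c) \<or> (eq2 i z c \<and> \<not> eq2 j z c \<and> \<not> eq2 k z c)"
      if "p.Lam z" for z
      using A[of "z mod int M"] that P unfolding L wrap_def by simp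
  qed
  have corner: "\<exists>A'. T2_equivalent M B A A' \<and> (\<exists>n\<in>P. corner M P n (Grid x0) A')"
    if l': "labels j i k" and sh: "\<And>b0. b0 \<in> B \<Longrightarrow> p.shifts b0 j c"
      and A: "\<And>y. y \<in> Grid x0 \<Longrightarrow> y \<in> A \<longleftrightarrow> (\<not> eq2 i y c \<and> eq2 j y c \<and> eq2 k y c) \<or> (eq2 i y c \<and> \<not> eq2 j y c \<and> \<not> eq2 k y c)"
    for j k
  proof -
    note P' = labels_mem[OF l'] and ne' = l'[unfolded labels_def]
    have cL: "p.Lam c" using c unfolding p.Lam_def Grid_def by auto
    obtain w where w: "p.Lam w" "\<not> eq2 j w c" "\<And>q. q \<in> P \<Longrightarrow> q \<noteq> j \<Longrightarrow> eq2 q w c"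
      using p.third_point[of j c c c] P' cL by metis
    define a' where "a' = w mod int M"
    have a': "a' \<in> Grid x0" "\<not> eq2 j c a'" "eq2 i c a'" "eq2 k c a'"
      using w P' ne' L eq2_sym unfolding a'_def by auto
    show ?thesis
    proof (rule corner_of_shift[OF l' sh c(1) a'])
      show "y \<in> A \<longleftrightarrow> \<not> eq2 i y c \<and> eq2 k y c" if "y \<in> Grid x0" "eq2 j y c" for y
        using A[OF that(1)] that(2) by blast
      show "y \<in> A \<longleftrightarrow> eq2 i y a' \<and> \<not> eq2 k y a'" if "y \<in> Grid x0" "eq2 j y a'" for y
        using A[OF that(1)] that(2) a' eq2_right[OF a'(3), of y] eq2_right[OF a'(4), of y] eq2_left[OF that(2), of c] eq2_sym by blast
    qed
  qed
  from f.shifts_all show ?thesis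
  proof
    assume "\<forall>b0\<in>B. p.shifts b0 j c"
    then show ?thesis using corner[OF labels_perm(1)[OF l]] A by blast
  next
    assume "\<forall>b0\<in>B. p.shifts b0 k c"
    moreover have "labels k i j" using labels_perm(5)[OF l] .
    ultimately show ?thesis using corner[of k j] A by blast
  qed
qed

lemma box_core_of_inj:
  assumes inj: "\<And>b b'. b \<in> B \<Longrightarrow> b' \<in> B \<Longrightarrow> (\<And>p. p \<in> P \<Longrightarrow> eq1 p b b') \<Longrightarrow> b = b'"
    and U: "\<And>p x y. p \<in> P \<Longrightarrow> eq2 p x y \<Longrightarrow> U p x \<longleftrightarrow> U p y"
    and ex: "\<And>p. p \<in> P \<Longrightarrow> \<exists>x\<in>Grid x0. U p x" "\<And>p. p \<in> P \<Longrightarrow> \<exists>x\<in>Grid x0. \<not> U p x"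
    and boxes: "\<And>x. x \<in> Grid x0 \<Longrightarrow> (\<forall>p\<in>P. U p x) \<or> (\<forall>p\<in>P. \<not> U p x) \<Longrightarrow> x \<in> A"
  shows "box_core P (wrap M A) B x0 U"
proof -
  interpret c: tiling_core P "wrap M A" B by (rule tiling_core)
  interpret g: grid_core P "wrap M A" B x0 by unfold_locales
  have L: "g.Lam z \<longleftrightarrow> z mod int M \<in> Grid x0" for z
    unfolding g.Lam_def Grid_def Zmod_def using M_pos by auto
  have G: "g.Lam z" if "z \<in> Grid x0" for z using that unfolding g.Lam_def Grid_def by auto
  show ?thesis
  proof unfold_locales
    show "U p x = U p y" if "p \<in> P" "eq2 p x y" for p x y using U[OF that] .
    show "\<exists>x. g.Lam x \<and> U p x" "\<exists>x. g.Lam x \<and> \<not> U p x" if "p \<in> P" for p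
      using ex[OF that] G by blast+
    show "wrap M A x" if x: "g.Lam x" "(\<forall>p\<in>P. U p x) \<or> (\<forall>p\<in>P. \<not> U p x)" for x
    proof -
      have "U p (x mod int M) \<longleftrightarrow> U p x" if "p \<in> P" for p using U[OF that, of "x mod int M" x] that by simp
      then show ?thesis using boxes[of "x mod int M"] x unfolding L wrap_def by blast
    qed
    show "b = b'" if "b \<in> B" "b' \<in> B" "\<And>p. p \<in> P \<Longrightarrow> eq1 p b b'" for b b' using inj[OF that] .
    show "\<exists>b\<in>B. \<forall>p\<in>P. eq1 p b n" for n by (rule B_residues[OF inj])
  qed
qed

text \<open>If two elements of \<open>B\<close> agree modulo \<open>D(M)\<close>, the gcd of their
  difference with \<open>M\<close> is one of the listed divisors, hence also attained in
  \<open>A\<close>; so the two elements coincide.\<close>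

lemma diagonal_boxes_shifts:
  assumes l: "labels i j k" and D: "{m. \<Prod>P dvd m \<and> m dvd M} \<subseteq> Div M (A \<inter> Grid x0)"
    and box: "diagonal_boxes M i j k (Grid x0) A"
  shows "T2_equivalent_via_fiber_shifts M P B A (Grid x0)"
proof -
  note P = labels_mem[OF l] and ne = l[unfolded labels_def]
  obtain x I J K where x: "x \<in> Grid x0" and IJK: "I \<noteq> {}" "I \<subset> {..<i}" "J \<noteq> {}" "J \<subset> {..<j}" "K \<noteq> {}" "K \<subset> {..<k}"
    and bx: "box M i j k x I J K \<union> box M i j k x ({..<i} - I) ({..<j} - J) ({..<k} - K) \<subseteq> A \<inter> Grid x0"
    using box unfolding diagonal_boxes_def by blast
  define S where "S p = (if p = i then I else if p = j then J else K)" for p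
  define U where "U p n \<longleftrightarrow> (\<exists>t\<in>S p. eq2 p n (x + int (t * (M div p))))" for p n
  have S: "S p \<noteq> {}" "S p \<subset> {..<p}" if "p \<in> P" for p
    using that IJK ne unfolding S_def by auto
  have U_iff: "U p n \<longleftrightarrow> t \<in> S p" if "p \<in> P" "t < p" "eq2 p n (x + int (t * (M div p)))" for p n t
  proof
    assume "U p n"
    then obtain s where s: "s \<in> S p" "eq2 p n (x + int (s * (M div p)))" unfolding U_def by blast
    have "s < p" using S(2)[OF that(1)] s by blast
    then have "s = t" using coord_unique[OF that(1) eq2_trans[OF eq2_sym[OF s(2)] that(3)]] that by blast
    then show "t \<in> S p" using s by simp
  qed (use that U_def in blast)
  have xe: "eq1 p (x + int (t * (M div p))) x" if "p \<in> P" for p t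
    using M_div(2)[OF that] unfolding eq1_def by (auto simp flip: of_nat_mult)
  have pt: "\<exists>y\<in>Grid x0. eq2 p y (x + int (t * (M div p)))" if p: "p \<in> P" for p t
  proof (rule bexI)
    show "eq2 p ((x + int (t * (M div p))) mod int M) (x + int (t * (M div p)))" using p by simp
    have "eq1 q (x + int (t * (M div p))) x" if "q \<in> P" for q
      using coord_other[OF p that] xe[OF p] eq2_imp_eq1 by (cases "q = p") auto
    then have "\<forall>q\<in>P. eq1 q (x + int (t * (M div p))) x0"
      using x eq1_trans unfolding Grid_def by blast
    then show "(x + int (t * (M div p))) mod int M \<in> Grid x0" by (rule Grid_mem)
  qed
  have "box_core P (wrap M A) B x0 U"
  proof (rule box_core_of_inj)
    fix b b' assume b: "b \<in> B" "b' \<in> B" "\<And>p. p \<in> P \<Longrightarrow> eq1 p b b'"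
    have "int (\<Prod>P) dvd b - b'" using b(3) unfolding prod_dvd_iff eq1_def by blast
    then have "\<Prod>P dvd gcdM M (b - b')" using gcdM_dvd[OF prod_dvd_M] by blast
    moreover have "gcdM M (b - b') dvd M" unfolding gcdM_def by (simp flip: int_dvd_int_iff)
    ultimately obtain a a' where a: "a \<in> A" "a' \<in> A" "gcdM M (a - a') = gcdM M (b - b')"
      using D unfolding Div_def by auto
    have e: "m dvd M \<Longrightarrow> int m dvd a - a' \<longleftrightarrow> int m dvd b - b'" for m using gcdM_dvd a(3) by metis
    show "b = b'"
    proof (rule sands_tiling[OF a(1,2) b(1,2)])
      show "eq1 p a a' \<longleftrightarrow> eq1 p b b'" "eq2 p a a' \<longleftrightarrow> eq2 p b b'" if "p \<in> P" for p
        using e[OF p_dvd_M(1)[OF that]] e[OF p_dvd_M(2)[OF that]] unfolding eq1_def eq2_def by auto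
    qed
  next
    show "U p n \<longleftrightarrow> U p m" if "p \<in> P" "eq2 p n m" for p n m
      unfolding U_def eq2_left[OF that(2)] ..
    show "\<exists>y\<in>Grid x0. U p y" if "p \<in> P" for p
      using S(1)[OF that] pt[OF that] unfolding U_def by blast
    show "\<exists>y\<in>Grid x0. \<not> U p y" if p: "p \<in> P" for p
    proof -
      obtain t where t: "t < p" "t \<notin> S p" using S(2)[OF p] by blast
      obtain y where "y \<in> Grid x0" "eq2 p y (x + int (t * (M div p)))" using pt[OF p] by blast
      then show ?thesis using U_iff[OF p t(1)] t by blast
    qed
    fix y assume y: "y \<in> Grid x0" "(\<forall>p\<in>P. U p y) \<or> (\<forall>p\<in>P. \<not> U p y)"
    have "\<forall>p\<in>P. \<exists>t<p. eq2 p y (x + int (t * (M div p)))"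
      using coord_ex[OF _ Grid_eq1[OF y(1) x]] by metis
    then obtain u v w where uvw: "u < i" "eq2 i y (x + int (u * (M div i)))" "v < j" "eq2 j y (x + int (v * (M div j)))"
      "w < k" "eq2 k y (x + int (w * (M div k)))" using P by blast
    have U3: "U i y \<longleftrightarrow> u \<in> I" "U j y \<longleftrightarrow> v \<in> J" "U k y \<longleftrightarrow> w \<in> K"
      using U_iff[of i u y] U_iff[of j v y] U_iff[of k w y] uvw P ne unfolding S_def by auto
    have "y = (x + int (u * (M div i) + v * (M div j) + w * (M div k))) mod int M"
      using mod_eq_sum[OF l uvw(2,4,6)] y(1) unfolding Grid_def Zmod_def by simp
    then have "y \<in> box M i j k x I J K \<union> box M i j k x ({..<i} - I) ({..<j} - J) ({..<k} - K)"
      using U3 y(2) uvw(1,3,5) unfolding labels_ball[OF l] box_def by blast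
    then show "y \<in> A" using bx by blast
  qed
  then show ?thesis using box_core_shifts tiling_setting_axioms by blast
qed

lemma almost_corner:
  assumes "almost_corner_structure M P (Grid x0) A"
  shows "T2_equivalent_via_fiber_shifts M P B A (Grid x0) \<or>
    (\<exists>A'. T2_equivalent M B A A' \<and> (\<exists>n\<in>P. corner M P n (Grid x0) A'))"
proof -
  obtain i j k and x :: "nat \<Rightarrow> int" and La Lb where ijk: "{i, j, k} = P"
    and x: "\<forall>l<k. x l \<in> Grid x0" "\<forall>l<k. \<forall>l'<k. l \<noteq> l' \<longrightarrow> gcdM M (x l - x l') = M div k"
    and L: "La \<inter> Lb = {}" "card La > 1" "card Lb > 1" "La \<union> Lb = {..<k}"
    and AL: "A \<inter> Grid x0 = {z \<in> Grid x0. (\<exists>l\<in>La. gcdM M (z - x l) = M div i) \<or>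
                           (\<exists>l\<in>Lb. gcdM M (z - x l) = M div j)}"
    using assms unfolding almost_corner_structure_def by (elim exE conjE) (rule that)
  have l: "labels i j k"
    unfolding labels_def using ijk card_P by (auto simp: card_insert_if split: if_splits)
  note P = labels_mem[OF l] and ne = l[unfolded labels_def]
  have Lk: "t < k" if "t \<in> La \<or> t \<in> Lb" for t using that L(4) by blast
  obtain l0 l1 where l01: "l0 \<in> La" "l1 \<in> Lb" using L(2,3) by (metis card.empty ex_in_conv not_less_zero)
  define c where "c = x l0"
  have c: "c \<in> Grid x0" using x(1) Lk l01 unfolding c_def by blast
  have xx: "\<not> eq2 k (x s) (x t) \<and> eq2 i (x s) (x t) \<and> eq2 j (x s) (x t)" if "s < k" "t < k" "s \<noteq> t" for s t
  proof -
    have st: "x s \<in> Grid x0" "x t \<in> Grid x0" "gcdM M (x s - x t) = M div k" using x that by blast+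
    then show ?thesis using gcdM_line[OF labels_perm(5)[OF l] Grid_eq1[OF st(1,2)]] by blast
  qed
  have xc: "eq2 i (x s) c" "eq2 j (x s) c" if "s < k" for s
    using xx[OF that Lk[of l0]] l01 unfolding c_def by (cases "s = l0"; auto)+
  \<comment> \<open>The \<open>k\<close> given points have pairwise distinct
    \<open>k\<close>-coordinates, so they exhaust all of them.\<close>
  have hit: "\<exists>s<k. eq2 k z (x s)" if z: "z \<in> Grid x0" for z
  proof -
    have kP: "k \<in> P" using P by simp
    have "\<forall>s. \<exists>t. s < k \<longrightarrow> t < k \<and> eq2 k (x s) (c + int (t * (M div k)))"
    proof
      fix s
      show "\<exists>t. s < k \<longrightarrow> t < k \<and> eq2 k (x s) (c + int (t * (M div k)))"
      proof (cases "s < k")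
        case True
        then have "x s \<in> Grid x0" using x(1) by blast
        from coord_ex[OF kP Grid_eq1[OF this c kP]] show ?thesis by blast
      qed blast
    qed
    then obtain h where h: "\<And>s. s < k \<Longrightarrow> h s < k \<and> eq2 k (x s) (c + int (h s * (M div k)))" by metis
    have "inj_on h {..<k}"
    proof (rule inj_onI)
      fix s t assume st: "s \<in> {..<k}" "t \<in> {..<k}" "h s = h t"
      then have "eq2 k (x s) (c + int (h t * (M div k)))" "eq2 k (x t) (c + int (h t * (M div k)))"
        using h[of s] h[of t] by auto
      then have "eq2 k (x s) (x t)" by (rule eq2_trans[OF _ eq2_sym])
      then show "s = t" using xx[of s t] st by auto
    qed
    then have "h ` {..<k} = {..<k}" using h by (intro endo_inj_surj) auto
    moreover obtain t where t: "t < k" "eq2 k z (c + int (t * (M div k)))"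
      by (rule coord_ex[OF kP Grid_eq1[OF z c kP]])
    ultimately have "t \<in> h ` {..<k}" by simp
    then obtain s where s: "s < k" "h s = t" by blast
    then show ?thesis using eq2_trans[OF t(2) eq2_sym] h[of s] by blast
  qed
  define U where "U z \<longleftrightarrow> (\<exists>s\<in>La. eq2 k z (x s))" for z
  have U_cong: "U y \<longleftrightarrow> U z" if "eq2 k y z" for y z unfolding U_def eq2_left[OF that] ..
  have nU: "\<not> U z \<longleftrightarrow> (\<exists>s\<in>Lb. eq2 k z (x s))" if z: "z \<in> Grid x0" for z
  proof
    assume "\<not> U z"
    then show "\<exists>s\<in>Lb. eq2 k z (x s)" using hit[OF z] L(4) unfolding U_def by blast
  next
    assume "\<exists>s\<in>Lb. eq2 k z (x s)"
    then obtain s where s: "s \<in> Lb" "eq2 k z (x s)" by blast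
    show "\<not> U z"
    proof
      assume "U z"
      then obtain t where t: "t \<in> La" "eq2 k z (x t)" unfolding U_def by blast
      then have "eq2 k (x s) (x t)" using s eq2_trans eq2_sym by blast
      then show False using xx[of s t] Lk s t L(1) by blast
    qed
  qed
  have A: "z \<in> A \<longleftrightarrow> (\<not> eq2 i z c \<and> eq2 j z c \<and> U z) \<or> (eq2 i z c \<and> \<not> eq2 j z c \<and> \<not> U z)"
    if z: "z \<in> Grid x0" for z
  proof -
    have e: "gcdM M (z - x s) = M div i \<longleftrightarrow> \<not> eq2 i z c \<and> eq2 j z c \<and> eq2 k z (x s)"
      "gcdM M (z - x s) = M div j \<longleftrightarrow> eq2 i z c \<and> \<not> eq2 j z c \<and> eq2 k z (x s)" if s: "s < k" for s
    proof -
      have xs: "x s \<in> Grid x0" using x s by blast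
      show "gcdM M (z - x s) = M div i \<longleftrightarrow> \<not> eq2 i z c \<and> eq2 j z c \<and> eq2 k z (x s)"
        using gcdM_line[OF l Grid_eq1[OF z xs]] eq2_right[OF xc(1)[OF s]] eq2_right[OF xc(2)[OF s]] by blast
      show "gcdM M (z - x s) = M div j \<longleftrightarrow> eq2 i z c \<and> \<not> eq2 j z c \<and> eq2 k z (x s)"
        using gcdM_line[OF labels_perm(1)[OF l] Grid_eq1[OF z xs]] eq2_right[OF xc(1)[OF s]] eq2_right[OF xc(2)[OF s]] by blast
    qed
    have "z \<in> A \<longleftrightarrow> (\<exists>s\<in>La. gcdM M (z - x s) = M div i) \<or> (\<exists>s\<in>Lb. gcdM M (z - x s) = M div j)"
      using AL z by blast
    also have "\<dots> \<longleftrightarrow> (\<not> eq2 i z c \<and> eq2 j z c \<and> U z) \<or> (eq2 i z c \<and> \<not> eq2 j z c \<and> \<not> U z)"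
      unfolding nU[OF z] using e Lk unfolding U_def by blast
    finally show ?thesis .
  qed
  have two: "\<exists>s\<in>Q. \<not> eq2 k (x s) w" if Q: "card Q > 1" "Q \<subseteq> {..<k}" for Q w
  proof (rule ccontr)
    assume n: "\<not> ?thesis"
    have "\<not> Q \<subseteq> {s}" for s using Q(1) card_mono[of "{s}" Q] by auto
    then obtain s t where st: "s \<in> Q" "t \<in> Q" "s \<noteq> t" by blast
    then have "eq2 k (x s) (x t)" using n eq2_trans eq2_sym by blast
    then show False using xx[of s t] st Q by blast
  qed
  interpret p: plane_core P "wrap M A" B x0 by (rule plane_core)
  have LG: "p.Lam z \<longleftrightarrow> z mod int M \<in> Grid x0" for z
    unfolding p.Lam_def Grid_def Zmod_def using M_pos by auto
  have GL: "p.Lam z" if "z \<in> Grid x0" for z using that unfolding p.Lam_def Grid_def by auto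
  interpret f: almost_corner_core P "wrap M A" B x0 i j k c U
  proof unfold_locales
    show "labels i j k" by (rule l)
    show "p.Lam c" by (rule GL[OF c])
    show "U y \<longleftrightarrow> U z" if "eq2 k y z" for y z using U_cong[OF that] .
    show "\<exists>y. p.Lam y \<and> U y \<and> \<not> eq2 k y w" for w
    proof -
      obtain s where s: "s \<in> La" "\<not> eq2 k (x s) w" using two[of La w] L by blast
      then have "p.Lam (x s)" using x(1) Lk GL by blast
      moreover have "U (x s)" unfolding U_def using s(1) eq2_refl by blast
      ultimately show ?thesis using s(2) by blast
    qed
    show "\<exists>y. p.Lam y \<and> \<not> U y \<and> \<not> eq2 k y w" for w
    proof -
      obtain s where s: "s \<in> Lb" "\<not> eq2 k (x s) w" using two[of Lb w] L by blast
      then have xs: "x s \<in> Grid x0" using x(1) Lk by blast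
      have "\<not> U (x s)" unfolding nU[OF xs] using s(1) eq2_refl by blast
      then show ?thesis using GL[OF xs] s(2) by blast
    qed
    show "wrap M A z \<longleftrightarrow> (\<not> eq2 i z c \<and> eq2 j z c \<and> U z) \<or> (eq2 i z c \<and> \<not> eq2 j z c \<and> \<not> U z)"
      if "p.Lam z" for z
      using A[of "z mod int M"] U_cong[of "z mod int M" z] that P unfolding LG wrap_def by simp
  qed
  from f.shifts_or_inj show ?thesis
  proof
    assume sh: "\<forall>b0\<in>B. p.shifts b0 k c"
    \<comment> \<open>The plane at an index from \<open>La\<close> contains a punctured
      \<open>i\<close>-line, the one at an index from \<open>Lb\<close> a punctured
      \<open>j\<close>-line.\<close>
    have "\<exists>A'. T2_equivalent M B A A' \<and> (\<exists>n\<in>P. corner M P n (Grid x0) A')"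
    proof (rule corner_of_shift[of k i j c x0 "x l1"])
      have l1: "x l1 \<in> Grid x0" "l1 < k" "l1 \<noteq> l0" "l0 < k" using x Lk l01 L(1) by auto
      show "labels k i j" using labels_perm(5)[OF l] .
      show "p.shifts b0 k c" if "b0 \<in> B" for b0 using sh that by blast
      show "c \<in> Grid x0" "x l1 \<in> Grid x0" using c l1 by auto
      show "\<not> eq2 k c (x l1)" "eq2 i c (x l1)" "eq2 j c (x l1)"
        using xx[of l0 l1] l1 unfolding c_def by auto
      have Uc: "U c" unfolding U_def c_def using l01(1) eq2_refl by blast
      have U1: "\<not> U (x l1)" using nU[OF l1(1)] l01(2) eq2_refl by blast
      show "y \<in> A \<longleftrightarrow> \<not> eq2 i y c \<and> eq2 j y c" if "y \<in> Grid x0" "eq2 k y c" for y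
        using A[OF that(1)] U_cong[OF that(2)] Uc by blast
      show "y \<in> A \<longleftrightarrow> eq2 i y (x l1) \<and> \<not> eq2 j y (x l1)" if "y \<in> Grid x0" "eq2 k y (x l1)" for y
        using A[OF that(1)] U_cong[OF that(2)] U1 eq2_right[OF xc(1)[OF l1(2)], of y] eq2_right[OF xc(2)[OF l1(2)], of y] by blast
    qed
    then show ?thesis ..
  next
    assume inj: "\<forall>b\<in>B. \<forall>b'\<in>B. (\<forall>p\<in>P. eq1 p b b') \<longrightarrow> b = b'"
    \<comment> \<open>The almost corner as diagonal boxes: all \<open>i\<close>-coordinates but that
      of \<open>c\<close>, the single \<open>j\<close>-coordinate of \<open>c\<close>, and the
      \<open>k\<close>-coordinates in \<open>U\<close>. The complementary box consists of the other
      family of lines.\<close>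
    define V where "V p z \<longleftrightarrow> (if p = i then \<not> eq2 i z c else if p = j then eq2 j z c else U z)" for p z
    have "box_core P (wrap M A) B x0 V"
    proof (rule box_core_of_inj)
      show "b = b'" if "b \<in> B" "b' \<in> B" "\<And>p. p \<in> P \<Longrightarrow> eq1 p b b'" for b b' using inj that by blast
      show "V p y \<longleftrightarrow> V p z" if "p \<in> P" "eq2 p y z" for p y z
        using that ne U_cong[of y z] eq2_left[of p y z c] unfolding V_def by auto
      have Vx: "z \<in> A" if "z \<in> Grid x0" "(\<forall>p\<in>P. V p z) \<or> (\<forall>p\<in>P. \<not> V p z)" for z
        using A[OF that(1)] that(2) ne unfolding labels_ball[OF l] V_def by auto
      then show "z \<in> A" if "z \<in> Grid x0" "(\<forall>p\<in>P. V p z) \<or> (\<forall>p\<in>P. \<not> V p z)" for z using that .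
      have third: "\<exists>w\<in>Grid x0. \<not> eq2 q w c" if q: "q \<in> P" for q
      proof -
        obtain w where w: "p.Lam w" "\<not> eq2 q w c" using p.third_point[OF q GL[OF c], of c c] by metis
        then have "w mod int M \<in> Grid x0" "\<not> eq2 q (w mod int M) c" using LG q by auto
        then show ?thesis by blast
      qed
      have l1: "x l1 \<in> Grid x0" using x(1) Lk l01 by blast
      have Uc: "U c" unfolding U_def c_def using l01(1) eq2_refl by blast
      have U1: "\<not> U (x l1)" using nU[OF l1] l01(2) eq2_refl by blast
      have V: "V i z \<longleftrightarrow> \<not> eq2 i z c" "V j z \<longleftrightarrow> eq2 j z c" "V k z \<longleftrightarrow> U z" for z
        using ne unfolding V_def by auto
      have "\<forall>p\<in>P. \<exists>z\<in>Grid x0. V p z" "\<forall>p\<in>P. \<exists>z\<in>Grid x0. \<not> V p z"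
        unfolding labels_ball[OF l] V not_not
        using third[of i] third[of j] P c Uc l1 U1 eq2_refl by blast+
      then show "\<exists>z\<in>Grid x0. V p z" "\<exists>z\<in>Grid x0. \<not> V p z" if "p \<in> P" for p
        using that by blast+
    qed
    from box_core_shifts[OF tiling_setting_axioms this] show ?thesis ..
  qed
qed

end

theorem theorem7p1:
  fixes p\<^sub>i p\<^sub>j p\<^sub>k M D :: nat and P :: "nat set" and A B \<Lambda> :: "int set"
  defines "M \<equiv> p\<^sub>i\<^sup>2 * p\<^sub>j\<^sup>2 * p\<^sub>k\<^sup>2"
    and "D \<equiv> p\<^sub>i * p\<^sub>j * p\<^sub>k"
    and "P \<equiv> {p\<^sub>i, p\<^sub>j, p\<^sub>k}"
  assumes "prime p\<^sub>i" "prime p\<^sub>j" "prime p\<^sub>k"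
    and "p\<^sub>i \<ge> 3" "p\<^sub>j \<ge> 3" "p\<^sub>k \<ge> 3"
    and "p\<^sub>i \<noteq> p\<^sub>j" "p\<^sub>i \<noteq> p\<^sub>k" "p\<^sub>j \<noteq> p\<^sub>k"
    and "tiling M A B"
    and "card A = p\<^sub>i * p\<^sub>j * p\<^sub>k" "card B = p\<^sub>i * p\<^sub>j * p\<^sub>k"
    and "cyclotomic M dvd mask_poly A"
    and "\<exists>x\<in>Zmod M. \<Lambda> = grid M D x"
    and "A \<inter> \<Lambda> \<noteq> {}"
    and "\<forall>\<nu>\<in>P. \<not> fibered M \<nu> (A \<inter> \<Lambda>)"
    and "({m. D dvd m \<and> m dvd M} \<subseteq> Div M (A \<inter> \<Lambda>) \<and> diagonal_boxes M p\<^sub>i p\<^sub>j p\<^sub>k \<Lambda> A) \<or>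
         full_plane_structure M P \<Lambda> A \<or>
         almost_corner_structure M P \<Lambda> A"
  shows "(T2_equivalent_via_fiber_shifts M P B A \<Lambda> \<or>
          (\<exists>A'. T2_equivalent M B A A' \<and> (\<exists>\<nu>\<in>P. corner M P \<nu> \<Lambda> A'))) \<and>
         (T2_equivalent_via_fiber_shifts M P B A \<Lambda> \<longrightarrow>
            (\<exists>F x. is_flat M P A F \<and> \<Lambda> = sumset M {x} F) \<and> T2 M A \<and> T2 M B)"
proof -
  have ne: "p\<^sub>i \<noteq> p\<^sub>j" "p\<^sub>i \<noteq> p\<^sub>k" "p\<^sub>j \<noteq> p\<^sub>k" using assms by auto
  have D: "D = \<Prod>P" unfolding D_def P_def using ne by (simp add: mult.assoc)
  interpret prime_triple P
    using assms(4-9) ne unfolding P_def by unfold_locales auto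
  interpret t: tiling_setting P M A B
  proof unfold_locales
    show "M = (\<Prod>p\<in>P. p\<^sup>2)" unfolding M_def P_def using ne by (simp add: mult.assoc)
    show "card A = \<Prod>P" "card B = \<Prod>P" using assms(14,15) D unfolding D_def by auto
    show "tiling M A B" by (rule assms(13))
  qed
  have l: "labels p\<^sub>i p\<^sub>j p\<^sub>k" unfolding labels_def using ne by (simp add: P_def)
  obtain x0 where \<Lambda>: "\<Lambda> = t.Grid x0" using assms(17) t.grid_eq unfolding D by blast
  have "T2_equivalent_via_fiber_shifts M P B A \<Lambda> \<or>
      (\<exists>A'. T2_equivalent M B A A' \<and> (\<exists>\<nu>\<in>P. corner M P \<nu> \<Lambda> A'))"
    using assms(20) t.diagonal_boxes_shifts[OF l] t.full_plane_corner t.almost_corner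
    unfolding \<Lambda> D by blast
  moreover have "(\<exists>F x. is_flat M P A F \<and> \<Lambda> = sumset M {x} F) \<and> T2 M A \<and> T2 M B"
    if "T2_equivalent_via_fiber_shifts M P B A \<Lambda>"
    using t.T2_and_flat_of_Grid[of x0] that unfolding \<Lambda> T2_equivalent_via_fiber_shifts_def by blast
  ultimately show ?thesis by blast
qed

end
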